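(* Let $\Omega\subset\mathbb{R}^2$ be an isosceles right triangle, and let $0=\lambda_1<\lambda_2\le\lambda_3\le\cdots$ be the eigenvalues of the Neumann Laplacian on $\Omega$, listed with multiplicity. The Courant-sharp eigenvalues of the Neumann Laplacian on $\Omega$ are exactly $\lambda_1,\lambda_2,\lambda_3,\lambda_4,\lambda_6$.
   Context: The Neumann eigenvalue problem on a bounded domain $\Omega$ is $-\Delta\varphi=\lambda\varphi$ in $\Omega$ with $\partial\varphi/\partial\vec n=0$ on $\partial\Omega$. For an eigenvalue $\lambda$ put $N(\lambda):=|\{j : \lambda_j<\lambda\}|+1$. For an eigenfunction $\varphi$ let $\nu(\varphi)$ be the number of connected components of $\Omega\setminus\varphi^{-1}(0)$ (nodal domains; $\Omega$ is the open domain). An eigenfunction $\varphi$ with eigenvalue $\lambda$ is Courant-sharp if $\nu(\varphi)=N(\lambda)$; an eigenvalue $\lambda$ is Courant-sharp if it has a Courant-sharp eigenfunction. *)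

theory Defs
  imports "HOL-Analysis.Analysis" "HOL-Library.Function_Algebras"
begin

global_interpretation fun_space: vector_space "\<lambda>(c::real) (f::'a \<Rightarrow> real) x. c * f x"
  by unfold_locales (auto simp: fun_eq_iff algebra_simps)

definition isosceles_right_triangle :: "(real^2) set \<Rightarrow> bool" where
  "isosceles_right_triangle \<Omega> \<longleftrightarrow>
     (\<exists>a b c. a \<noteq> b \<and> (b - a) \<bullet> (c - a) = 0 \<and> dist a b = dist a c \<and>
        \<Omega> = interior (convex hull {a, b, c}))"

text \<open>
  \<open>n\<close> is the outward unit normal at the boundary point \<open>x\<close>: near \<open>x\<close>, the set \<open>\<Omega>\<close> agrees with
  the half-space \<open>{y. n \<bullet> (y - x) < 0}\<close> up to cones of arbitrarily small opening around its
  boundary hyperplane. A corner of a polygon has no such normal, so that the Neumann condition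
  imposes nothing there.
\<close>

definition outward_unit_normal :: "'a::euclidean_space set \<Rightarrow> 'a \<Rightarrow> 'a \<Rightarrow> bool" where
  "outward_unit_normal \<Omega> x n \<longleftrightarrow> x \<in> frontier \<Omega> \<and> norm n = 1 \<and>
     (\<forall>e>0. \<forall>\<^sub>F y in at x.
        (n \<bullet> (y - x) < - e * norm (y - x) \<longrightarrow> y \<in> \<Omega>) \<and>
        (n \<bullet> (y - x) > e * norm (y - x) \<longrightarrow> y \<notin> \<Omega>))"

text \<open>
  Classical real solutions \<open>\<phi> \<in> C\<^sup>2(\<Omega>) \<inter> C\<^sup>1(closure \<Omega>)\<close> of the Neumann problem, the zero function
  included; \<open>g\<close> is the gradient and \<open>H\<close> the Hessian of \<open>\<phi>\<close>, so the sum over \<open>Basis\<close> is the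
  Laplacian. Functions on \<open>closure \<Omega>\<close> are represented by their extension by \<open>0\<close>; otherwise the
  dimension of this space would count arbitrary values outside \<open>closure \<Omega>\<close>.
\<close>

definition neumann_eigenspace :: "'a::euclidean_space set \<Rightarrow> real \<Rightarrow> ('a \<Rightarrow> real) set" where
  "neumann_eigenspace \<Omega> \<mu> =
     {\<phi>. (\<forall>x. x \<notin> closure \<Omega> \<longrightarrow> \<phi> x = 0) \<and>
        (\<exists>g H.
           (\<forall>x\<in>closure \<Omega>. (\<phi> has_derivative (\<lambda>h. g x \<bullet> h)) (at x within closure \<Omega>)) \<and>
           continuous_on (closure \<Omega>) g \<and>
           (\<forall>x\<in>\<Omega>. (g has_derivative H x) (at x)) \<and>
           (\<forall>h. continuous_on \<Omega> (\<lambda>x. H x h)) \<and>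
           (\<forall>x\<in>\<Omega>. - (\<Sum>b\<in>Basis. H x b \<bullet> b) = \<mu> * \<phi> x) \<and>
           (\<forall>x n. outward_unit_normal \<Omega> x n \<longrightarrow> g x \<bullet> n = 0))}"

definition neumann_eigenfunction :: "'a::euclidean_space set \<Rightarrow> real \<Rightarrow> ('a \<Rightarrow> real) \<Rightarrow> bool" where
  "neumann_eigenfunction \<Omega> \<mu> \<phi> \<longleftrightarrow> \<phi> \<in> neumann_eigenspace \<Omega> \<mu> \<and> \<phi> \<noteq> 0"

text \<open>
  \<open>lam 1 \<le> lam 2 \<le> \<dots>\<close> lists the eigenvalues with multiplicity (\<open>lam 0\<close> is irrelevant): every real
  \<open>\<mu>\<close> occurs exactly as often as the eigenspace has dimensions, hence not at all unless it is an
  eigenvalue. A finite basis is required because the library's \<open>dim\<close> and \<open>card\<close> are \<open>0\<close> in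
  infinite cases.
\<close>

definition neumann_eigenvalue_listing :: "'a::euclidean_space set \<Rightarrow> (nat \<Rightarrow> real) \<Rightarrow> bool" where
  "neumann_eigenvalue_listing \<Omega> lam \<longleftrightarrow> mono_on {1..} lam \<and>
     (\<forall>\<mu>. \<exists>B. finite B \<and> fun_space.independent B \<and> fun_space.span B = neumann_eigenspace \<Omega> \<mu> \<and>
        finite {j. 1 \<le> j \<and> lam j = \<mu>} \<and> card {j. 1 \<le> j \<and> lam j = \<mu>} = card B)"

definition counting_number :: "(nat \<Rightarrow> real) \<Rightarrow> real \<Rightarrow> nat" where
  "counting_number lam \<mu> = card {j. 1 \<le> j \<and> lam j < \<mu>} + 1"

definition nodal_domains :: "'a::euclidean_space set \<Rightarrow> ('a \<Rightarrow> real) \<Rightarrow> 'a set set" where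
  "nodal_domains \<Omega> \<phi> = components (\<Omega> - \<phi> -` {0})"

text \<open>
  Since \<open>counting_number\<close> is positive, the equation below also forces \<open>nodal_domains \<Omega> \<phi>\<close> to be
  finite.
\<close>

definition courant_sharp_eigenfunction ::
    "'a::euclidean_space set \<Rightarrow> (nat \<Rightarrow> real) \<Rightarrow> real \<Rightarrow> ('a \<Rightarrow> real) \<Rightarrow> bool" where
  "courant_sharp_eigenfunction \<Omega> lam \<mu> \<phi> \<longleftrightarrow>
     neumann_eigenfunction \<Omega> \<mu> \<phi> \<and> card (nodal_domains \<Omega> \<phi>) = counting_number lam \<mu>"

definition courant_sharp_eigenvalue ::
    "'a::euclidean_space set \<Rightarrow> (nat \<Rightarrow> real) \<Rightarrow> real \<Rightarrow> bool" where
  "courant_sharp_eigenvalue \<Omega> lam \<mu> \<longleftrightarrow> (\<exists>\<phi>. courant_sharp_eigenfunction \<Omega> lam \<mu> \<phi>)"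

end

theory Submission
  imports Defs
begin

text \<open>
  After a similarity, \<open>\<Omega>\<close> is the triangle \<open>0 < y < x < pi\<close>, whose eigenfunctions are the modes
  \<open>cos (m * x) * cos (n * y) + cos (n * x) * cos (m * y)\<close> with eigenvalue \<open>m\<^sup>2 + n\<^sup>2\<close>.

  Write an eigenvalue \<open>\<mu> > 0\<close> as \<open>2 ^ k * m\<close> with \<open>m\<close> odd. The map \<open>(x, y) \<mapsto> (x + y, x - y)\<close> turns modes
  into modes and doubles their eigenvalues; hence all eigenfunctions for \<open>\<mu>\<close> vanish on a common grid.
  If \<open>m \<ge> 3\<close>, then products of cosines of real frequencies, folded along the grid, give a continuous
  function \<open>e\<close> that solves the Neumann problem for \<open>\<mu>\<close> off the grid, does not vanish on all of the grid, and
  has energy at most \<open>\<mu>\<close> times its squared norm. As an eigenfunction \<open>\<phi>\<close> for \<open>\<mu>\<close> vanishes where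
  \<open>\<nabla> e\<close> jumps, every linear combination of \<open>e\<close> and the restrictions of \<open>\<phi>\<close> to its nodal domains
  has Rayleigh quotient at most \<open>\<mu>\<close>. If \<open>\<phi>\<close> had more nodal domains than there are
  eigenvalues below \<open>\<mu>\<close>, then a nontrivial combination omitting one nodal domain would be orthogonal to
  all lower modes, hence an eigenfunction for \<open>\<mu>\<close>; evaluating on the grid shows that it does not
  involve \<open>e\<close>, so it vanishes on the omitted domain and therefore everywhere, a contradiction.
  Thus \<open>\<mu>\<close> is not Courant-sharp.

  If \<open>m = 1\<close>, then \<open>\<mu>\<close> is simple and its nodal domains are convex cells of the grid; there are too few
  of them as soon as \<open>\<mu> \<ge> 16\<close>.
\<close>


section \<open>Integration over the triangle\<close>

text \<open>The gradient of \<open>e\<close> may jump because every function paired with it vanishes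
  on the grid, so no flux is left in the mixed terms. The energy of \<open>e\<close> itself is not
  protected in this way: integrating by parts leaves boundary terms on the grid, and their sum must
  be nonpositive. A cell of the grid is a scaled copy of the square of side \<open>pi\<close>, cut
  by its diagonal in the model case, and the scaling turns \<open>2 ^ k * m\<close> into
  \<open>p^2 + q^2 = m / 2\<close>. As \<open>m\<close> is odd, \<open>p\<close> and
  \<open>q\<close> cannot both be integers, so the boundary terms cannot be removed by Neumann
  conditions for both cosines. Instead \<open>q\<close> is taken to be an integer or a half-integer,
  so that \<open>cos (q * x)\<close> satisfies a Neumann or a Dirichlet condition at
  \<open>pi\<close>, and \<open>p\<close> is placed where the remaining terms have the right sign.
  For \<open>m = 1\<close> no such pair can exist, because 1, 2, 4 and 8 are Courant-sharp. A second
  obstacle is regularity: a restriction of an eigenfunction to a nodal domain is not C^1, and a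
  general eigenfunction is C^2 only in the open triangle. The first is met by a smooth cut-off near
  the nodal set, the second by shrinking the triangle.\<close>

definition tri :: "(real \<times> real) set" where
  "tri = {(x, y). 0 < y \<and> y < x \<and> x < pi}"

definition ctri :: "(real \<times> real) set" where
  "ctri = {(x, y). 0 \<le> y \<and> y \<le> x \<and> x \<le> pi}"

lemma mem_tri [simp]: "(x, y) \<in> tri \<longleftrightarrow> 0 < y \<and> y < x \<and> x < pi"
  by (simp add: tri_def)

lemma mem_ctri [simp]: "(x, y) \<in> ctri \<longleftrightarrow> 0 \<le> y \<and> y \<le> x \<and> x \<le> pi"
  by (simp add: ctri_def)

lemma tri_eq: "tri = {z. 0 < snd z} \<inter> {z. snd z < fst z} \<inter> {z. fst z < pi}"
  by (auto simp: tri_def)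

lemma ctri_eq: "ctri = {z. 0 \<le> snd z} \<inter> {z. snd z \<le> fst z} \<inter> {z. fst z \<le> pi}"
  by (auto simp: ctri_def)

lemma open_tri [simp]: "open tri"
  unfolding tri_eq by (intro open_Int open_Collect_less continuous_intros)

lemma closed_ctri [simp]: "closed ctri"
  unfolding ctri_eq by (intro closed_Int closed_Collect_le continuous_intros)

lemma ctri_subset_square: "ctri \<subseteq> {0..pi} \<times> {0..pi}"
  by (auto simp: ctri_def)

lemma compact_ctri [simp]: "compact ctri"
  using compact_Int_closed[OF compact_Times[OF compact_Icc compact_Icc, of 0 pi 0 pi] closed_ctri]
    ctri_subset_square by (simp add: inf.absorb2)

lemma tri_subset_ctri: "tri \<subseteq> ctri"
  by (auto simp: tri_def ctri_def)

lemma convex_tri [simp]: "convex tri"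
proof -
  have "linear (snd :: real \<times> real \<Rightarrow> real)" "linear (\<lambda>z::real \<times> real. fst z - snd z)" "linear (fst :: real \<times> real \<Rightarrow> real)"
    by (auto intro!: linearI simp: algebra_simps)
  from convex_linear_vimage[OF this(1), of "{0<..}"] convex_linear_vimage[OF this(2), of "{0<..}"]
    convex_linear_vimage[OF this(3), of "{..<pi}"]
  have "convex (snd -` {0<..} \<inter> (\<lambda>z. fst z - snd z) -` {0<..} \<inter> fst -` {..<pi} :: (real \<times> real) set)"
    by (intro convex_Int) auto
  also have "\<dots> = tri" by (auto simp: tri_def)
  finally show ?thesis .
qed

text \<open>The target point is the centroid. Contraction towards it carries the closed triangle
  into the open one; this yields the closure of \<open>tri\<close> and, later, the shrunk triangles
  on which Green's formula is applied to eigenfunctions.\<close>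

lemma ctri_scale:
  assumes "z \<in> ctri" "0 < t" "t \<le> 1"
  shows "(1 - t) *\<^sub>R z + t *\<^sub>R (2 * pi / 3, pi / 3) \<in> tri"
proof -
  obtain x y where z: "z = (x, y)" and *: "0 \<le> y" "y \<le> x" "x \<le> pi"
    using assms(1) by (cases z) auto
  have "0 \<le> (1 - t) * y" "(1 - t) * y \<le> (1 - t) * x" "(1 - t) * x \<le> (1 - t) * pi"
    using * assms by (auto intro!: mult_left_mono)
  moreover have "0 < t * (pi / 3)" using assms by simp
  ultimately show ?thesis
    unfolding z by (auto simp: algebra_simps)
qed

lemma closure_tri [simp]: "closure tri = ctri"
proof
  show "closure tri \<subseteq> ctri"
    by (rule closure_minimal[OF tri_subset_ctri closed_ctri])
next
  show "ctri \<subseteq> closure tri"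
  proof
    fix z assume z: "z \<in> ctri"
    define g where "g n = (1 - inverse (real (Suc n))) *\<^sub>R z + inverse (real (Suc n)) *\<^sub>R (2 * pi / 3, pi / 3)" for n
    have "g n \<in> tri" for n
      unfolding g_def by (rule ctri_scale[OF z]) (auto simp: field_simps)
    moreover have "g \<longlonglongrightarrow> (1 - 0) *\<^sub>R z + 0 *\<^sub>R (2 * pi / 3, pi / 3)"
      unfolding g_def by (intro tendsto_intros LIMSEQ_inverse_real_of_nat)
    ultimately show "z \<in> closure tri"
      unfolding closure_sequential by (intro exI[of _ g]) (simp flip: zero_prod_def)
  qed
qed

lemma tri_nonempty: "tri \<noteq> {}"
proof -
  have "(2 * pi / 3, pi / 3) \<in> tri" by simp
  then show ?thesis by blast
qed

section \<open>Bounded measurable integrands on the triangle\<close>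

definition tint :: "(real \<times> real \<Rightarrow> real) \<Rightarrow> real" where
  "tint h = (LINT z|lborel. indicator ctri z * h z)"

text \<open>Bounded measurable rather than continuous, since the gradient of the extra test function
  jumps. The class is closed under products, and its members are integrable over the compact
  triangle.\<close>

definition bmeas :: "(real \<times> real \<Rightarrow> real) \<Rightarrow> bool" where
  "bmeas h \<longleftrightarrow> (\<lambda>z. indicator ctri z * h z) \<in> borel_measurable borel \<and> (\<exists>B. \<forall>z\<in>ctri. \<bar>h z\<bar> \<le> B)"

lemma indicator_ctri_borel [measurable]: "(indicator ctri :: _ \<Rightarrow> real) \<in> borel_measurable borel"
  by (intro borel_measurable_indicator) (simp add: borel_closed)

lemma emeasure_ctri_finite: "emeasure lborel ctri < \<infinity>"
  using emeasure_compact_finite[OF compact_ctri] by simp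

lemma integrable_bmeas: assumes "bmeas h" shows "integrable lborel (\<lambda>z. indicator ctri z * h z)"
proof -
  obtain B where B: "\<forall>z\<in>ctri. \<bar>h z\<bar> \<le> B" and m: "(\<lambda>z. indicator ctri z * h z) \<in> borel_measurable borel"
    using assms by (auto simp: bmeas_def)
  have "integrable lborel (\<lambda>z. indicator ctri z * B :: real)"
    using emeasure_ctri_finite by (intro integrable_mult_left integrable_real_indicator) (auto simp: borel_closed)
  then show ?thesis
    by (rule Bochner_Integration.integrable_bound) (use m B in \<open>auto split: split_indicator\<close>, fastforce)
qed

lemma bmeas_continuous: assumes "continuous_on ctri h" shows "bmeas h"
proof -
  have "(\<lambda>z. indicator ctri z * h z) \<in> borel_measurable borel"
    using borel_integrable_compact[OF compact_ctri assms] by (auto dest: borel_measurable_integrable)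
  moreover have "bounded (h ` ctri)"
    using assms by (intro compact_imp_bounded compact_continuous_image) auto
  ultimately show ?thesis
    unfolding bmeas_def bounded_iff by auto
qed

lemma bmeas_bounded_borel:
  assumes "h \<in> borel_measurable borel" "\<And>z. \<bar>h z\<bar> \<le> B" shows "bmeas h"
  unfolding bmeas_def using assms by (intro conjI exI[of _ B] borel_measurable_times indicator_ctri_borel) simp_all

lemma bmeas_add [intro]: assumes "bmeas f" "bmeas g" shows "bmeas (\<lambda>z. f z + g z)"
proof -
  obtain A B where "\<forall>z\<in>ctri. \<bar>f z\<bar> \<le> A" "\<forall>z\<in>ctri. \<bar>g z\<bar> \<le> B" using assms by (auto simp: bmeas_def)
  then have "\<forall>z\<in>ctri. \<bar>f z + g z\<bar> \<le> A + B" by (meson abs_triangle_ineq add_mono order_trans)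
  then show ?thesis using assms by (auto simp: bmeas_def distrib_left)
qed

lemma bmeas_mult [intro]: assumes "bmeas f" "bmeas g" shows "bmeas (\<lambda>z. f z * g z)"
proof -
  obtain A B where "\<forall>z\<in>ctri. \<bar>f z\<bar> \<le> A" "\<forall>z\<in>ctri. \<bar>g z\<bar> \<le> B" using assms by (auto simp: bmeas_def)
  then have "\<forall>z\<in>ctri. \<bar>f z * g z\<bar> \<le> A * B"
    by (simp add: abs_mult) (meson abs_ge_zero mult_mono order_trans)
  moreover have "(\<lambda>z. indicator ctri z * (f z * g z)) = (\<lambda>z. (indicator ctri z * f z) * (indicator ctri z * g z))"
    by (auto split: split_indicator)
  ultimately show ?thesis using assms by (auto simp: bmeas_def)
qed

lemma bmeas_const [intro]: "bmeas (\<lambda>z. c)"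
  by (intro bmeas_continuous continuous_intros)

lemma bmeas_minus [intro]: "bmeas f \<Longrightarrow> bmeas (\<lambda>z. - f z)"
  using bmeas_mult[OF bmeas_const[of "-1"], of f] by simp

lemma bmeas_diff [intro]: "bmeas f \<Longrightarrow> bmeas g \<Longrightarrow> bmeas (\<lambda>z. f z - g z)"
  using bmeas_add[OF _ bmeas_minus, of f g] by simp

lemma bmeas_power2 [intro]: "bmeas f \<Longrightarrow> bmeas (\<lambda>z. (f z)\<^sup>2)"
  by (simp add: power2_eq_square bmeas_mult)

lemma bmeas_sum [intro]: "(\<And>i. i \<in> A \<Longrightarrow> bmeas (f i)) \<Longrightarrow> bmeas (\<lambda>z. \<Sum>i\<in>A. f i z)"
  by (induction A rule: infinite_finite_induct) auto

lemma tint_cong: "(\<And>z. z \<in> ctri \<Longrightarrow> f z = g z) \<Longrightarrow> tint f = tint g"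
  unfolding tint_def by (intro Bochner_Integration.integral_cong) (auto split: split_indicator)

lemma tint_add: "bmeas f \<Longrightarrow> bmeas g \<Longrightarrow> tint (\<lambda>z. f z + g z) = tint f + tint g"
  unfolding tint_def distrib_left by (intro Bochner_Integration.integral_add integrable_bmeas)

lemma tint_diff: "bmeas f \<Longrightarrow> bmeas g \<Longrightarrow> tint (\<lambda>z. f z - g z) = tint f - tint g"
  unfolding tint_def right_diff_distrib by (intro Bochner_Integration.integral_diff integrable_bmeas)

lemma tint_cmult: "tint (\<lambda>z. c * f z) = c * tint f"
  unfolding tint_def by (simp add: mult.left_commute)

lemma tint_minus: "tint (\<lambda>z. - f z) = - tint f"
  unfolding tint_def by simp

lemma tint_sum: "(\<And>i. i \<in> A \<Longrightarrow> bmeas (f i)) \<Longrightarrow> tint (\<lambda>z. \<Sum>i\<in>A. f i z) = (\<Sum>i\<in>A. tint (f i))"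
proof (induction A rule: infinite_finite_induct)
  case (insert x F)
  then show ?case by (simp add: tint_add bmeas_sum)
qed (simp_all add: tint_def)

lemma tint_mono: "bmeas f \<Longrightarrow> bmeas g \<Longrightarrow> (\<And>z. z \<in> ctri \<Longrightarrow> f z \<le> g z) \<Longrightarrow> tint f \<le> tint g"
  unfolding tint_def by (rule integral_mono[OF integrable_bmeas integrable_bmeas]) (simp_all add: mult_left_mono indicator_def)

lemma tint_nonneg: "(\<And>z. z \<in> ctri \<Longrightarrow> 0 \<le> f z) \<Longrightarrow> 0 \<le> tint f"
  unfolding tint_def by (rule Bochner_Integration.integral_nonneg) (simp add: indicator_def)

text \<open>Inside \<open>tri\<close>, the set where \<open>f\<close> is nonzero is open and null,
  hence empty; continuity extends this to the closure.\<close>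

lemma tint_eq_0_imp:
  assumes c: "continuous_on ctri f" and nn: "\<And>z. z \<in> ctri \<Longrightarrow> 0 \<le> f z" and 0: "tint f = 0" and z: "z \<in> ctri"
  shows "f z = 0"
proof -
  have "AE z in lborel. indicator ctri z * f z = 0"
    using 0 unfolding tint_def
    by (subst (asm) integral_nonneg_eq_0_iff_AE) (auto simp: nn integrable_bmeas bmeas_continuous c split: split_indicator)
  then have *: "AE z in lborel. \<not> (z \<in> tri \<and> f z \<noteq> 0)"
    by eventually_elim (use tri_subset_ctri in \<open>auto split: split_indicator_asm\<close>)
  have op: "open {z \<in> tri. f z \<noteq> 0}"
  proof -
    have "open (tri \<inter> f -` (- {0}))"
      by (intro continuous_open_preimage continuous_on_subset[OF c] tri_subset_ctri) auto
    moreover have "tri \<inter> f -` (- {0}) = {z \<in> tri. f z \<noteq> 0}" by auto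
    ultimately show ?thesis by simp
  qed
  have "{z \<in> tri. f z \<noteq> 0} = {}"
  proof (rule ccontr)
    assume ne: "{z \<in> tri. f z \<noteq> 0} \<noteq> {}"
    have "emeasure lborel {z \<in> tri. f z \<noteq> 0} = 0"
      using * op by (subst (asm) AE_iff_measurable[OF _ refl]) (auto simp: borel_open)
    then show False
      using open_not_negligible[OF op ne] op by (auto simp: negligible_iff_null_sets null_sets_def borel_open)
  qed
  then have eq0: "f z = 0" if "z \<in> tri" for z using that by blast
  show ?thesis
    using continuous_constant_on_closure[of tri f 0 z] c eq0 z by simp
qed

section \<open>Divergence theorem and Green's formula on the triangle\<close>

text \<open>The exceptional set \<open>S\<close> is meant for the points where a line crosses the
  grid: there \<open>P\<close> is continuous but may have a kink.\<close>

lemma lborel_integral_FTC: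
  fixes P p :: "real \<Rightarrow> real"
  assumes "finite S" "a \<le> b" "\<And>x. x \<in> {a<..<b} - S \<Longrightarrow> (P has_real_derivative p x) (at x)"
    and "continuous_on {a..b} P" and int: "integrable lborel (\<lambda>x. indicator {a..b} x * p x)"
  shows "(LINT x|lborel. indicator {a..b} x * p x) = P b - P a"
proof -
  have "(p has_integral (P b - P a)) {a..b}"
    using assms by (intro fundamental_theorem_of_calculus_interior_strong) (auto simp: has_real_derivative_iff_has_vector_derivative)
  then have "((\<lambda>x. indicator {a..b} x * p x) has_integral (P b - P a)) UNIV"
    by (subst (asm) has_integral_restrict_UNIV[symmetric]) (simp add: indicator_def of_bool_def if_distrib[of "\<lambda>c. c * _"] cong: if_cong)
  then show ?thesis
    using has_integral_integral_lborel[OF int] has_integral_unique by blast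
qed

text \<open>The inner integral \<open>L\<close> is identified with the boundary values only almost
  everywhere, because Fubini provides integrable sections only for almost all \<open>y\<close>, and
  the derivative hypothesis says nothing about the sections at \<open>0\<close> and
  \<open>pi\<close>. Stated through \<open>L\<close>, the conclusion does not ask for measurability
  of the boundary values themselves.\<close>

lemma tint_x_derivative:
  assumes "\<And>y. 0 \<le> y \<Longrightarrow> y \<le> pi \<Longrightarrow> continuous_on {y..pi} (\<lambda>x. P (x, y))"
    and "\<And>y. finite (S y)"
    and "\<And>x y. 0 < y \<Longrightarrow> y < x \<Longrightarrow> x < pi \<Longrightarrow> x \<notin> S y \<Longrightarrow> ((\<lambda>x. P (x, y)) has_real_derivative p (x, y)) (at x)"
    and p: "bmeas p"
  obtains L where "integrable lborel L" "tint p = (LINT y|lborel. L y)"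
    "AE y in lborel. L y = indicator {0..pi} y * (P (pi, y) - P (y, y))"
proof -
  define f where "f x y = indicator ctri (x, y) * p (x, y)" for x y
  have int: "integrable (lborel \<Otimes>\<^sub>M lborel) (case_prod f)"
    using integrable_bmeas[OF p] by (simp add: lborel_prod f_def case_prod_unfold)
  show ?thesis
  proof
    show "integrable lborel (\<lambda>y. LINT x|lborel. f x y)"
      by (rule lborel_pair.integrable_snd[OF int])
    have "tint p = integral\<^sup>L (lborel \<Otimes>\<^sub>M lborel) (case_prod f)"
      by (simp add: lborel_prod f_def case_prod_unfold tint_def)
    also have "\<dots> = (LINT y|lborel. (LINT x|lborel. f x y))"
      using lborel_pair.integral_snd[OF int] by simp
    finally show "tint p = (LINT y|lborel. (LINT x|lborel. f x y))" .
    have "AE y in lborel. y \<noteq> (0::real)" "AE y in lborel. y \<noteq> (pi::real)" by (rule AE_lborel_singleton)+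
    with lborel_pair.AE_integrable_snd[OF int]
    show "AE y in lborel. (LINT x|lborel. f x y) = indicator {0..pi} y * (P (pi, y) - P (y, y))"
    proof eventually_elim
      case (elim y)
      show ?case
      proof (cases "y \<in> {0..pi}")
        case True
        then have f: "f x y = indicator {y..pi} x * p (x, y)" for x
          by (auto simp: f_def indicator_def)
        have "(LINT x|lborel. indicator {y..pi} x * p (x, y)) = P (pi, y) - P (y, y)"
          using True elim assms unfolding f by (intro lborel_integral_FTC[where S = "S y"]) auto
        then show ?thesis using True by (simp add: f)
      next
        case False
        then have f: "f x y = 0" for x
          by (auto simp: f_def indicator_def)
        show ?thesis using False by (simp add: f)
      qed
    qed
  qed
qed

lemma tint_y_derivative:
  assumes "\<And>x. 0 \<le> x \<Longrightarrow> x \<le> pi \<Longrightarrow> continuous_on {0..x} (\<lambda>y. Q (x, y))"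
    and "\<And>x. finite (S x)"
    and "\<And>x y. 0 < y \<Longrightarrow> y < x \<Longrightarrow> x < pi \<Longrightarrow> y \<notin> S x \<Longrightarrow> ((\<lambda>y. Q (x, y)) has_real_derivative q (x, y)) (at y)"
    and q: "bmeas q"
  obtains L where "integrable lborel L" "tint q = (LINT x|lborel. L x)"
    "AE x in lborel. L x = indicator {0..pi} x * (Q (x, x) - Q (x, 0))"
proof -
  define f where "f x y = indicator ctri (x, y) * q (x, y)" for x y
  have int: "integrable (lborel \<Otimes>\<^sub>M lborel) (case_prod f)"
    using integrable_bmeas[OF q] by (simp add: lborel_prod f_def case_prod_unfold)
  show ?thesis
  proof
    show "integrable lborel (\<lambda>x. LINT y|lborel. f x y)"
      by (rule lborel_pair.integrable_fst[OF int])
    have "tint q = integral\<^sup>L (lborel \<Otimes>\<^sub>M lborel) (case_prod f)"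
      by (simp add: lborel_prod f_def case_prod_unfold tint_def)
    also have "\<dots> = (LINT x|lborel. (LINT y|lborel. f x y))"
      using lborel_pair.integral_fst[OF int] by simp
    finally show "tint q = (LINT x|lborel. (LINT y|lborel. f x y))" .
    have "AE y in lborel. y \<noteq> (0::real)" "AE y in lborel. y \<noteq> (pi::real)" by (rule AE_lborel_singleton)+
    with lborel_pair.AE_integrable_fst[OF int]
    show "AE x in lborel. (LINT y|lborel. f x y) = indicator {0..pi} x * (Q (x, x) - Q (x, 0))"
    proof eventually_elim
      case (elim x)
      show ?case
      proof (cases "x \<in> {0..pi}")
        case True
        then have f: "f x y = indicator {0..x} y * q (x, y)" for y
          by (auto simp: f_def indicator_def)
        have "(LINT y|lborel. indicator {0..x} y * q (x, y)) = Q (x, x) - Q (x, 0)"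
          using True elim assms unfolding f by (intro lborel_integral_FTC[where S = "S x"]) auto
        then show ?thesis using True by (simp add: f)
      next
        case False
        then have f: "f x y = 0" for y
          by (auto simp: f_def indicator_def)
        show ?thesis using False by (simp add: f)
      qed
    qed
  qed
qed

text \<open>\<open>D t\<close> collects the outward flux through the three sides
  \<open>x = pi\<close>, \<open>x = y\<close> and \<open>y = 0\<close> at the common parameter
  \<open>t\<close>. On the diagonal the length element \<open>sqrt 2\<close> cancels the norm of the
  normal \<open>(-1, 1)\<close>. Measurability is asked of this sum only, and in applications the
  sum is often 0.\<close>

theorem triangle_divergence:
  assumes "\<And>y. 0 \<le> y \<Longrightarrow> y \<le> pi \<Longrightarrow> continuous_on {y..pi} (\<lambda>x. P (x, y))"
    and "\<And>x. 0 \<le> x \<Longrightarrow> x \<le> pi \<Longrightarrow> continuous_on {0..x} (\<lambda>y. Q (x, y))"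
    and "\<And>y. finite (S y)" "\<And>x. finite (S' x)"
    and "\<And>x y. 0 < y \<Longrightarrow> y < x \<Longrightarrow> x < pi \<Longrightarrow> x \<notin> S y \<Longrightarrow> ((\<lambda>x. P (x, y)) has_real_derivative p (x, y)) (at x)"
    and "\<And>x y. 0 < y \<Longrightarrow> y < x \<Longrightarrow> x < pi \<Longrightarrow> y \<notin> S' x \<Longrightarrow> ((\<lambda>y. Q (x, y)) has_real_derivative q (x, y)) (at y)"
    and p: "bmeas p" and q: "bmeas q"
    and D: "\<And>t. 0 < t \<Longrightarrow> t < pi \<Longrightarrow> D t = P (pi, t) - P (t, t) + Q (t, t) - Q (t, 0)"
    and m: "(\<lambda>t. indicator {0..pi} t * D t) \<in> borel_measurable borel"
  shows "tint (\<lambda>z. p z + q z) = (LINT t|lborel. indicator {0..pi} t * D t)"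
proof -
  obtain L where L: "integrable lborel L" "tint p = (LINT y|lborel. L y)"
    "AE y in lborel. L y = indicator {0..pi} y * (P (pi, y) - P (y, y))"
    by (rule tint_x_derivative[of P S p, OF assms(1,3,5,7)])
  obtain M where M: "integrable lborel M" "tint q = (LINT y|lborel. M y)"
    "AE x in lborel. M x = indicator {0..pi} x * (Q (x, x) - Q (x, 0))"
    by (rule tint_y_derivative[of Q S' q, OF assms(2,4,6,8)])
  have "tint (\<lambda>z. p z + q z) = (LINT t|lborel. L t + M t)"
    by (simp add: tint_add p q L M)
  also have "\<dots> = (LINT t|lborel. indicator {0..pi} t * D t)"
  proof (rule Bochner_Integration.integral_cong_AE)
    have "AE y in lborel. y \<noteq> (0::real)" "AE y in lborel. y \<noteq> (pi::real)" by (rule AE_lborel_singleton)+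
    with L(3) M(3) show "AE t in lborel. L t + M t = indicator {0..pi} t * D t"
      by eventually_elim (auto simp: D indicator_def)
    show "(\<lambda>t. L t + M t) \<in> borel_measurable lborel"
      using L(1) M(1) by auto
    show "(\<lambda>t. indicator {0..pi} t * D t) \<in> borel_measurable lborel"
      using m by simp
  qed
  finally show ?thesis .
qed

text \<open>Continuity is required of the products \<open>w * h1\<close> and \<open>w * h2\<close>
  only. Thus the field \<open>(h1, h2)\<close> may jump where \<open>w\<close> vanishes, which is
  how a function vanishing on the grid is paired with the gradient of \<open>e\<close>.\<close>

lemma triangle_green:
  assumes "\<And>y. 0 \<le> y \<Longrightarrow> y \<le> pi \<Longrightarrow> continuous_on {y..pi} (\<lambda>x. w (x, y) * h1 (x, y))"
    and "\<And>x. 0 \<le> x \<Longrightarrow> x \<le> pi \<Longrightarrow> continuous_on {0..x} (\<lambda>y. w (x, y) * h2 (x, y))"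
    and "\<And>y. finite (S y)" "\<And>x. finite (S' x)"
    and "\<And>x y. 0 < y \<Longrightarrow> y < x \<Longrightarrow> x < pi \<Longrightarrow> x \<notin> S y \<Longrightarrow> ((\<lambda>x. w (x, y)) has_real_derivative w1 (x, y)) (at x)"
    and "\<And>x y. 0 < y \<Longrightarrow> y < x \<Longrightarrow> x < pi \<Longrightarrow> y \<notin> S' x \<Longrightarrow> ((\<lambda>y. w (x, y)) has_real_derivative w2 (x, y)) (at y)"
    and "\<And>x y. 0 < y \<Longrightarrow> y < x \<Longrightarrow> x < pi \<Longrightarrow> x \<notin> S y \<Longrightarrow> ((\<lambda>x. h1 (x, y)) has_real_derivative h11 (x, y)) (at x)"
    and "\<And>x y. 0 < y \<Longrightarrow> y < x \<Longrightarrow> x < pi \<Longrightarrow> y \<notin> S' x \<Longrightarrow> ((\<lambda>y. h2 (x, y)) has_real_derivative h22 (x, y)) (at y)"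
    and m: "bmeas w" "bmeas w1" "bmeas w2" "bmeas h1" "bmeas h2" "bmeas h11" "bmeas h22"
    and b1: "\<And>t. 0 < t \<Longrightarrow> t < pi \<Longrightarrow> w (pi, t) * h1 (pi, t) = 0"
    and b2: "\<And>t. 0 < t \<Longrightarrow> t < pi \<Longrightarrow> w (t, 0) * h2 (t, 0) = 0"
    and b3: "\<And>t. 0 < t \<Longrightarrow> t < pi \<Longrightarrow> w (t, t) * h1 (t, t) = w (t, t) * h2 (t, t)"
  shows "tint (\<lambda>z. w1 z * h1 z + w2 z * h2 z) = - tint (\<lambda>z. w z * (h11 z + h22 z))"
proof -
  have D: "0 = w (pi, t) * h1 (pi, t) - w (t, t) * h1 (t, t) + w (t, t) * h2 (t, t) - w (t, 0) * h2 (t, 0)"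
    if "0 < t" "t < pi" for t
    using b1[OF that] b2[OF that] b3[OF that] by linarith
  have "tint (\<lambda>z. (w1 z * h1 z + h11 z * w z) + (w2 z * h2 z + h22 z * w z)) = (LINT t|lborel. indicator {0..pi} t * 0)"
    by (rule triangle_divergence[where P = "\<lambda>z. w z * h1 z" and Q = "\<lambda>z. w z * h2 z" and S = S and S' = S'])
       (use assms(1-8) m D in \<open>auto intro!: DERIV_mult\<close>)
  then have "tint (\<lambda>z. (w1 z * h1 z + h11 z * w z) + (w2 z * h2 z + h22 z * w z)) = 0" by simp
  also have "(\<lambda>z. (w1 z * h1 z + h11 z * w z) + (w2 z * h2 z + h22 z * w z)) =
      (\<lambda>z. (w1 z * h1 z + w2 z * h2 z) + w z * (h11 z + h22 z))" by (auto simp: algebra_simps)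
  finally show ?thesis
    by (subst (asm) tint_add) (auto intro!: bmeas_add bmeas_mult m)
qed

section \<open>Cosine modes\<close>

text \<open>The sum symmetrises \<open>cos (m * x) * cos (n * y)\<close> under exchange of the
  coordinates; this is what gives the Neumann condition on the diagonal.\<close>

definition md :: "int \<times> int \<Rightarrow> real \<times> real \<Rightarrow> real" where
  "md = (\<lambda>(m, n) (x, y). cos (of_int m * x) * cos (of_int n * y) + cos (of_int n * x) * cos (of_int m * y))"

definition md1 :: "int \<times> int \<Rightarrow> real \<times> real \<Rightarrow> real" where
  "md1 = (\<lambda>(m, n) (x, y). - of_int m * sin (of_int m * x) * cos (of_int n * y) - of_int n * sin (of_int n * x) * cos (of_int m * y))"

definition md2 :: "int \<times> int \<Rightarrow> real \<times> real \<Rightarrow> real" where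
  "md2 = (\<lambda>(m, n) (x, y). - of_int n * cos (of_int m * x) * sin (of_int n * y) - of_int m * cos (of_int n * x) * sin (of_int m * y))"

definition md11 :: "int \<times> int \<Rightarrow> real \<times> real \<Rightarrow> real" where
  "md11 = (\<lambda>(m, n) (x, y). - (of_int m)\<^sup>2 * cos (of_int m * x) * cos (of_int n * y) - (of_int n)\<^sup>2 * cos (of_int n * x) * cos (of_int m * y))"

definition md12 :: "int \<times> int \<Rightarrow> real \<times> real \<Rightarrow> real" where
  "md12 = (\<lambda>(m, n) (x, y). of_int m * of_int n * (sin (of_int m * x) * sin (of_int n * y) + sin (of_int n * x) * sin (of_int m * y)))"

definition md22 :: "int \<times> int \<Rightarrow> real \<times> real \<Rightarrow> real" where
  "md22 = (\<lambda>(m, n) (x, y). - (of_int n)\<^sup>2 * cos (of_int m * x) * cos (of_int n * y) - (of_int m)\<^sup>2 * cos (of_int n * x) * cos (of_int m * y))"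

definition ev :: "int \<times> int \<Rightarrow> real" where
  "ev = (\<lambda>(m, n). of_int (m\<^sup>2 + n\<^sup>2))"

text \<open>One index pair for each function \<open>md p\<close>, which depends neither on the signs
  nor on the order of the pair.\<close>

definition modes :: "(int \<times> int) set" where
  "modes = {(m, n). 0 \<le> n \<and> n \<le> m}"

lemmas md_simps = md_def md1_def md2_def md11_def md12_def md22_def ev_def

lemma md_laplace: "md11 p z + md22 p z = - ev p * md p z"
  by (cases p; cases z) (simp add: md_simps algebra_simps)

lemma continuous_md [continuous_intros]:
  "continuous_on A (md p)" "continuous_on A (md1 p)" "continuous_on A (md2 p)"
  "continuous_on A (md11 p)" "continuous_on A (md12 p)" "continuous_on A (md22 p)"
  by (cases p; simp add: md_simps case_prod_unfold; intro continuous_intros)+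

lemma DERIV_md:
  "((\<lambda>x. md p (x, y)) has_real_derivative md1 p (x, y)) (at x within A)"
  "((\<lambda>y. md p (x, y)) has_real_derivative md2 p (x, y)) (at y within B)"
  "((\<lambda>x. md1 p (x, y)) has_real_derivative md11 p (x, y)) (at x within A)"
  "((\<lambda>y. md2 p (x, y)) has_real_derivative md22 p (x, y)) (at y within B)"
  by (cases p; auto simp: md_simps power2_eq_square intro!: derivative_eq_intros)+

lemma has_derivative_md:
  "(md p has_derivative (\<lambda>h. md1 p z * fst h + md2 p z * snd h)) (at z within A)"
  "(md1 p has_derivative (\<lambda>h. md11 p z * fst h + md12 p z * snd h)) (at z within A)"
  "(md2 p has_derivative (\<lambda>h. md12 p z * fst h + md22 p z * snd h)) (at z within A)"
  by (cases p; cases z; auto simp: md_simps case_prod_unfold power2_eq_square algebra_simps intro!: derivative_eq_intros)+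

lemma md_boundary:
  "md1 p (pi, y) = 0" "md2 p (x, 0) = 0" "md1 p (t, t) = md2 p (t, t)"
  by (cases p; simp add: md_simps mult.commute[of _ pi]; simp add: algebra_simps)+

lemma cos_abs_int: "cos (real_of_int \<bar>m\<bar> * x) = cos (real_of_int m * x)"
  by (cases "0 \<le> m") simp_all

lemma md_swap: "md (n, m) = md (m, n)"
  by (auto simp: md_def)

lemma md_abs: "md (\<bar>m\<bar>, \<bar>n\<bar>) = md (m, n)"
  unfolding md_def prod.case cos_abs_int ..

lemma md_in_modes: "\<exists>p\<in>modes. md p = md q"
proof (cases q)
  case (Pair m n)
  show ?thesis
  proof (cases "\<bar>n\<bar> \<le> \<bar>m\<bar>")
    case True
    then show ?thesis using Pair by (intro bexI[of _ "(\<bar>m\<bar>, \<bar>n\<bar>)"]) (auto simp: md_abs modes_def)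
  next
    case False
    then show ?thesis using Pair by (intro bexI[of _ "(\<bar>n\<bar>, \<bar>m\<bar>)"]) (auto simp: md_abs modes_def md_swap)
  qed
qed

section \<open>Trigonometric polynomials: density and unique continuation\<close>

text \<open>The linear span of the modes. It is an algebra by the product-to-sum formula, so
  Stone-Weierstrass applies to it.\<close>

inductive tpoly :: "(real \<times> real \<Rightarrow> real) \<Rightarrow> bool" where
  tpoly_md: "tpoly (md p)"
| tpoly_cmult: "tpoly f \<Longrightarrow> tpoly (\<lambda>z. c * f z)"
| tpoly_add: "tpoly f \<Longrightarrow> tpoly g \<Longrightarrow> tpoly (\<lambda>z. f z + g z)"

lemma tpoly_0: "tpoly (\<lambda>z. 0)"
  using tpoly_cmult[OF tpoly_md, of 0] by simp

lemma tpoly_sum: "(\<And>i. i \<in> A \<Longrightarrow> tpoly (f i)) \<Longrightarrow> tpoly (\<lambda>z. \<Sum>i\<in>A. f i z)"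
  by (induction A rule: infinite_finite_induct) (auto intro: tpoly_0 tpoly_add)

lemma tpoly_const: "tpoly (\<lambda>z. c)"
proof -
  have "(\<lambda>z. c / 2 * md (0, 0) z) = (\<lambda>z. c)" by (auto simp: md_def)
  then show ?thesis using tpoly_cmult[OF tpoly_md, of "c/2" "(0, 0)"] by simp
qed

lemma tpoly_continuous: "tpoly f \<Longrightarrow> continuous_on A f"
  by (induction rule: tpoly.induct) (auto intro!: continuous_intros)

lemma md_mult: "md (m, n) z * md (k, l) z = 1/4 * (md (m + k, n + l) z + md (m + k, n - l) z
   + md (m - k, n + l) z + md (m - k, n - l) z + md (m + l, n + k) z + md (m + l, n - k) z
   + md (m - l, n + k) z + md (m - l, n - k) z)"
  by (cases z) (simp add: md_def distrib_right left_diff_distrib cos_add cos_diff; simp add: algebra_simps)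

lemma tpoly_mult_md: "tpoly (\<lambda>z. md p z * md q z)"
  by (cases p; cases q) (simp only: md_mult; intro tpoly_cmult tpoly_add tpoly_md)

lemma tpoly_mult: "tpoly f \<Longrightarrow> tpoly g \<Longrightarrow> tpoly (\<lambda>z. f z * g z)"
proof (induction arbitrary: g rule: tpoly.induct)
  case (tpoly_md p)
  then show ?case
  proof (induction rule: tpoly.induct)
    case (tpoly_md q)
    show ?case by (rule tpoly_mult_md)
  next
    case (tpoly_cmult f c)
    from tpoly.tpoly_cmult[OF this(2), of c] show ?case by (simp add: mult.left_commute)
  next
    case (tpoly_add f g)
    from tpoly.tpoly_add[OF this(3,4)] show ?case by (simp add: distrib_left)
  qed
next
  case (tpoly_cmult f c)
  from tpoly.tpoly_cmult[OF tpoly_cmult(2)[OF tpoly_cmult(3)], of c] show ?case by (simp add: mult.assoc)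
next
  case (tpoly_add f h)
  from tpoly.tpoly_add[OF tpoly_add(3,4)[OF tpoly_add(5)]] show ?case by (simp add: distrib_right)
qed

lemma tpoly_explicit:
  assumes "tpoly f" obtains A a where "finite A" "A \<subseteq> modes" "f = (\<lambda>z. \<Sum>p\<in>A. a p * md p z)"
proof -
  have "\<exists>A a. finite A \<and> A \<subseteq> modes \<and> f = (\<lambda>z. \<Sum>p\<in>A. a p * md p z)"
    using assms
  proof (induction rule: tpoly.induct)
    case (tpoly_md q)
    obtain p where "p \<in> modes" "md p = md q" using md_in_modes by blast
    then show ?case by (intro exI[of _ "{p}"] exI[of _ "\<lambda>_. 1"]) auto
  next
    case (tpoly_cmult f c)
    then obtain A a where "finite A" "A \<subseteq> modes" "f = (\<lambda>z. \<Sum>p\<in>A. a p * md p z)" by blast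
    then show ?case by (intro exI[of _ A] exI[of _ "\<lambda>p. c * a p"]) (auto simp: sum_distrib_left mult.assoc)
  next
    case (tpoly_add f g)
    from tpoly_add(3) obtain A a where 1: "finite A" "A \<subseteq> modes" "f = (\<lambda>z. \<Sum>p\<in>A. a p * md p z)" by blast
    from tpoly_add(4) obtain B b where 2: "finite B" "B \<subseteq> modes" "g = (\<lambda>z. \<Sum>p\<in>B. b p * md p z)" by blast
    note * = 1 2
    have "f z + g z = (\<Sum>p\<in>A \<union> B. ((if p \<in> A then a p else 0) + (if p \<in> B then b p else 0)) * md p z)" for z
    proof -
      have "f z = (\<Sum>p\<in>A \<union> B. (if p \<in> A then a p else 0) * md p z)"
        unfolding * by (rule sum.mono_neutral_cong_left) (use * in auto)
      moreover have "g z = (\<Sum>p\<in>A \<union> B. (if p \<in> B then b p else 0) * md p z)"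
        unfolding * by (rule sum.mono_neutral_cong_left) (use * in auto)
      ultimately show ?thesis by (simp add: sum.distrib distrib_right)
    qed
    then show ?case using * by (intro exI[of _ "A \<union> B"] exI[of _ "\<lambda>p. (if p \<in> A then a p else 0) + (if p \<in> B then b p else 0)"]) auto
  qed
  then show ?thesis using that by blast
qed

text \<open>Up to a factor 2, \<open>md (1, 0)\<close> and \<open>md (1, 1)\<close> are the sum and
  the product of \<open>cos x\<close> and \<open>cos y\<close>. They determine the unordered pair,
  and the order is restored by \<open>y \<le> x\<close>, as cosine decreases on
  \<open>[0, pi]\<close>.\<close>

lemma tpoly_separates:
  assumes "z \<in> ctri" "w \<in> ctri" "z \<noteq> w" shows "\<exists>f. tpoly f \<and> f z \<noteq> f w"
proof (rule ccontr)
  assume "\<not> ?thesis"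
  then have *: "f z = f w" if "tpoly f" for f using that by blast
  obtain x y where z: "z = (x, y)" by (cases z)
  obtain x' y' where w: "w = (x', y')" by (cases w)
  have bd: "0 \<le> y" "y \<le> x" "x \<le> pi" "0 \<le> y'" "y' \<le> x'" "x' \<le> pi" using assms z w by auto
  have s: "cos x + cos y = cos x' + cos y'" using *[OF tpoly_md[of "(1, 0)"]] by (simp add: md_def z w)
  have p: "cos x * cos y = cos x' * cos y'" using *[OF tpoly_md[of "(1, 1)"]] by (simp add: md_def z w)
  have "(cos x - cos x') * (cos x - cos y') = cos x * cos x - (cos x' + cos y') * cos x + cos x' * cos y'"
    by (simp add: algebra_simps)
  also have "\<dots> = 0" using s p by (simp flip: s p add: algebra_simps)
  finally have "cos x = cos x' \<or> cos x = cos y'" by auto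
  moreover have "cos x \<le> cos y" "cos x' \<le> cos y'" using bd by (auto intro!: cos_monotone_0_pi_le)
  ultimately have "cos x = cos x'" "cos y = cos y'" using s by auto
  then have "x = x'" "y = y'" using bd by (auto intro!: cos_inj_pi)
  then show False using assms z w by simp
qed

lemma tpoly_dense:
  assumes "continuous_on ctri f" "0 < e"
  obtains g where "tpoly g" "\<And>z. z \<in> ctri \<Longrightarrow> \<bar>f z - g z\<bar> < e"
proof -
  have "\<exists>g. tpoly g \<and> (\<forall>z\<in>ctri. \<bar>f z - g z\<bar> < e)"
    by (rule Stone_Weierstrass_HOL[OF compact_ctri]) (use assms tpoly_const tpoly_continuous tpoly_add tpoly_mult tpoly_separates in auto)
  then show ?thesis using that by blast
qed

text \<open>Chebyshev polynomials. They make each section of a trigonometric polynomial an ordinary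
  polynomial in a cosine, hence a function with few zeros unless it vanishes identically.\<close>

lemma cos_nat_times_poly: "\<exists>q::real poly. \<forall>x. cos (real n * x) = poly q (cos x)"
proof (induction n rule: less_induct)
  case (less n)
  consider "n = 0" | "n = 1" | m where "n = Suc (Suc m)" by (metis One_nat_def not0_implies_Suc)
  then show ?case
  proof cases
    case 1 then show ?thesis by (intro exI[of _ 1]) simp
  next
    case 2 then show ?thesis by (intro exI[of _ "[:0, 1:]"]) simp
  next
    case 3
    obtain q r where q: "\<forall>x. cos (real m * x) = poly q (cos x)" and r: "\<forall>x. cos (real (Suc m) * x) = poly r (cos x)"
      using less 3 by (metis lessI less_SucI)
    have "cos (real n * x) = 2 * cos x * cos (real (Suc m) * x) - cos (real m * x)" for x
    proof -
      have "cos (real n * x) = cos (real (Suc m) * x + x)" "cos (real m * x) = cos (real (Suc m) * x - x)"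
        using 3 by (simp_all add: algebra_simps)
      then show ?thesis unfolding cos_add cos_diff by simp
    qed
    then show ?thesis using q r by (intro exI[of _ "[:0, 2:] * r - q"]) simp
  qed
qed

lemma cos_int_times_poly: "\<exists>q::real poly. \<forall>x::real. cos (of_int n * x) = poly q (cos x)"
proof -
  have "cos (of_int n * x) = cos (real (nat \<bar>n\<bar>) * x)" for x
    using cos_abs_int[of n x] by simp
  then show ?thesis using cos_nat_times_poly by presburger
qed

lemma tpoly_sections: assumes "tpoly f"
  shows "\<exists>q::real poly. \<forall>x. f (x, y) = poly q (cos x)" "\<exists>q::real poly. \<forall>y. f (x, y) = poly q (cos y)"
  using assms
proof (induction rule: tpoly.induct)
  case (tpoly_md p)
  obtain m n where p: "p = (m, n)" by (cases p)
  obtain q :: "real poly" where q: "\<forall>x::real. cos (of_int m * x) = poly q (cos x)" using cos_int_times_poly by blast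
  obtain r :: "real poly" where r: "\<forall>x::real. cos (of_int n * x) = poly r (cos x)" using cos_int_times_poly by blast
  { case 1 show ?case using q r by (intro exI[of _ "smult (cos (of_int n * y)) q + smult (cos (of_int m * y)) r"]) (simp add: p md_def mult.commute) }
  { case 2 show ?case using q r by (intro exI[of _ "smult (cos (of_int m * x)) r + smult (cos (of_int n * x)) q"]) (simp add: p md_def mult.commute) }
next
  case (tpoly_cmult f c)
  { case 1 show ?case using tpoly_cmult(2) by (metis poly_smult) }
  { case 2 show ?case using tpoly_cmult(3) by (metis poly_smult) }
next
  case (tpoly_add f g)
  { case 1 show ?case using tpoly_add(3,5) by (metis poly_add) }
  { case 2 show ?case using tpoly_add(4,6) by (metis poly_add) }
qed

lemma poly_cos_eq_0:
  fixes q :: "real poly"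
  assumes "0 \<le> a" "a < b" "b \<le> pi" "\<And>x. a < x \<Longrightarrow> x < b \<Longrightarrow> poly q (cos x) = 0" shows "q = 0"
proof (rule ccontr)
  assume "q \<noteq> 0"
  then have "finite (cos ` {a<..<b})"
    using assms by (intro finite_subset[OF _ poly_roots_finite[of q]]) auto
  moreover have "inj_on cos {a<..<b}"
  proof (rule inj_onI)
    fix x y assume "x \<in> {a<..<b}" "y \<in> {a<..<b}" "cos x = cos y"
    then show "x = y" using assms(1,3) cos_inj_pi[of x y] by simp
  qed
  ultimately show False using infinite_Ioo[OF assms(2)] finite_imageD by blast
qed

text \<open>On a box inside \<open>U\<close>, each horizontal section is a polynomial in
  \<open>cos x\<close> with infinitely many zeros, so \<open>f\<close> vanishes on a whole
  horizontal strip. The vertical sections then vanish for the same reason.\<close>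

lemma tpoly_unique:
  assumes f: "tpoly f" and U: "open U" "U \<subseteq> tri" "U \<noteq> {}" and 0: "\<And>z. z \<in> U \<Longrightarrow> f z = 0"
  shows "f z = 0"
proof -
  obtain a b where "(a, b) \<in> U" using U by auto
  then obtain A B where AB: "open A" "open B" "a \<in> A" "b \<in> B" "A \<times> B \<subseteq> U"
    using open_prod_elim[OF U(1), of "(a, b)"] by (metis mem_Sigma_iff)
  obtain r where r: "r > 0" "ball a r \<subseteq> A" using AB open_contains_ball by blast
  obtain s where s: "s > 0" "ball b s \<subseteq> B" using AB open_contains_ball by blast
  have box: "(x, y) \<in> U" if "a < x" "x < a + r" "b < y" "y < b + s" for x y
  proof -
    have "x \<in> ball a r" "y \<in> ball b s" using that by (auto simp: dist_real_def)
    then have "(x, y) \<in> A \<times> B" using r(2) s(2) by blast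
    then show ?thesis using AB(5) by blast
  qed
  define a' where "a' = a + r / 2" define b' where "b' = b + s / 2"
  have "(a, b) \<in> tri" "(a', b') \<in> tri"
    using box[of a' b'] r(1) s(1) U(2) \<open>(a, b) \<in> U\<close> unfolding a'_def b'_def by auto
  then have bd: "0 < a" "a < a'" "a' \<le> pi" "0 < b" "b < b'" "b' \<le> pi"
    using r(1) s(1) by (auto simp: a'_def b'_def)
  have 1: "f (x, y) = 0" if "b < y" "y < b'" for x y
  proof -
    obtain q where q: "\<forall>x. f (x, y) = poly q (cos x)" using tpoly_sections(1)[OF f] by blast
    have "q = 0"
      using bd r s that q box 0 by (intro poly_cos_eq_0[of a a']) (auto simp: a'_def b'_def simp flip: q)
    then show ?thesis using q by simp
  qed
  have 2: "f (x, y) = 0" for x y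
  proof -
    obtain q where q: "\<forall>y. f (x, y) = poly q (cos y)" using tpoly_sections(2)[OF f] by blast
    have "q = 0"
      using bd 1 q by (intro poly_cos_eq_0[of b b']) (auto simp flip: q)
    then show ?thesis using q by simp
  qed
  show ?thesis by (cases z) (simp add: 2)
qed

section \<open>Orthogonality and completeness of the modes\<close>

definition lint :: "(real \<Rightarrow> real) \<Rightarrow> real" where
  "lint u = (LINT x|lborel. indicator {0..pi} x * u x)"

definition sqint :: "(real \<times> real \<Rightarrow> real) \<Rightarrow> real" where
  "sqint h = (LINT z|lborel. indicator ({0..pi} \<times> {0..pi}) z * h z)"

lemma lint_integrable: "continuous_on {0..pi} u \<Longrightarrow> integrable lborel (\<lambda>x. indicator {0..pi} x * (u x :: real))"
  using borel_integrable_compact[of "{0..pi}" u] by simp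

lemma sqint_integrable: "continuous_on ({0..pi} \<times> {0..pi}) h \<Longrightarrow>
    integrable lborel (\<lambda>z. indicator ({0..pi} \<times> {0..pi}) z * (h z :: real))"
  using borel_integrable_compact[of "{0..pi} \<times> {0..pi}" h] by (simp add: compact_Times)

lemma sqint_add: "continuous_on ({0..pi} \<times> {0..pi}) f \<Longrightarrow> continuous_on ({0..pi} \<times> {0..pi}) g \<Longrightarrow>
    sqint (\<lambda>z. f z + g z) = sqint f + sqint g"
  unfolding sqint_def distrib_left by (intro Bochner_Integration.integral_add sqint_integrable)

lemma sqint_cmult: "sqint (\<lambda>z. c * f z) = c * sqint f"
  unfolding sqint_def by (simp add: mult.left_commute)

lemma sqint_product:
  assumes "continuous_on {0..pi} u" "continuous_on {0..pi} v"
  shows "sqint (\<lambda>z. u (fst z) * v (snd z)) = lint u * lint v"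
proof -
  have "continuous_on ({0..pi} \<times> {0..pi}) (\<lambda>z. u (fst z) * v (snd z))"
    by (intro continuous_intros continuous_on_compose2[OF assms(1)] continuous_on_compose2[OF assms(2)]) auto
  from sqint_integrable[OF this]
  have int: "integrable (lborel \<Otimes>\<^sub>M lborel) (\<lambda>(x, y). indicator ({0..pi} \<times> {0..pi}) (x, y) * (u x * v y))"
    by (simp add: lborel_prod case_prod_unfold)
  have "sqint (\<lambda>z. u (fst z) * v (snd z)) = integral\<^sup>L (lborel \<Otimes>\<^sub>M lborel) (\<lambda>(x, y). indicator ({0..pi} \<times> {0..pi}) (x, y) * (u x * v y))"
    by (simp add: lborel_prod case_prod_unfold sqint_def)
  also have "\<dots> = (LINT x|lborel. LINT y|lborel. indicator ({0..pi} \<times> {0..pi}) (x, y) * (u x * v y))"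
    using lborel_pair.integral_fst[OF int] by simp
  also have "\<dots> = (LINT x|lborel. LINT y|lborel. (indicator {0..pi} x * u x) * (indicator {0..pi} y * v y))"
    by (simp add: indicator_times mult_ac)
  also have "\<dots> = lint u * lint v"
    by (simp add: lint_def)
  finally show ?thesis .
qed

lemma AE_not_diagonal: "AE z in lborel. fst z \<noteq> (snd z :: real)"
proof -
  have "negligible {z :: real \<times> real. (1, -1) \<bullet> z = 0}"
    by (rule negligible_hyperplane) (simp add: zero_prod_def)
  moreover have "{z :: real \<times> real. (1, -1) \<bullet> z = 0} = {z. fst z = snd z}"
    by (auto simp: inner_prod_def)
  moreover have "closed {z :: real \<times> real. fst z = snd z}"
    by (intro closed_Collect_eq continuous_intros)
  ultimately show ?thesis
    by (subst AE_iff_measurable[OF _ refl]) (auto simp: negligible_iff_null_sets null_sets_def borel_closed)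
qed

text \<open>The square consists of the triangle and its mirror image, which overlap in the null set
  \<open>x = y\<close>. The square is preferred for computations because integrals of products
  factor there.\<close>

lemma tint_symmetric:
  assumes c: "continuous_on ({0..pi} \<times> {0..pi}) h" and s: "\<And>x y. h (y, x) = h (x, y)"
  shows "sqint h = 2 * tint h"
proof -
  have b: "bmeas h"
    by (intro bmeas_continuous continuous_on_subset[OF c] ctri_subset_square)
  define f where "f = (\<lambda>z. indicator ctri z * h z)"
  have int: "integrable lborel f" unfolding f_def by (rule integrable_bmeas[OF b])
  then have int': "integrable (lborel \<Otimes>\<^sub>M lborel) f" by (simp add: lborel_prod)
  have 1: "integrable lborel (\<lambda>(x, y). f (y, x))" 
    using lborel_pair.integrable_product_swap[OF int'] by (simp add: lborel_prod)
  have 2: "integral\<^sup>L lborel (\<lambda>(x, y). f (y, x)) = integral\<^sup>L lborel f"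
    using lborel_pair.integral_product_swap[of f] int' by (simp add: lborel_prod)
  have "sqint h = (LINT z|lborel. f z + (\<lambda>(x, y). f (y, x)) z)"
    unfolding sqint_def
  proof (rule Bochner_Integration.integral_cong_AE)
    show "AE z in lborel. indicator ({0..pi} \<times> {0..pi}) z * h z = f z + (\<lambda>(x, y). f (y, x)) z"
      using AE_not_diagonal
    proof eventually_elim
      case (elim z)
      then show ?case by (cases z) (auto simp: f_def indicator_def s)
    qed
    show "(\<lambda>z. indicator ({0..pi} \<times> {0..pi}) z * h z) \<in> borel_measurable lborel"
      using sqint_integrable[OF c] by auto
    show "(\<lambda>z. f z + (case z of (x, y) \<Rightarrow> f (y, x))) \<in> borel_measurable lborel"
      using int 1 by auto
  qed
  also have "\<dots> = 2 * tint h"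
    using int 1 2 by (simp add: tint_def f_def)
  finally show ?thesis .
qed

lemma lint_FTC:
  assumes "\<And>x. 0 \<le> x \<Longrightarrow> x \<le> pi \<Longrightarrow> (P has_real_derivative p x) (at x)" "continuous_on {0..pi} p"
  shows "lint p = P pi - P 0"
proof -
  have "continuous_on {0..pi} P"
    by (rule DERIV_continuous_on[of _ _ p]) (use assms in \<open>auto intro: has_field_derivative_at_within\<close>)
  then show ?thesis
    unfolding lint_def using assms by (intro lborel_integral_FTC[where S = "{}"] lint_integrable) auto
qed

lemma sin_of_int_pi: "sin (of_int j * pi) = 0"
  by (simp add: mult.commute[of _ pi])

text \<open>For equal frequencies only positivity is recorded, since the value is \<open>pi\<close>
  for frequency 0 and \<open>pi / 2\<close> otherwise.\<close>

lemma lint_cos_cos: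
  assumes "0 \<le> m" "0 \<le> k"
  shows "m \<noteq> k \<Longrightarrow> lint (\<lambda>x. cos (of_int m * x) * cos (of_int k * x)) = 0"
    and "0 < lint (\<lambda>x. cos (of_int m * x) * cos (of_int m * x))"
proof -
  assume "m \<noteq> k"
  then have nz: "real_of_int (m + k) \<noteq> 0" "real_of_int (m - k) \<noteq> 0" using assms by linarith+
  have "lint (\<lambda>x. cos (of_int m * x) * cos (of_int k * x)) =
      lint (\<lambda>x. (cos (of_int (m - k) * x) + cos (of_int (m + k) * x)) / 2)"
    by (simp add: cos_times_cos left_diff_distrib distrib_right)
  also have "\<dots> = (sin (of_int (m - k) * pi) / of_int (m - k) + sin (of_int (m + k) * pi) / of_int (m + k)) / 2 -
    (sin (of_int (m - k) * 0) / of_int (m - k) + sin (of_int (m + k) * 0) / of_int (m + k)) / 2"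
    using nz by (intro lint_FTC continuous_intros) (auto intro!: derivative_eq_intros simp del: of_int_add of_int_diff)
  finally have "lint (\<lambda>x. cos (of_int m * x) * cos (of_int k * x)) = \<dots>" .
  then show "lint (\<lambda>x. cos (of_int m * x) * cos (of_int k * x)) = 0"
    by (simp only: sin_of_int_pi) simp
next
  show "0 < lint (\<lambda>x. cos (of_int m * x) * cos (of_int m * x))"
  proof (cases "m = 0")
    case True
    have "lint (\<lambda>x. 1) = pi - 0" by (intro lint_FTC) (auto intro!: derivative_eq_intros)
    then show ?thesis using True by simp
  next
    case False
    have "lint (\<lambda>x. cos (of_int m * x) * cos (of_int m * x)) = lint (\<lambda>x. (1 + cos (of_int (2 * m) * x)) / 2)"
      by (simp add: cos_times_cos mult_ac)
    also have "\<dots> =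
      (pi / 2 + sin (of_int (2 * m) * pi) / (4 * of_int m)) - (0 / 2 + sin (of_int (2 * m) * 0) / (4 * of_int m))"
      using False by (intro lint_FTC continuous_intros)
       (auto intro!: derivative_eq_intros simp: field_simps)
    also have "\<dots> = pi / 2"
      by (simp only: sin_of_int_pi) simp
    finally show ?thesis using pi_gt_zero by linarith
  qed
qed

lemma tint_md_md:
  "tint (\<lambda>z. md (m, n) z * md (k, l) z) =
     lint (\<lambda>x. cos (of_int m * x) * cos (of_int k * x)) * lint (\<lambda>x. cos (of_int n * x) * cos (of_int l * x)) +
     lint (\<lambda>x. cos (of_int m * x) * cos (of_int l * x)) * lint (\<lambda>x. cos (of_int n * x) * cos (of_int k * x))"
proof -
  let ?c = "\<lambda>m x. cos (real_of_int m * x)"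
  let ?p = "\<lambda>a b c d z. (?c a (fst z) * ?c b (fst z)) * (?c c (snd z) * ?c d (snd z))"
  have p: "sqint (?p a b c d) = lint (\<lambda>x. ?c a x * ?c b x) * lint (\<lambda>x. ?c c x * ?c d x)" for a b c d
    by (intro sqint_product continuous_intros)
  have "2 * tint (\<lambda>z. md (m, n) z * md (k, l) z) = sqint (\<lambda>z. md (m, n) z * md (k, l) z)"
    by (intro tint_symmetric[symmetric] continuous_intros) (auto simp: md_def algebra_simps)
  also have "\<dots> = sqint (\<lambda>z. (?p m k n l z + ?p m l n k z) + (?p n k m l z + ?p n l m k z))"
    by (intro arg_cong[where f = sqint]) (auto simp: md_def algebra_simps fun_eq_iff)
  also have "\<dots> = (sqint (?p m k n l) + sqint (?p m l n k)) + (sqint (?p n k m l) + sqint (?p n l m k))"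
    by (subst sqint_add; (intro continuous_intros)?; subst sqint_add; (intro continuous_intros)?)
       (subst sqint_add; (intro continuous_intros)?; rule refl)
  finally show ?thesis unfolding p by (simp add: mult.commute)
qed

text \<open>Different ordered pairs in \<open>modes\<close> also differ as unordered pairs, so in
  either way of matching the frequencies some one-dimensional integral is 0.\<close>

lemma md_orthogonal:
  assumes "p \<in> modes" "q \<in> modes" "p \<noteq> q" shows "tint (\<lambda>z. md p z * md q z) = 0"
proof -
  obtain m n k l where p: "p = (m, n)" and q: "q = (k, l)" by (cases p; cases q)
  then have *: "0 \<le> n" "n \<le> m" "0 \<le> l" "l \<le> k" "m \<noteq> k \<or> n \<noteq> l" using assms by (auto simp: modes_def)
  then have "m \<noteq> l \<or> n \<noteq> k" by auto
  with * show ?thesis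
    unfolding p q tint_md_md using lint_cos_cos(1)[of m k] lint_cos_cos(1)[of n l] lint_cos_cos(1)[of m l] lint_cos_cos(1)[of n k]
    by auto
qed

definition nrm :: "int \<times> int \<Rightarrow> real" where
  "nrm p = tint (\<lambda>z. md p z * md p z)"

lemma nrm_pos: assumes "p \<in> modes" shows "0 < nrm p"
proof -
  obtain m n where p: "p = (m, n)" by (cases p)
  then have *: "0 \<le> n" "0 \<le> m" using assms by (auto simp: modes_def)
  have "0 \<le> lint (\<lambda>x. cos (of_int m * x) * cos (of_int n * x)) * lint (\<lambda>x. cos (of_int n * x) * cos (of_int m * x))"
    by (simp add: mult.commute[of "cos (of_int n * _)"])
  moreover have "0 < lint (\<lambda>x. cos (of_int m * x) * cos (of_int m * x)) * lint (\<lambda>x. cos (of_int n * x) * cos (of_int n * x))"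
    using lint_cos_cos(2)[OF *(2) *(2)] lint_cos_cos(2)[OF *(1) *(1)] by simp
  ultimately show ?thesis unfolding nrm_def p tint_md_md by linarith
qed

lemma bmeas_md [intro]: "bmeas (md p)" "bmeas (md1 p)" "bmeas (md2 p)" "bmeas (md11 p)" "bmeas (md22 p)"
  by (intro bmeas_continuous continuous_intros)+

lemmas bmeas_intros = bmeas_add bmeas_mult bmeas_const bmeas_minus bmeas_diff bmeas_power2 bmeas_sum bmeas_md

lemma tint_md_sum:
  assumes "finite A" "A \<subseteq> modes" "p \<in> modes"
  shows "tint (\<lambda>z. (\<Sum>q\<in>A. a q * md q z) * md p z) = (if p \<in> A then a p * nrm p else 0)"
proof -
  have "tint (\<lambda>z. (\<Sum>q\<in>A. a q * md q z) * md p z) = (\<Sum>q\<in>A. tint (\<lambda>z. a q * (md q z * md p z)))"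
    by (subst tint_sum[symmetric]) (intro bmeas_intros, simp add: sum_distrib_right mult.assoc)
  also have "\<dots> = (\<Sum>q\<in>A. if q = p then a p * nrm p else 0)"
    using assms by (intro sum.cong refl) (auto simp: tint_cmult nrm_def intro!: md_orthogonal)
  also have "\<dots> = (if p \<in> A then a p * nrm p else 0)"
    using assms by (simp add: sum.delta)
  finally show ?thesis .
qed

text \<open>Such an \<open>f\<close> is orthogonal to every trigonometric polynomial
  \<open>g\<close>, so the integral of \<open>f * f\<close> equals that of
  \<open>f * (f - g)\<close>, which is arbitrarily small by uniform approximation.\<close>

lemma tpoly_complete:
  assumes c: "continuous_on ctri f" and 0: "\<And>p. p \<in> modes \<Longrightarrow> tint (\<lambda>z. f z * md p z) = 0" and z: "z \<in> ctri"
  shows "f z = 0"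
proof -
  have b: "bmeas f" by (rule bmeas_continuous[OF c])
  obtain B where B: "\<And>z. z \<in> ctri \<Longrightarrow> \<bar>f z\<bar> \<le> B" "0 \<le> B"
    using b unfolding bmeas_def by (metis abs_ge_zero order_trans all_not_in_conv z)
  have "tint (\<lambda>z. f z * f z) \<le> e" if "0 < e" for e
  proof -
    define d where "d = e / (tint (\<lambda>z. B) + 1)"
    have B0: "0 \<le> tint (\<lambda>z. B)" using B by (intro tint_nonneg) auto
    then have d: "0 < d" using that by (simp add: d_def)
    obtain g where g: "tpoly g" "\<And>z. z \<in> ctri \<Longrightarrow> \<bar>f z - g z\<bar> < d" using tpoly_dense[OF c d] by blast
    then obtain A a where A: "finite A" "A \<subseteq> modes" "g = (\<lambda>z. \<Sum>p\<in>A. a p * md p z)" using tpoly_explicit by blast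
    have bg: "bmeas g" using g(1) by (intro bmeas_continuous tpoly_continuous)
    have "tint (\<lambda>z. f z * g z) = (\<Sum>p\<in>A. a p * tint (\<lambda>z. f z * md p z))"
      unfolding A(3) sum_distrib_left
      by (subst tint_sum) (intro bmeas_intros b, simp add: tint_cmult[symmetric] mult_ac)
    also have "\<dots> = 0" using A 0 by (intro sum.neutral) auto
    finally have "tint (\<lambda>z. f z * f z) = tint (\<lambda>z. f z * f z) - tint (\<lambda>z. f z * g z)" by simp
    also have "\<dots> = tint (\<lambda>z. f z * f z - f z * g z)" by (rule tint_diff[symmetric]) (auto intro!: b bg)
    also have "\<dots> \<le> tint (\<lambda>z. d * B)"
    proof (rule tint_mono)
      fix z assume z: "z \<in> ctri"
      have "f z * f z - f z * g z = f z * (f z - g z)" by (simp add: algebra_simps)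
      also have "\<dots> \<le> \<bar>f z\<bar> * \<bar>f z - g z\<bar>" by (metis abs_ge_self abs_mult)
      also have "\<dots> \<le> B * d" using B z g(2)[OF z] by (intro mult_mono) auto
      finally show "f z * f z - f z * g z \<le> d * B" by (simp add: mult.commute)
    qed (auto intro!: b bg)
    also have "\<dots> = d * tint (\<lambda>z. B)" by (rule tint_cmult)
    also have "\<dots> \<le> e" using B0 that by (simp add: d_def field_simps)
    finally show ?thesis .
  qed
  then have "tint (\<lambda>z. f z * f z) \<le> 0" using field_le_epsilon[of "tint (\<lambda>z. f z * f z)" 0] by simp
  moreover have "0 \<le> tint (\<lambda>z. f z * f z)" by (rule tint_nonneg) simp
  ultimately have "tint (\<lambda>z. f z * f z) = 0" by simp
  then have "f z * f z = 0" using c z by (intro tint_eq_0_imp[of "\<lambda>z. f z * f z"]) (auto intro!: continuous_intros)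
  then show ?thesis by simp
qed

text \<open>After subtraction of the finite Fourier sum, the remainder is continuous and orthogonal
  to every mode.\<close>

lemma tint_md_complete_support:
  assumes c: "continuous_on ctri f" and A: "finite A" "A \<subseteq> modes"
    and 0: "\<And>p. p \<in> modes \<Longrightarrow> p \<notin> A \<Longrightarrow> tint (\<lambda>z. f z * md p z) = 0" and z: "z \<in> ctri"
  shows "f z = (\<Sum>p\<in>A. tint (\<lambda>z. f z * md p z) / nrm p * md p z)"
proof -
  let ?g = "\<lambda>z. \<Sum>p\<in>A. tint (\<lambda>z. f z * md p z) / nrm p * md p z"
  have "(\<lambda>z. f z - ?g z) z = 0"
  proof (rule tpoly_complete[OF _ _ z])
    show "continuous_on ctri (\<lambda>z. f z - ?g z)" by (intro continuous_intros c)
    fix p assume p: "p \<in> modes"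
    have "tint (\<lambda>z. (f z - ?g z) * md p z) = tint (\<lambda>z. f z * md p z) - tint (\<lambda>z. ?g z * md p z)"
      unfolding left_diff_distrib by (rule tint_diff) (intro bmeas_intros bmeas_continuous[OF c])+
    also have "\<dots> = 0"
      unfolding tint_md_sum[OF A p] using 0[OF p] nrm_pos[OF p] by simp
    finally show "tint (\<lambda>z. (f z - ?g z) * md p z) = 0" .
  qed
  then show ?thesis by simp
qed

text \<open>The hard half of Parseval's identity, stated with finite sets and an error so that no
  series occurs. A uniformly close \<open>g\<close> has small mean square distance from
  \<open>f\<close>, and Fourier coefficients do at least as well as the coefficients of
  \<open>g\<close>: complete the square for each mode.\<close>

lemma md_parseval:
  assumes c: "continuous_on ctri f" and e: "0 < e"
  obtains A where "finite A" "A \<subseteq> modes"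
    "\<And>B. finite B \<Longrightarrow> A \<subseteq> B \<Longrightarrow> B \<subseteq> modes \<Longrightarrow>
       tint (\<lambda>z. f z * f z) \<le> (\<Sum>p\<in>B. (tint (\<lambda>z. f z * md p z))\<^sup>2 / nrm p) + e"
proof -
  define V where "V = tint (\<lambda>z. 1)"
  have V: "0 \<le> V" unfolding V_def by (rule tint_nonneg) simp
  define d where "d = sqrt (e / (V + 1))"
  have d: "0 < d" "d * d * V \<le> e" using e V by (auto simp: d_def field_simps)
  obtain g where g: "tpoly g" "\<And>z. z \<in> ctri \<Longrightarrow> \<bar>f z - g z\<bar> < d" using tpoly_dense[OF c d(1)] by blast
  then obtain A a where A: "finite A" "A \<subseteq> modes" "g = (\<lambda>z. \<Sum>p\<in>A. a p * md p z)" using tpoly_explicit by blast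
  have bf: "bmeas f" by (rule bmeas_continuous[OF c])
  show ?thesis
  proof (rule that[OF A(1,2)])
    fix B assume B: "finite B" "A \<subseteq> B" "B \<subseteq> modes"
    define b where "b p = (if p \<in> A then a p else 0)" for p
    have gB: "g = (\<lambda>z. \<Sum>p\<in>B. b p * md p z)"
      unfolding A(3) b_def by (rule ext, rule sum.mono_neutral_cong_left) (use B in auto)
    have bg: "bmeas g" using g(1) by (intro bmeas_continuous tpoly_continuous)
    define u where "u p = tint (\<lambda>z. f z * md p z)" for p
    have fg: "tint (\<lambda>z. f z * g z) = (\<Sum>p\<in>B. b p * u p)"
      unfolding gB sum_distrib_left u_def
      by (subst tint_sum) (intro bmeas_intros bf, simp add: tint_cmult[symmetric] mult_ac)
    have gg: "tint (\<lambda>z. g z * g z) = (\<Sum>p\<in>B. b p * (b p * nrm p))"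
    proof -
      have "tint (\<lambda>z. g z * g z) = tint (\<lambda>z. \<Sum>p\<in>B. b p * (g z * md p z))"
        by (subst (2) gB) (simp add: sum_distrib_left mult_ac)
      also have "\<dots> = (\<Sum>p\<in>B. b p * tint (\<lambda>z. g z * md p z))"
        by (subst tint_sum) (intro bmeas_intros bg, simp add: tint_cmult)
      also have "\<dots> = (\<Sum>p\<in>B. b p * (b p * nrm p))"
        unfolding gB using B by (intro sum.cong refl, subst tint_md_sum) auto
      finally show ?thesis .
    qed
    have "tint (\<lambda>z. f z * f z) - (\<Sum>p\<in>B. (u p)\<^sup>2 / nrm p) \<le> tint (\<lambda>z. f z * f z) - 2 * (\<Sum>p\<in>B. b p * u p) + (\<Sum>p\<in>B. b p * (b p * nrm p))"
    proof -
      have "2 * (b p * u p) - b p * (b p * nrm p) \<le> (u p)\<^sup>2 / nrm p" if "p \<in> B" for p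
      proof -
        have n: "0 < nrm p" using that B nrm_pos by blast
        have "0 \<le> (u p - b p * nrm p)\<^sup>2 / nrm p" using n by simp
        also have "\<dots> = (u p)\<^sup>2 / nrm p - (2 * (b p * u p) - b p * (b p * nrm p))"
          using n by (simp add: power2_eq_square field_simps)
        finally show ?thesis by simp
      qed
      then have "(\<Sum>p\<in>B. 2 * (b p * u p) - b p * (b p * nrm p)) \<le> (\<Sum>p\<in>B. (u p)\<^sup>2 / nrm p)" by (rule sum_mono)
      then show ?thesis by (simp add: sum_subtractf sum_distrib_left)
    qed
    also have "\<dots> = tint (\<lambda>z. f z * f z) - 2 * tint (\<lambda>z. f z * g z) + tint (\<lambda>z. g z * g z)"
      by (simp add: fg gg)
    also have "\<dots> = tint (\<lambda>z. (f z * f z - 2 * (f z * g z)) + g z * g z)"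
      by (subst tint_add; (subst tint_diff)?) ((intro bmeas_intros bf bg)+, simp add: tint_cmult)
    also have "\<dots> \<le> tint (\<lambda>z. d * d * 1)"
    proof (rule tint_mono)
      fix z assume "z \<in> ctri"
      then have "\<bar>f z - g z\<bar> * \<bar>f z - g z\<bar> \<le> d * d" using g(2)[of z] by (intro mult_mono) auto
      then show "f z * f z - 2 * (f z * g z) + g z * g z \<le> d * d * 1" by (simp add: algebra_simps flip: abs_mult)
    qed (intro bmeas_intros bf bg)+
    also have "\<dots> = d * d * V" unfolding V_def by (rule tint_cmult)
    also have "\<dots> \<le> e" by (rule d(2))
    finally show "tint (\<lambda>z. f z * f z) \<le> (\<Sum>p\<in>B. (tint (\<lambda>z. f z * md p z))\<^sup>2 / nrm p) + e"
      by (simp add: u_def)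
  qed
qed

section \<open>Neumann eigenspaces of the triangle\<close>

lemma sum_fun_apply: "(\<Sum>x\<in>A. F x) z = (\<Sum>x\<in>A. F x z)"
  for F :: "'a \<Rightarrow> 'b \<Rightarrow> 'c::comm_monoid_add"
  by (induction A rule: infinite_finite_induct) (simp_all add: plus_fun_def zero_fun_def)

text \<open>If \<open>n \<bullet> t\<close> were nonzero, a small step along \<open>t\<close> or
  \<open>- t\<close> would stay in the inner cone at \<open>x\<close>, and hence lie in
  \<open>\<Omega>\<close>. For the triangle, \<open>t\<close> is the direction of a side.\<close>

lemma outward_unit_normal_orthogonal:
  assumes n: "outward_unit_normal \<Omega> x n" and t: "\<And>s. x + s *\<^sub>R t \<notin> \<Omega>"
  shows "n \<bullet> t = 0"
proof -
  have *: "\<not> n \<bullet> u < 0" if u: "\<And>s. x + s *\<^sub>R u \<notin> \<Omega>" for u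
  proof
    assume neg: "n \<bullet> u < 0"
    then have u0: "norm u > 0" by auto
    \<comment> \<open>Half the cosine of the angle between \<open>u\<close> and \<open>- n\<close>,
      so that \<open>u\<close> points strictly into the cone.\<close>
    define e where "e = - (n \<bullet> u) / (2 * norm u)"
    have "e > 0" using neg u0 by (simp add: e_def field_simps)
    then obtain d where d: "d > 0" "\<And>y. y \<noteq> x \<Longrightarrow> dist y x < d \<Longrightarrow> n \<bullet> (y - x) < - e * norm (y - x) \<Longrightarrow> y \<in> \<Omega>"
      using n unfolding outward_unit_normal_def eventually_at by (metis UNIV_I)
    define s where "s = d / (2 * norm u)"
    have s: "s > 0" using d u0 by (simp add: s_def)
    have "n \<bullet> (s *\<^sub>R u) < - e * norm (s *\<^sub>R u)"
      using neg s u0 by (simp add: e_def field_simps)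
    moreover have "norm (s *\<^sub>R u) < d" using s u0 d by (simp add: s_def)
    ultimately show False
      using d(2)[of "x + s *\<^sub>R u"] u[of s] s u0 by (simp add: dist_norm)
  qed
  have "\<not> n \<bullet> (- t) < 0"
  proof (rule *)
    show "x + s *\<^sub>R (- t) \<notin> \<Omega>" for s using t[of "- s"] by simp
  qed
  then show ?thesis using *[OF t] by simp
qed

lemma outward_unit_normal_halfspace:
  assumes "x \<in> frontier \<Omega>" "norm n = 1" "\<forall>\<^sub>F y in at x. y \<in> \<Omega> \<longleftrightarrow> n \<bullet> (y - x) < 0"
  shows "outward_unit_normal \<Omega> x n"
  unfolding outward_unit_normal_def
proof (intro conjI allI impI assms(1,2))
  fix e :: real assume "e > 0"
  from assms(3) show "\<forall>\<^sub>F y in at x. (n \<bullet> (y - x) < - e * norm (y - x) \<longrightarrow> y \<in> \<Omega>) \<and> (n \<bullet> (y - x) > e * norm (y - x) \<longrightarrow> y \<notin> \<Omega>)"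
  proof eventually_elim
    case (elim y)
    have "0 \<le> e * norm (y - x)" using \<open>e > 0\<close> by simp
    then show ?case using elim by auto
  qed
qed

lemma frontier_tri: "frontier tri = ctri - tri"
  unfolding frontier_def by (simp add: interior_open)

lemma normal_tri_right:
  assumes "0 < t" "t < pi" shows "outward_unit_normal tri (pi, t) (1, 0)"
proof (rule outward_unit_normal_halfspace)
  show "(pi, t) \<in> frontier tri" using assms by (simp add: frontier_tri)
  have "open ({z::real\<times>real. 0 < snd z} \<inter> {z. snd z < fst z})"
    by (intro open_Int open_Collect_less continuous_intros)
  moreover have "(pi, t) \<in> {z. 0 < snd z} \<inter> {z. snd z < fst z}" using assms by simp
  ultimately have "\<forall>\<^sub>F y in at (pi, t). y \<in> {z. 0 < snd z} \<inter> {z. snd z < fst z}"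
    by (rule eventually_at_in_open')
  then show "\<forall>\<^sub>F y in at (pi, t). y \<in> tri \<longleftrightarrow> (1, 0) \<bullet> (y - (pi, t)) < 0"
    by eventually_elim (auto simp: tri_def)
qed simp

lemma normal_tri_bottom:
  assumes "0 < t" "t < pi" shows "outward_unit_normal tri (t, 0) (0, -1)"
proof (rule outward_unit_normal_halfspace)
  show "(t, 0) \<in> frontier tri" using assms by (simp add: frontier_tri)
  have "open ({z::real\<times>real. fst z < pi} \<inter> {z. snd z < fst z})"
    by (intro open_Int open_Collect_less continuous_intros)
  moreover have "(t, 0) \<in> {z. fst z < pi} \<inter> {z. snd z < fst z}" using assms by simp
  ultimately have "\<forall>\<^sub>F y in at (t, 0). y \<in> {z. fst z < pi} \<inter> {z. snd z < fst z}"
    by (rule eventually_at_in_open')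
  then show "\<forall>\<^sub>F y in at (t, 0). y \<in> tri \<longleftrightarrow> (0, -1) \<bullet> (y - (t, 0)) < 0"
    by eventually_elim (auto simp: tri_def)
qed simp

lemma normal_tri_diagonal:
  assumes "0 < t" "t < pi" shows "outward_unit_normal tri (t, t) (- (1 / sqrt 2), 1 / sqrt 2)"
proof (rule outward_unit_normal_halfspace)
  show "(t, t) \<in> frontier tri" using assms by (simp add: frontier_tri)
  show "norm (- (1 / sqrt 2), 1 / sqrt 2) = (1 :: real)" by (simp add: norm_prod_def power_divide)
  have "open ({z::real\<times>real. fst z < pi} \<inter> {z. 0 < snd z})"
    by (intro open_Int open_Collect_less continuous_intros)
  moreover have "(t, t) \<in> {z. fst z < pi} \<inter> {z. 0 < snd z}" using assms by simp
  ultimately have "\<forall>\<^sub>F y in at (t, t). y \<in> {z. fst z < pi} \<inter> {z. 0 < snd z}"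
    by (rule eventually_at_in_open')
  then show "\<forall>\<^sub>F y in at (t, t). y \<in> tri \<longleftrightarrow> (- (1 / sqrt 2), 1 / sqrt 2) \<bullet> (y - (t, t)) < 0"
    by eventually_elim (auto simp: tri_def field_simps)
qed

lemma Basis_real_prod: "(Basis :: (real \<times> real) set) = {(1, 0), (0, 1)}"
  by (auto simp: Basis_prod_def)

definition zext :: "(real \<times> real \<Rightarrow> real) \<Rightarrow> real \<times> real \<Rightarrow> real" where
  "zext f z = (if z \<in> ctri then f z else 0)"

lemma md_eigenspace: "zext (md p) \<in> neumann_eigenspace tri (ev p)"
proof -
  define g where "g z = (md1 p z, md2 p z)" for z
  define H where "H z h = (md11 p z * fst h + md12 p z * snd h, md12 p z * fst h + md22 p z * snd h)" for z and h :: "real \<times> real"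
  have 1: "(zext (md p) has_derivative (\<lambda>h. g z \<bullet> h)) (at z within closure tri)" if "z \<in> closure tri" for z
  proof (rule has_derivative_transform[OF that, of "zext (md p)" "md p"])
    show "(md p has_derivative (\<lambda>h. g z \<bullet> h)) (at z within closure tri)"
      using has_derivative_md(1)[of p z] by (simp add: g_def inner_prod_def)
  qed (simp add: zext_def)
  have 2: "continuous_on (closure tri) g"
    unfolding g_def by (intro continuous_intros)
  have 3: "(g has_derivative H z) (at z)" for z
    unfolding g_def H_def by (intro has_derivative_Pair has_derivative_md)
  have 4: "continuous_on tri (\<lambda>z. H z h)" for h
    unfolding H_def by (intro continuous_intros)
  have 5: "- (\<Sum>b\<in>Basis. H z b \<bullet> b) = ev p * zext (md p) z" if "z \<in> tri" for z
    using that tri_subset_ctri md_laplace[of p z] by (auto simp: Basis_real_prod H_def zext_def inner_prod_def)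
  have 6: "g z \<bullet> n = 0" if n: "outward_unit_normal tri z n" for z n
  proof -
    obtain x y where z: "z = (x, y)" by (cases z)
    obtain a b where ab: "n = (a, b)" by (cases n)
    have "z \<in> ctri - tri" using n by (simp add: outward_unit_normal_def frontier_tri)
    \<comment> \<open>A corner falls under several cases. The argument for any one of its sides is
      valid there, as the whole line through a side avoids the open triangle.\<close>
    then consider "y = 0" | "x = y" | "x = pi" using z by force
    then show ?thesis
    proof cases
      case 1
      then have "n \<bullet> (1, 0) = 0" by (intro outward_unit_normal_orthogonal[OF n]) (simp add: z)
      then show ?thesis using 1 by (simp add: g_def z ab md_boundary)
    next
      case 2
      then have "n \<bullet> (1, 1) = 0" by (intro outward_unit_normal_orthogonal[OF n]) (simp add: z)
      then show ?thesis using 2 by (simp add: g_def z ab md_boundary flip: distrib_left)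
    next
      case 3
      then have "n \<bullet> (0, 1) = 0" by (intro outward_unit_normal_orthogonal[OF n]) (simp add: z)
      then show ?thesis using 3 by (simp add: g_def z ab md_boundary)
    qed
  qed
  show ?thesis
    unfolding neumann_eigenspace_def using 1 2 3 4 5 6
    by (auto simp: zext_def[of _ z for z] intro!: exI[of _ g] exI[of _ H])
qed

lemma subspace_neumann_eigenspace: "fun_space.subspace (neumann_eigenspace \<Omega> \<mu>)"
proof (rule fun_space.subspaceI)
  have "(\<bullet>) (0 :: 'a) = (\<lambda>h. 0 :: real)" by auto
  then show "0 \<in> neumann_eigenspace \<Omega> \<mu>"
    unfolding neumann_eigenspace_def using has_derivative_const[of "0::real"]
    by (auto simp: zero_fun_def inner_zero_left[abs_def] intro!: exI[of _ "\<lambda>_. 0"] exI[of _ "\<lambda>_ _. 0"])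
next
  fix \<phi> \<psi> assume "\<phi> \<in> neumann_eigenspace \<Omega> \<mu>" "\<psi> \<in> neumann_eigenspace \<Omega> \<mu>"
  then obtain g H g' H' where
    \<phi>: "\<forall>x. x \<notin> closure \<Omega> \<longrightarrow> \<phi> x = 0"
       "\<forall>x\<in>closure \<Omega>. (\<phi> has_derivative (\<lambda>h. g x \<bullet> h)) (at x within closure \<Omega>)" "continuous_on (closure \<Omega>) g"
       "\<forall>x\<in>\<Omega>. (g has_derivative H x) (at x)" "\<forall>h. continuous_on \<Omega> (\<lambda>x. H x h)"
       "\<forall>x\<in>\<Omega>. - (\<Sum>b\<in>Basis. H x b \<bullet> b) = \<mu> * \<phi> x" "\<forall>x n. outward_unit_normal \<Omega> x n \<longrightarrow> g x \<bullet> n = 0" and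
    \<psi>: "\<forall>x. x \<notin> closure \<Omega> \<longrightarrow> \<psi> x = 0"
       "\<forall>x\<in>closure \<Omega>. (\<psi> has_derivative (\<lambda>h. g' x \<bullet> h)) (at x within closure \<Omega>)" "continuous_on (closure \<Omega>) g'"
       "\<forall>x\<in>\<Omega>. (g' has_derivative H' x) (at x)" "\<forall>h. continuous_on \<Omega> (\<lambda>x. H' x h)"
       "\<forall>x\<in>\<Omega>. - (\<Sum>b\<in>Basis. H' x b \<bullet> b) = \<mu> * \<psi> x" "\<forall>x n. outward_unit_normal \<Omega> x n \<longrightarrow> g' x \<bullet> n = 0"
    unfolding neumann_eigenspace_def by blast
  show "\<phi> + \<psi> \<in> neumann_eigenspace \<Omega> \<mu>"
    unfolding neumann_eigenspace_def plus_fun_def mem_Collect_eq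
  proof (intro conjI exI[of _ "\<lambda>x. g x + g' x"] exI[of _ "\<lambda>x h. H x h + H' x h"] allI impI ballI)
    fix x assume x: "x \<in> \<Omega>"
    have "- (\<Sum>b\<in>Basis. (H x b + H' x b) \<bullet> b) = - (\<Sum>b\<in>Basis. H x b \<bullet> b) + - (\<Sum>b\<in>Basis. H' x b \<bullet> b)"
      by (simp add: inner_add_left sum.distrib)
    then show "- (\<Sum>b\<in>Basis. (H x b + H' x b) \<bullet> b) = \<mu> * (\<phi> x + \<psi> x)"
      using \<phi>(6) \<psi>(6) x by (simp add: distrib_left)
  next
    fix x assume x: "x \<in> closure \<Omega>"
    show "((\<lambda>x. \<phi> x + \<psi> x) has_derivative (\<lambda>h. (g x + g' x) \<bullet> h)) (at x within closure \<Omega>)"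
      unfolding inner_add_left using \<phi>(2) \<psi>(2) x by (intro has_derivative_add) auto
  qed (use \<phi> \<psi> in \<open>auto simp: inner_add_left intro!: has_derivative_add continuous_intros\<close>)
next
  fix c \<phi> assume "\<phi> \<in> neumann_eigenspace \<Omega> \<mu>"
  then obtain g H where
    \<phi>: "\<forall>x. x \<notin> closure \<Omega> \<longrightarrow> \<phi> x = 0"
       "\<forall>x\<in>closure \<Omega>. (\<phi> has_derivative (\<lambda>h. g x \<bullet> h)) (at x within closure \<Omega>)" "continuous_on (closure \<Omega>) g"
       "\<forall>x\<in>\<Omega>. (g has_derivative H x) (at x)" "\<forall>h. continuous_on \<Omega> (\<lambda>x. H x h)"
       "\<forall>x\<in>\<Omega>. - (\<Sum>b\<in>Basis. H x b \<bullet> b) = \<mu> * \<phi> x" "\<forall>x n. outward_unit_normal \<Omega> x n \<longrightarrow> g x \<bullet> n = 0"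
    unfolding neumann_eigenspace_def by blast
  show "(\<lambda>x. c * \<phi> x) \<in> neumann_eigenspace \<Omega> \<mu>"
    unfolding neumann_eigenspace_def mem_Collect_eq
  proof (intro conjI exI[of _ "\<lambda>x. c *\<^sub>R g x"] exI[of _ "\<lambda>x h. c *\<^sub>R H x h"] allI impI ballI)
    fix x assume x: "x \<in> \<Omega>"
    have "- (\<Sum>b\<in>Basis. (c *\<^sub>R H x b) \<bullet> b) = c * (- (\<Sum>b\<in>Basis. H x b \<bullet> b))"
      by (simp add: sum_distrib_left)
    then show "- (\<Sum>b\<in>Basis. (c *\<^sub>R H x b) \<bullet> b) = \<mu> * (c * \<phi> x)"
      using \<phi>(6) x by (simp add: mult.left_commute)
  next
    fix x assume x: "x \<in> closure \<Omega>"
    show "((\<lambda>x. c * \<phi> x) has_derivative (\<lambda>h. (c *\<^sub>R g x) \<bullet> h)) (at x within closure \<Omega>)"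
      using has_derivative_mult_right[OF \<phi>(2)[rule_format, OF x], of c] by simp
  qed (use \<phi> in \<open>auto intro!: continuous_intros has_derivative_scaleR_right\<close>)
qed

section \<open>Eigenfunctions are finite sums of modes\<close>

lemma tint_tendsto:
  assumes f: "\<And>n. bmeas (f n)" "bmeas g" and B: "\<And>n z. z \<in> ctri \<Longrightarrow> \<bar>f n z\<bar> \<le> B"
    and lim: "\<And>z. z \<in> ctri \<Longrightarrow> (\<lambda>n. f n z) \<longlonglongrightarrow> g z"
  shows "(\<lambda>n. tint (f n)) \<longlonglongrightarrow> tint g"
  unfolding tint_def
proof (rule integral_dominated_convergence[where w = "\<lambda>z. indicator ctri z * B"])
  show "integrable lborel (\<lambda>z. indicator ctri z * B)" by (rule integrable_bmeas) (rule bmeas_const)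
  show "(\<lambda>z. indicator ctri z * g z) \<in> borel_measurable lborel" using f(2) by (simp add: bmeas_def)
  show "(\<lambda>z. indicator ctri z * f n z) \<in> borel_measurable lborel" for n using f(1) by (simp add: bmeas_def)
  show "AE z in lborel. (\<lambda>n. indicator ctri z * f n z) \<longlonglongrightarrow> indicator ctri z * g z"
    using lim by (intro AE_I2) (auto simp: indicator_def)
  show "AE z in lborel. norm (indicator ctri z * f n z) \<le> indicator ctri z * B" for n
    using B by (intro AE_I2) (auto simp: indicator_def)
qed

text \<open>Green's second identity for \<open>\<phi>\<close> and a mode. The second derivatives of
  \<open>\<phi>\<close> exist only in \<open>tri\<close> and may be unbounded near its boundary, so
  the divergence theorem is applied to the field composed with the contractions
  \<open>\<sigma> n\<close>. In the limit the flux becomes that of the original boundary, which is 0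
  by both Neumann conditions; value and gradient of \<open>\<phi>\<close> are continuous on
  \<open>ctri\<close>, so dominated convergence applies.\<close>

lemma eigenfunction_orthogonal:
  assumes "\<phi> \<in> neumann_eigenspace tri \<mu>"
  shows "(ev p - \<mu>) * tint (\<lambda>z. \<phi> z * md p z) = 0"
proof -
  obtain g H where
    \<phi>: "\<And>x. x \<in> ctri \<Longrightarrow> (\<phi> has_derivative (\<lambda>h. g x \<bullet> h)) (at x within ctri)" and g: "continuous_on ctri g"
    and H: "\<And>x. x \<in> tri \<Longrightarrow> (g has_derivative H x) (at x)" "\<And>h. continuous_on tri (\<lambda>x. H x h)"
    and L: "\<And>x. x \<in> tri \<Longrightarrow> - (\<Sum>b\<in>Basis. H x b \<bullet> b) = \<mu> * \<phi> x"
    and N: "\<And>x n. outward_unit_normal tri x n \<Longrightarrow> g x \<bullet> n = 0"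
    using assms unfolding neumann_eigenspace_def closure_tri by blast
  have c\<phi>: "continuous_on ctri \<phi>"
    by (rule has_derivative_continuous_on[OF \<phi>])
  define f where "f = md p" define f1 where "f1 = md1 p" define f2 where "f2 = md2 p"
  \<comment> \<open>\<open>(P, Q)\<close> is the field
    \<open>f * grad \<phi> - \<phi> * grad f\<close>, whose divergence is
    \<open>(ev p - \<mu>) * \<phi> * f\<close>.\<close>
  define P where "P z = fst (g z) * f z - \<phi> z * f1 z" for z
  define Q where "Q z = snd (g z) * f z - \<phi> z * f2 z" for z
  define P1 where "P1 z = fst (H z (1, 0)) * f z - \<phi> z * md11 p z" for z
  define Q2 where "Q2 z = snd (H z (0, 1)) * f z - \<phi> z * md22 p z" for z
  have cP: "continuous_on ctri P" "continuous_on ctri Q"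
    unfolding P_def Q_def f_def f1_def f2_def by (intro continuous_intros c\<phi> g)+
  have cP1: "continuous_on tri P1" "continuous_on tri Q2"
    unfolding P1_def Q2_def f_def by (intro continuous_intros H continuous_on_subset[OF c\<phi> tri_subset_ctri])+
  have gx: "((\<lambda>x. fst (g (x, y))) has_real_derivative fst (H (x, y) (1, 0))) (at x)"
       "((\<lambda>x. \<phi> (x, y)) has_real_derivative fst (g (x, y))) (at x)"
       "((\<lambda>y. snd (g (x, y))) has_real_derivative snd (H (x, y) (0, 1))) (at y)"
       "((\<lambda>y. \<phi> (x, y)) has_real_derivative snd (g (x, y))) (at y)" if "(x, y) \<in> tri" for x y
  proof -
    have dx: "((\<lambda>x. (x, y)) has_derivative (\<lambda>h. (h, 0))) (at x)" and dy: "((\<lambda>y. (x, y)) has_derivative (\<lambda>h. (0, h))) (at y)"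
      by (auto intro!: derivative_eq_intros)
    note scale = linear_scale[OF has_derivative_linear[OF H(1)[OF that]]]
    have lin: "(\<lambda>h. fst (H (x, y) (h, 0))) = (*) (fst (H (x, y) (1, 0)))" "(\<lambda>h. snd (H (x, y) (0, h))) = (*) (snd (H (x, y) (0, 1)))"
    proof -
      have e: "(h, 0) = h *\<^sub>R (1::real, 0::real)" "(0, h) = h *\<^sub>R (0::real, 1::real)" for h by simp_all
      show "(\<lambda>h. fst (H (x, y) (h, 0))) = (*) (fst (H (x, y) (1, 0)))"
        by (rule ext, subst e(1), subst scale, simp only: fst_scaleR real_scaleR_def mult.commute)
      show "(\<lambda>h. snd (H (x, y) (0, h))) = (*) (snd (H (x, y) (0, 1)))"
        by (rule ext, subst e(2), subst scale, simp only: snd_scaleR real_scaleR_def mult.commute)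
    qed
    show "((\<lambda>x. fst (g (x, y))) has_real_derivative fst (H (x, y) (1, 0))) (at x)"
      using has_derivative_fst[OF has_derivative_compose[OF dx H(1)[OF that]]]
      unfolding has_field_derivative_def lin .
    show "((\<lambda>y. snd (g (x, y))) has_real_derivative snd (H (x, y) (0, 1))) (at y)"
      using has_derivative_snd[OF has_derivative_compose[OF dy H(1)[OF that]]]
      unfolding has_field_derivative_def lin .
    have "(\<phi> has_derivative (\<lambda>h. g (x, y) \<bullet> h)) (at (x, y) within tri)"
      by (rule has_derivative_subset[OF \<phi> tri_subset_ctri]) (use that tri_subset_ctri in blast)
    then have d: "(\<phi> has_derivative (\<lambda>h. g (x, y) \<bullet> h)) (at (x, y))"
      by (simp only: at_within_open[OF that open_tri])
    show "((\<lambda>x. \<phi> (x, y)) has_real_derivative fst (g (x, y))) (at x)"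
      using has_derivative_compose[OF dx d] by (simp add: has_field_derivative_def inner_prod_def)
    show "((\<lambda>y. \<phi> (x, y)) has_real_derivative snd (g (x, y))) (at y)"
      using has_derivative_compose[OF dy d] by (simp add: has_field_derivative_def inner_prod_def)
  qed
  have DP: "((\<lambda>x. P (x, y)) has_real_derivative P1 (x, y)) (at x)" "((\<lambda>y. Q (x, y)) has_real_derivative Q2 (x, y)) (at y)"
    if "(x, y) \<in> tri" for x y
    using DERIV_diff[OF DERIV_mult[OF gx(1)[OF that] DERIV_md(1)[of p y x UNIV]] DERIV_mult[OF gx(2)[OF that] DERIV_md(3)[of p y x UNIV]]]
      DERIV_diff[OF DERIV_mult[OF gx(3)[OF that] DERIV_md(2)[of p x y UNIV]] DERIV_mult[OF gx(4)[OF that] DERIV_md(4)[of p x y UNIV]]]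
    unfolding P_def Q_def P1_def Q2_def f_def f1_def f2_def by (simp_all add: algebra_simps)
  have div: "P1 z + Q2 z = (ev p - \<mu>) * (\<phi> z * f z)" if "z \<in> tri" for z
  proof -
    have "P1 z + Q2 z = (\<Sum>b\<in>Basis. H z b \<bullet> b) * f z - \<phi> z * (md11 p z + md22 p z)"
      by (simp add: P1_def Q2_def Basis_real_prod inner_prod_def algebra_simps)
    also have "\<dots> = (ev p - \<mu>) * (\<phi> z * f z)"
    proof -
      have "(\<Sum>b\<in>Basis. H z b \<bullet> b) = - (\<mu> * \<phi> z)" using L[OF that] by simp
      then show ?thesis unfolding md_laplace by (simp only: f_def) (simp add: algebra_simps)
    qed
    finally show ?thesis .
  qed
  have N1: "P (pi, t) - P (t, t) + Q (t, t) - Q (t, 0) = 0" if "0 < t" "t < pi" for t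
    using N[OF normal_tri_right[OF that]] N[OF normal_tri_bottom[OF that]] N[OF normal_tri_diagonal[OF that]]
    by (simp add: P_def Q_def f1_def f2_def md_boundary inner_prod_def algebra_simps)
  define \<tau> where "\<tau> n = inverse (real (Suc n))" for n
  have \<tau>: "0 < \<tau> n" "\<tau> n \<le> 1" for n by (auto simp: \<tau>_def field_simps)
  have \<tau>0: "\<tau> \<longlonglongrightarrow> 0" unfolding \<tau>_def by (rule LIMSEQ_inverse_real_of_nat)
  define \<sigma> where "\<sigma> n z = (1 - \<tau> n) *\<^sub>R z + \<tau> n *\<^sub>R (2 * pi / 3, pi / 3)" for n z
  have \<sigma>: "\<sigma> n z \<in> tri" if "z \<in> ctri" for n z
    unfolding \<sigma>_def by (rule ctri_scale[OF that \<tau>])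
  have \<sigma>': "\<sigma> n z \<in> ctri" if "z \<in> ctri" for n z using \<sigma>[OF that] tri_subset_ctri by blast
  have \<sigma>lim: "(\<lambda>n. \<sigma> n z) \<longlonglongrightarrow> z" for z
  proof -
    have "(\<lambda>n. \<sigma> n z) \<longlonglongrightarrow> (1 - 0) *\<^sub>R z + 0 *\<^sub>R (2 * pi / 3, pi / 3)"
      unfolding \<sigma>_def by (intro tendsto_intros \<tau>0)
    then show ?thesis by (simp flip: zero_prod_def)
  qed
  have c\<sigma>: "continuous_on A (\<sigma> n)" for A n unfolding \<sigma>_def by (intro continuous_intros)
  have \<sigma>c: "continuous_on ctri (\<lambda>z. h (\<sigma> n z))" if "continuous_on tri h" for h :: "real \<times> real \<Rightarrow> real" and n
    by (rule continuous_on_compose2[OF that c\<sigma>]) (use \<sigma> in auto)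
  have lim: "(\<lambda>n. h (\<sigma> n z)) \<longlonglongrightarrow> h z" if "continuous_on ctri h" "z \<in> ctri" for h :: "real \<times> real \<Rightarrow> real" and z
    using continuous_on_tendsto_compose[OF that(1) \<sigma>lim that(2)] \<sigma>'[OF that(2)] by simp
  define D where "D n t = P (\<sigma> n (pi, t)) - P (\<sigma> n (t, t)) + Q (\<sigma> n (t, t)) - Q (\<sigma> n (t, 0))" for n t
  have cD: "continuous_on {0..pi} (D n)" for n
    unfolding D_def
    by (intro continuous_intros continuous_on_compose2[OF cP(1)] continuous_on_compose2[OF cP(2)] continuous_on_compose2[OF c\<sigma>[of UNIV]])
       (use \<sigma>' in auto)
  have main: "(1 - \<tau> n) * ((ev p - \<mu>) * tint (\<lambda>z. \<phi> (\<sigma> n z) * f (\<sigma> n z))) = lint (D n)" for n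
  proof -
    have sub: "{(x, y). 0 \<le> y \<and> y \<le> x \<and> x \<le> pi} = ctri" by (simp add: ctri_def)
    have "tint (\<lambda>z. (1 - \<tau> n) * P1 (\<sigma> n z) + (1 - \<tau> n) * Q2 (\<sigma> n z)) = (LINT t|lborel. indicator {0..pi} t * D n t)"
    proof (rule triangle_divergence[where P = "\<lambda>z. P (\<sigma> n z)" and Q = "\<lambda>z. Q (\<sigma> n z)" and S = "\<lambda>_. {}" and S' = "\<lambda>_. {}"])
      fix y :: real assume "0 \<le> y" "y \<le> pi"
      then show "continuous_on {y..pi} (\<lambda>x. P (\<sigma> n (x, y)))"
        by (intro continuous_on_compose2[OF \<sigma>c[OF continuous_on_subset[OF cP(1) tri_subset_ctri]]] continuous_intros) auto
    next
      fix x :: real assume "0 \<le> x" "x \<le> pi"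
      then show "continuous_on {0..x} (\<lambda>y. Q (\<sigma> n (x, y)))"
        by (intro continuous_on_compose2[OF \<sigma>c[OF continuous_on_subset[OF cP(2) tri_subset_ctri]]] continuous_intros) auto
    next
      fix x y :: real assume *: "0 < y" "y < x" "x < pi"
      let ?u = "(1 - \<tau> n) * x + \<tau> n * (2 * pi / 3)" and ?v = "(1 - \<tau> n) * y + \<tau> n * (pi / 3)"
      have eq: "\<sigma> n (x', y') = ((1 - \<tau> n) * x' + \<tau> n * (2 * pi / 3), (1 - \<tau> n) * y' + \<tau> n * (pi / 3))" for x' y'
        by (simp add: \<sigma>_def)
      have uv: "(?u, ?v) \<in> tri" using \<sigma>[of "(x, y)" n] * unfolding eq by auto
      have "((\<lambda>x. (1 - \<tau> n) * x + \<tau> n * (2 * pi / 3)) has_real_derivative (1 - \<tau> n)) (at x)"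
        by (auto intro!: derivative_eq_intros)
      from DERIV_chain2[OF DP(1)[OF uv] this]
      show "((\<lambda>x. P (\<sigma> n (x, y))) has_real_derivative (1 - \<tau> n) * P1 (\<sigma> n (x, y))) (at x)"
        unfolding eq by (simp add: mult.commute)
      have "((\<lambda>y. (1 - \<tau> n) * y + \<tau> n * (pi / 3)) has_real_derivative (1 - \<tau> n)) (at y)"
        by (auto intro!: derivative_eq_intros)
      from DERIV_chain2[OF DP(2)[OF uv] this]
      show "((\<lambda>y. Q (\<sigma> n (x, y))) has_real_derivative (1 - \<tau> n) * Q2 (\<sigma> n (x, y))) (at y)"
        unfolding eq by (simp add: mult.commute)
    next
      show "(\<lambda>t. indicator {0..pi} t * D n t) \<in> borel_measurable borel"
        using lint_integrable[OF cD] by (auto dest: borel_measurable_integrable)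
    qed (auto simp: D_def intro!: bmeas_continuous \<sigma>c cP1 continuous_on_mult continuous_on_const)
    also have "tint (\<lambda>z. (1 - \<tau> n) * P1 (\<sigma> n z) + (1 - \<tau> n) * Q2 (\<sigma> n z)) = tint (\<lambda>z. (1 - \<tau> n) * ((ev p - \<mu>) * (\<phi> (\<sigma> n z) * f (\<sigma> n z))))"
      by (rule tint_cong) (simp add: div \<sigma> flip: distrib_left)
    also have "\<dots> = (1 - \<tau> n) * ((ev p - \<mu>) * tint (\<lambda>z. \<phi> (\<sigma> n z) * f (\<sigma> n z)))"
      by (simp only: tint_cmult)
    finally show ?thesis by (simp add: lint_def)
  qed
  have c\<phi>f: "continuous_on ctri (\<lambda>z. \<phi> z * f z)" unfolding f_def by (intro continuous_intros c\<phi>)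
  have "bounded ((\<lambda>z. \<phi> z * f z) ` ctri)" by (intro compact_imp_bounded compact_continuous_image c\<phi>f compact_ctri)
  then obtain B where B: "\<And>z. z \<in> ctri \<Longrightarrow> \<bar>\<phi> z * f z\<bar> \<le> B" unfolding bounded_iff by auto
  have limL: "(\<lambda>n. tint (\<lambda>z. \<phi> (\<sigma> n z) * f (\<sigma> n z))) \<longlonglongrightarrow> tint (\<lambda>z. \<phi> z * f z)"
  proof (rule tint_tendsto)
    show "bmeas (\<lambda>z. \<phi> (\<sigma> n z) * f (\<sigma> n z))" for n
      by (intro bmeas_continuous \<sigma>c[of "\<lambda>z. \<phi> z * f z"] continuous_on_subset[OF c\<phi>f tri_subset_ctri])
    show "bmeas (\<lambda>z. \<phi> z * f z)" by (intro bmeas_continuous c\<phi>f)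
    show "\<bar>\<phi> (\<sigma> n z) * f (\<sigma> n z)\<bar> \<le> B" if "z \<in> ctri" for n z using B[OF \<sigma>'[OF that]] .
    show "(\<lambda>n. \<phi> (\<sigma> n z) * f (\<sigma> n z)) \<longlonglongrightarrow> \<phi> z * f z" if "z \<in> ctri" for z
      by (rule lim[OF c\<phi>f that])
  qed
  have "bounded (P ` ctri)" "bounded (Q ` ctri)" by (intro compact_imp_bounded compact_continuous_image cP compact_ctri)+
  then obtain B1 B2 where B12: "\<And>z. z \<in> ctri \<Longrightarrow> \<bar>P z\<bar> \<le> B1" "\<And>z. z \<in> ctri \<Longrightarrow> \<bar>Q z\<bar> \<le> B2" unfolding bounded_iff by auto
  have "(\<lambda>n. lint (D n)) \<longlonglongrightarrow> lint (\<lambda>t. 0)"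
    unfolding lint_def
  proof (rule integral_dominated_convergence[where w = "\<lambda>t. indicator {0..pi} t * (2 * B1 + 2 * B2)"])
    show "integrable lborel (\<lambda>t. indicator {0..pi} t * (2 * B1 + 2 * B2))" by (intro lint_integrable continuous_intros)
    show "(\<lambda>t. indicator {0..pi} t * D n t) \<in> borel_measurable lborel" for n
      using lint_integrable[OF cD] by (auto dest: borel_measurable_integrable)
    have "AE t in lborel. t \<noteq> (0::real)" "AE t in lborel. t \<noteq> (pi::real)" by (rule AE_lborel_singleton)+
    then show "AE t in lborel. (\<lambda>n. indicator {0..pi} t * D n t) \<longlonglongrightarrow> indicator {0..pi} t * 0"
    proof eventually_elim
      case (elim t)
      show ?case
      proof (cases "0 < t \<and> t < pi")
        case True
        have "(\<lambda>n. D n t) \<longlonglongrightarrow> P (pi, t) - P (t, t) + Q (t, t) - Q (t, 0)"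
          unfolding D_def using True by (intro tendsto_intros lim cP) auto
        then show ?thesis using N1 True by (simp add: indicator_def)
      next
        case False
        then have "t \<notin> {0..pi}" using elim by auto
        then show ?thesis by simp
      qed
    qed
    show "AE t in lborel. norm (indicator {0..pi} t * D n t) \<le> indicator {0..pi} t * (2 * B1 + 2 * B2)" for n
    proof (rule AE_I2)
      fix t :: real
      show "norm (indicator {0..pi} t * D n t) \<le> indicator {0..pi} t * (2 * B1 + 2 * B2)"
      proof (cases "t \<in> {0..pi}")
        case True
        then have "(pi, t) \<in> ctri" "(t, t) \<in> ctri" "(t, 0) \<in> ctri" by auto
        from this[THEN \<sigma>', of n] show ?thesis
          using True B12(1)[of "\<sigma> n (pi, t)"] B12(1)[of "\<sigma> n (t, t)"] B12(2)[of "\<sigma> n (t, t)"] B12(2)[of "\<sigma> n (t, 0)"]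
          by (simp add: D_def)
      qed simp
    qed
  qed simp
  moreover have "(\<lambda>n. lint (D n)) \<longlonglongrightarrow> (1 - 0) * ((ev p - \<mu>) * tint (\<lambda>z. \<phi> z * f z))"
    unfolding main[symmetric] by (intro tendsto_intros \<tau>0 limL)
  ultimately have "(1 - 0) * ((ev p - \<mu>) * tint (\<lambda>z. \<phi> z * f z)) = lint (\<lambda>t. 0)"
    by (rule LIMSEQ_unique[symmetric])
  then show ?thesis by (simp add: lint_def f_def)
qed

section \<open>Counting the eigenvalues with lattice points\<close>

definition level :: "real \<Rightarrow> (int \<times> int) set" where
  "level \<mu> = {p \<in> modes. ev p = \<mu>}"

definition low :: "real \<Rightarrow> (int \<times> int) set" where
  "low \<mu> = {p \<in> modes. ev p < \<mu>}"

lemma finite_modes_le: "finite {p \<in> modes. ev p \<le> c}"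
proof (rule finite_subset)
  show "{p \<in> modes. ev p \<le> c} \<subseteq> {0..\<lceil>c\<rceil>} \<times> {0..\<lceil>c\<rceil>}"
  proof
    fix p assume "p \<in> {p \<in> modes. ev p \<le> c}"
    then obtain m n where p: "p = (m, n)" "0 \<le> n" "n \<le> m" "real_of_int (m\<^sup>2 + n\<^sup>2) \<le> c"
      by (auto simp: modes_def ev_def)
    have "m\<^sup>2 + n\<^sup>2 \<le> \<lceil>c\<rceil>" using p(4) by linarith
    moreover have "m \<le> m\<^sup>2" "0 \<le> n\<^sup>2" using p by (auto simp: power2_eq_square mult_le_cancel_left1)
    ultimately have "m \<le> \<lceil>c\<rceil>" by linarith
    then show "p \<in> {0..\<lceil>c\<rceil>} \<times> {0..\<lceil>c\<rceil>}" using p by auto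
  qed
qed simp

lemma finite_level [simp]: "finite (level \<mu>)"
  by (rule finite_subset[OF _ finite_modes_le[of \<mu>]]) (auto simp: level_def)

lemma finite_low [simp]: "finite (low \<mu>)"
  by (rule finite_subset[OF _ finite_modes_le[of \<mu>]]) (auto simp: low_def)

lemma tint_zext: "tint (\<lambda>z. zext f z * g z) = tint (\<lambda>z. f z * g z)"
  by (rule tint_cong) (simp add: zext_def)

lemma eigenspace_expansion:
  assumes "\<phi> \<in> neumann_eigenspace tri \<mu>"
  obtains a where "\<phi> = zext (\<lambda>z. \<Sum>p\<in>level \<mu>. a p * md p z)"
proof -
  have d: "\<exists>g. \<forall>x\<in>ctri. (\<phi> has_derivative (\<lambda>h. g x \<bullet> h)) (at x within ctri)" and 0: "\<And>z. z \<notin> ctri \<Longrightarrow> \<phi> z = 0"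
    using assms unfolding neumann_eigenspace_def closure_tri by blast+
  from d obtain g where g: "\<And>x. x \<in> ctri \<Longrightarrow> (\<phi> has_derivative (\<lambda>h. g x \<bullet> h)) (at x within ctri)" by blast
  have c: "continuous_on ctri \<phi>" by (rule has_derivative_continuous_on[OF g])
  have "\<phi> z = (\<Sum>p\<in>level \<mu>. tint (\<lambda>z. \<phi> z * md p z) / nrm p * md p z)" if "z \<in> ctri" for z
  proof (rule tint_md_complete_support[OF c _ _ _ that])
    show "level \<mu> \<subseteq> modes" by (auto simp: level_def)
    fix p assume "p \<in> modes" "p \<notin> level \<mu>"
    then show "tint (\<lambda>z. \<phi> z * md p z) = 0"
      using eigenfunction_orthogonal[OF assms, of p] by (auto simp: level_def)
  qed simp
  then have "\<phi> = zext (\<lambda>z. \<Sum>p\<in>level \<mu>. tint (\<lambda>z. \<phi> z * md p z) / nrm p * md p z)"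
    using 0 by (auto simp: zext_def)
  then show ?thesis by (rule that)
qed

lemma zext_sum: "(\<Sum>p\<in>A. (\<lambda>z. a p * zext (md p) z)) = zext (\<lambda>z. \<Sum>p\<in>A. a p * md p z)"
  by (rule ext, simp add: sum_fun_apply) (simp add: zext_def)

lemma zext_md_coeff:
  assumes "finite A" "A \<subseteq> modes" "p \<in> A" "zext (\<lambda>z. \<Sum>p\<in>A. a p * md p z) = 0"
  shows "a p = 0"
proof -
  have "tint (\<lambda>z. (\<Sum>p\<in>A. a p * md p z) * md p z) = tint (\<lambda>z. 0)"
  proof (rule tint_cong)
    fix z assume "z \<in> ctri"
    then have "(\<Sum>p\<in>A. a p * md p z) = 0" using fun_cong[OF assms(4), of z] by (simp add: zext_def)
    then show "(\<Sum>p\<in>A. a p * md p z) * md p z = 0" by simp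
  qed
  then have "a p * nrm p = 0" using assms by (subst (asm) tint_md_sum) (auto simp: tint_def)
  then show ?thesis using nrm_pos[of p] assms by auto
qed

lemma inj_zext_md: "inj_on (\<lambda>p. zext (md p)) modes"
proof (rule inj_onI)
  fix p q assume *: "p \<in> modes" "q \<in> modes" "zext (md p) = zext (md q)"
  show "p = q"
  proof (rule ccontr)
    assume "p \<noteq> q"
    have "tint (\<lambda>z. md p z * md p z) = tint (\<lambda>z. zext (md q) z * md p z)"
      unfolding *(3)[symmetric] by (simp only: tint_zext)
    then show False using md_orthogonal[of q p] * \<open>p \<noteq> q\<close> nrm_pos[of p] by (simp add: tint_zext nrm_def)
  qed
qed

lemma eigenspace_basis:
  defines "B \<mu> \<equiv> (\<lambda>p. zext (md p)) ` level \<mu>"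
  shows "fun_space.independent (B \<mu>)" "fun_space.span (B \<mu>) = neumann_eigenspace tri \<mu>" "card (B \<mu>) = card (level \<mu>)"
proof -
  have inj: "inj_on (\<lambda>p. zext (md p)) (level \<mu>)"
    by (rule inj_on_subset[OF inj_zext_md]) (auto simp: level_def)
  then show "card (B \<mu>) = card (level \<mu>)" unfolding B_def by (rule card_image)
  show "fun_space.independent (B \<mu>)"
  proof (rule fun_space.independent_if_scalars_zero)
    fix f x assume *: "(\<Sum>x\<in>B \<mu>. (\<lambda>z. f x * x z)) = 0" "x \<in> B \<mu>"
    from *(2) obtain q where q: "q \<in> level \<mu>" "x = zext (md q)" by (auto simp: B_def)
    have "(\<Sum>p\<in>level \<mu>. (\<lambda>z. f (zext (md p)) * zext (md p) z)) = 0"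
      using *(1) unfolding B_def by (subst (asm) sum.reindex[OF inj]) (simp add: o_def)
    then show "f x = 0" unfolding q zext_sum by (rule zext_md_coeff[OF finite_level _ q(1), rotated]) (auto simp: level_def)
  qed (simp add: B_def)
  show "fun_space.span (B \<mu>) = neumann_eigenspace tri \<mu>"
  proof
    show "fun_space.span (B \<mu>) \<subseteq> neumann_eigenspace tri \<mu>"
    proof (rule fun_space.span_minimal[OF _ subspace_neumann_eigenspace])
      show "B \<mu> \<subseteq> neumann_eigenspace tri \<mu>" unfolding B_def using md_eigenspace by (force simp: level_def)
    qed
    show "neumann_eigenspace tri \<mu> \<subseteq> fun_space.span (B \<mu>)"
    proof
      fix \<phi> assume "\<phi> \<in> neumann_eigenspace tri \<mu>"
      then obtain a where "\<phi> = zext (\<lambda>z. \<Sum>p\<in>level \<mu>. a p * md p z)" by (rule eigenspace_expansion)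
      then have "\<phi> = (\<Sum>p\<in>level \<mu>. (\<lambda>z. a p * zext (md p) z))" by (simp add: zext_sum)
      also have "\<dots> \<in> fun_space.span (B \<mu>)"
        unfolding B_def by (intro fun_space.span_sum fun_space.span_scale fun_space.span_base imageI)
      finally show "\<phi> \<in> fun_space.span (B \<mu>)" .
    qed
  qed
qed

lemma listing_multiplicity:
  assumes "neumann_eigenvalue_listing tri lam"
  shows "finite {j. 1 \<le> j \<and> lam j = \<mu>}" "card {j. 1 \<le> j \<and> lam j = \<mu>} = card (level \<mu>)"
proof -
  obtain B where B: "finite B" "fun_space.independent B" "fun_space.span B = neumann_eigenspace tri \<mu>"
    "finite {j. 1 \<le> j \<and> lam j = \<mu>}" "card {j. 1 \<le> j \<and> lam j = \<mu>} = card B"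
    using assms unfolding neumann_eigenvalue_listing_def by blast
  show "finite {j. 1 \<le> j \<and> lam j = \<mu>}" by fact
  have "card B = fun_space.dim (neumann_eigenspace tri \<mu>)"
    unfolding B(3)[symmetric] using B(2) by (simp add: fun_space.dim_eq_card_independent)
  also have "\<dots> = card (level \<mu>)"
    unfolding eigenspace_basis(2)[symmetric] using eigenspace_basis(1,3)[of \<mu>] by (simp add: fun_space.dim_eq_card_independent)
  finally show "card {j. 1 \<le> j \<and> lam j = \<mu>} = card (level \<mu>)" using B(5) by simp
qed

text \<open>Every listed value has positive multiplicity, hence belongs to some mode. So both sets
  split over the finitely many eigenvalues of modes below \<open>\<mu>\<close>, with equal
  multiplicities.\<close>

lemma listing_below:
  assumes "neumann_eigenvalue_listing tri lam"
  shows "finite {j. 1 \<le> j \<and> lam j < \<mu>}" "card {j. 1 \<le> j \<and> lam j < \<mu>} = card (low \<mu>)"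
proof -
  have ne: "level (lam j) \<noteq> {}" if "1 \<le> j" for j
  proof
    assume "level (lam j) = {}"
    then have "{i. 1 \<le> i \<and> lam i = lam j} = {}"
      using listing_multiplicity[OF assms, of "lam j"] by simp
    then show False using that by blast
  qed
  have 1: "{j. 1 \<le> j \<and> lam j < \<mu>} = (\<Union>k\<in>ev ` low \<mu>. {j. 1 \<le> j \<and> lam j = k})"
  proof (intro equalityI subsetI)
    fix j assume j: "j \<in> {j. 1 \<le> j \<and> lam j < \<mu>}"
    then obtain p where "p \<in> level (lam j)" using ne by blast
    then show "j \<in> (\<Union>k\<in>ev ` low \<mu>. {j. 1 \<le> j \<and> lam j = k})"
      using j by (intro UN_I[of "lam j"] image_eqI[of _ _ p]) (auto simp: level_def low_def)
  qed (auto simp: low_def)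
  have 2: "low \<mu> = (\<Union>k\<in>ev ` low \<mu>. level k)"
    by (auto simp: low_def level_def)
  show "finite {j. 1 \<le> j \<and> lam j < \<mu>}"
    unfolding 1 using listing_multiplicity(1)[OF assms] by simp
  have "card {j. 1 \<le> j \<and> lam j < \<mu>} = (\<Sum>k\<in>ev ` low \<mu>. card {j. 1 \<le> j \<and> lam j = k})"
    unfolding 1 using listing_multiplicity(1)[OF assms] by (intro card_UN_disjoint) auto
  also have "\<dots> = (\<Sum>k\<in>ev ` low \<mu>. card (level k))"
    using listing_multiplicity(2)[OF assms] by simp
  also have "\<dots> = card (\<Union>k\<in>ev ` low \<mu>. level k)"
  proof (rule card_UN_disjoint[symmetric])
    show "\<forall>i\<in>ev ` low \<mu>. \<forall>j\<in>ev ` low \<mu>. i \<noteq> j \<longrightarrow> level i \<inter> level j = {}"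
      by (auto simp: level_def)
  qed simp_all
  finally show "card {j. 1 \<le> j \<and> lam j < \<mu>} = card (low \<mu>)" using 2 by simp
qed

lemma counting_number_tri:
  "neumann_eigenvalue_listing tri lam \<Longrightarrow> counting_number lam \<mu> = card (low \<mu>) + 1"
  unfolding counting_number_def by (simp only: listing_below)

lemma listing_less_iff:
  assumes l: "neumann_eigenvalue_listing tri lam" and j: "1 \<le> j"
  shows "lam j < \<mu> \<longleftrightarrow> j \<le> card (low \<mu>)"
proof -
  let ?S = "{j. 1 \<le> j \<and> lam j < \<mu>}"
  have mono: "lam i \<le> lam k" if "1 \<le> i" "i \<le> k" for i k
    using l that unfolding neumann_eigenvalue_listing_def mono_on_def by auto
  show ?thesis
  proof
    assume "lam j < \<mu>"
    then have "{1..j} \<subseteq> ?S" using mono by fastforce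
    from card_mono[OF listing_below(1)[OF l] this] show "j \<le> card (low \<mu>)" by (simp only: listing_below(2)[OF l]) simp
  next
    assume "j \<le> card (low \<mu>)"
    show "lam j < \<mu>"
    proof (rule ccontr)
      assume "\<not> lam j < \<mu>"
      then have "?S \<subseteq> {1..<j}" using mono[OF j] by (auto simp: not_less) (meson leI le_less_trans order.strict_trans2 not_le)
      from card_mono[OF _ this] have "card (low \<mu>) \<le> j - 1" by (simp only: listing_below(2)[OF l]) simp
      then show False using \<open>j \<le> card (low \<mu>)\<close> j by simp
    qed
  qed
qed

lemma listing_value:
  assumes l: "neumann_eigenvalue_listing tri lam" and j: "1 \<le> j"
    and "card (low c) < j" "j \<le> card {p \<in> modes. ev p \<le> c}"
  shows "lam j = c"
proof (rule antisym)
  show "c \<le> lam j" using listing_less_iff[OF l j, of c] assms by simp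
  show "lam j \<le> c"
  proof (rule field_le_epsilon)
    \<comment> \<open>\<open>listing_less_iff\<close> controls strict inequalities only, so the
      bound by \<open>c\<close> is approached through \<open>c + e\<close>.\<close>
    fix e :: real assume "0 < e"
    have "card {p \<in> modes. ev p \<le> c} \<le> card (low (c + e))"
      using \<open>0 < e\<close> by (intro card_mono[OF finite_low]) (auto simp: low_def)
    then have "j \<le> card (low (c + e))" using assms by simp
    then show "lam j \<le> c + e" using listing_less_iff[OF l j, of "c + e"] by simp
  qed
qed

text \<open>A filter over a finite integer box, which can be counted by evaluation.\<close>

lemma modes_le_explicit:
  "{p \<in> modes. ev p \<le> of_int c} = Set.filter (\<lambda>(m, n). n \<le> m \<and> m\<^sup>2 + n\<^sup>2 \<le> c) ({0..c} \<times> {0..c})"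
proof (intro equalityI subsetI)
  fix p assume "p \<in> {p \<in> modes. ev p \<le> of_int c}"
  then obtain m n where p: "p = (m, n)" "0 \<le> n" "n \<le> m" "m\<^sup>2 + n\<^sup>2 \<le> c"
    by (auto simp: modes_def ev_def simp flip: of_int_power of_int_add)
  have "m \<le> m\<^sup>2" "0 \<le> n\<^sup>2" using p by (auto simp: power2_eq_square mult_le_cancel_left1)
  then have "m \<le> c" using p by linarith
  then show "p \<in> Set.filter (\<lambda>(m, n). n \<le> m \<and> m\<^sup>2 + n\<^sup>2 \<le> c) ({0..c} \<times> {0..c})" using p by auto
qed (auto simp: modes_def ev_def simp flip: of_int_power of_int_add)

lemma low_explicit: "low (of_int c) = {p \<in> modes. ev p \<le> of_int (c - 1)}"
  by (auto simp: low_def ev_def simp flip: of_int_power of_int_add)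

text \<open>The eigenvalues of modes up to 8 are 0, 1, 2, 4, 5 and 8, all simple. The bounds -1, 3
  and 7 arise from \<open>low_explicit\<close> at 0, 4 and 8.\<close>

lemma card_modes_le:
  "card {p \<in> modes. ev p \<le> of_int (-1)} = 0" "card {p \<in> modes. ev p \<le> of_int 0} = 1"
  "card {p \<in> modes. ev p \<le> of_int 1} = 2" "card {p \<in> modes. ev p \<le> of_int 2} = 3"
  "card {p \<in> modes. ev p \<le> of_int 3} = 3" "card {p \<in> modes. ev p \<le> of_int 4} = 4"
  "card {p \<in> modes. ev p \<le> of_int 7} = 5" "card {p \<in> modes. ev p \<le> of_int 8} = 6"
  unfolding modes_le_explicit by code_simp+

lemma listing_values:
  assumes l: "neumann_eigenvalue_listing tri lam"
  shows "lam 1 = 0" "lam 2 = 1" "lam 3 = 2" "lam 4 = 4" "lam 6 = 8"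
  using listing_value[OF l, of 1 "of_int 0"] listing_value[OF l, of 2 "of_int 1"] listing_value[OF l, of 3 "of_int 2"]
    listing_value[OF l, of 4 "of_int 4"] listing_value[OF l, of 6 "of_int 8"]
  unfolding low_explicit by (simp_all add: card_modes_le del: of_int_numeral of_int_0 of_int_1 of_int_minus)

section \<open>Courant's argument with an extra test function\<close>

text \<open>Gaussian elimination by induction on the equations: an equation with a nonzero
  coefficient \<open>M i0 j\<close> serves to eliminate the unknown \<open>i0\<close> from all the
  others.\<close>

lemma homogeneous_system_nontrivial_solution:
  fixes M :: "'i \<Rightarrow> 'j \<Rightarrow> real"
  assumes "finite J" "finite I" "card J < card I"
  shows "\<exists>c. (\<exists>i\<in>I. c i \<noteq> 0) \<and> (\<forall>j\<in>J. (\<Sum>i\<in>I. c i * M i j) = 0)"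
  using assms
proof (induction J arbitrary: I M rule: finite_induct)
  case empty
  then obtain i where "i \<in> I" by (auto simp: card_gt_0_iff)
  then show ?case by (intro exI[of _ "\<lambda>_. 1"]) auto
next
  case (insert j J)
  show ?case
  proof (cases "\<forall>i\<in>I. M i j = 0")
    case True
    obtain c where "\<exists>i\<in>I. c i \<noteq> 0" "\<forall>k\<in>J. (\<Sum>i\<in>I. c i * M i k) = 0"
      using insert.IH[of I M] insert.prems insert.hyps by auto
    then show ?thesis using True by (intro exI[of _ c]) auto
  next
    case False
    then obtain i0 where i0: "i0 \<in> I" "M i0 j \<noteq> 0" by blast
    let ?I = "I - {i0}"
    obtain c where c: "\<exists>i\<in>?I. c i \<noteq> 0" "\<forall>k\<in>J. (\<Sum>i\<in>?I. c i * (M i k - M i j / M i0 j * M i0 k)) = 0"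
    proof -
      have "card J < card ?I" using insert.prems insert.hyps i0 by simp
      then show ?thesis
        using insert.IH[of ?I "\<lambda>i k. M i k - M i j / M i0 j * M i0 k"] insert.prems that by blast
    qed
    define d where "d i = (if i = i0 then - (\<Sum>i\<in>?I. c i * (M i j / M i0 j)) else c i)" for i
    have d: "(\<Sum>i\<in>I. d i * M i k) = (\<Sum>i\<in>?I. c i * (M i k - M i j / M i0 j * M i0 k))" for k
    proof -
      have "(\<Sum>i\<in>I. d i * M i k) = d i0 * M i0 k + (\<Sum>i\<in>?I. d i * M i k)"
        using insert.prems i0 by (intro sum.remove) auto
      also have "(\<Sum>i\<in>?I. d i * M i k) = (\<Sum>i\<in>?I. c i * M i k)"
        by (intro sum.cong) (auto simp: d_def)
      also have "d i0 * M i0 k = - (\<Sum>i\<in>?I. c i * (M i j / M i0 j * M i0 k))"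
        by (simp add: d_def sum_distrib_right mult.assoc)
      finally show ?thesis by (simp add: right_diff_distrib sum_subtractf)
    qed
    have "(\<Sum>i\<in>I. d i * M i j) = 0" unfolding d using i0 by simp
    moreover have "\<exists>i\<in>I. d i \<noteq> 0" using c(1) by (auto simp: d_def)
    ultimately show ?thesis using c(2) by (intro exI[of _ d]) (auto simp: d)
  qed
qed

text \<open>\<open>(v1, v2)\<close> is a weak gradient of \<open>v\<close>, tested against gradients
  of modes only. This admits functions with kinks, is stable under linear combinations, and is what
  Bessel's inequality for gradients uses.\<close>

definition mode_green :: "(real \<times> real \<Rightarrow> real) \<Rightarrow> (real \<times> real \<Rightarrow> real) \<Rightarrow> (real \<times> real \<Rightarrow> real) \<Rightarrow> bool" where
  "mode_green v v1 v2 \<longleftrightarrow> bmeas v \<and> bmeas v1 \<and> bmeas v2 \<and>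
     (\<forall>p. tint (\<lambda>z. v1 z * md1 p z + v2 z * md2 p z) = ev p * tint (\<lambda>z. v z * md p z))"

lemma mode_greenD:
  assumes "mode_green v v1 v2"
  shows "tint (\<lambda>z. v1 z * md1 p z + v2 z * md2 p z) = ev p * tint (\<lambda>z. v z * md p z)"
    and "bmeas v" "bmeas v1" "bmeas v2"
  using assms unfolding mode_green_def by blast+

lemma mode_green_sum:
  assumes "mode_green v v1 v2"
  shows "tint (\<lambda>z. v1 z * (\<Sum>p\<in>A. b p * md1 p z) + v2 z * (\<Sum>p\<in>A. b p * md2 p z)) = (\<Sum>p\<in>A. b p * ev p * tint (\<lambda>z. v z * md p z))"
proof -
  have b: "bmeas v1" "bmeas v2" using assms by (auto simp: mode_green_def)
  have "tint (\<lambda>z. v1 z * (\<Sum>p\<in>A. b p * md1 p z) + v2 z * (\<Sum>p\<in>A. b p * md2 p z)) =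
    tint (\<lambda>z. \<Sum>p\<in>A. b p * (v1 z * md1 p z + v2 z * md2 p z))"
    by (simp add: sum_distrib_left sum.distrib distrib_left mult_ac)
  also have "\<dots> = (\<Sum>p\<in>A. b p * ev p * tint (\<lambda>z. v z * md p z))"
    by (subst tint_sum) (intro bmeas_intros b, simp add: tint_cmult mode_greenD(1)[OF assms] mult.assoc)
  finally show ?thesis .
qed

lemma mode_green_line_derivatives:
  assumes c: "continuous_on ctri w" "continuous_on ctri w1" "continuous_on ctri w2"
    and d: "\<And>x y. (x, y) \<in> tri \<Longrightarrow> ((\<lambda>x. w (x, y)) has_real_derivative w1 (x, y)) (at x)"
           "\<And>x y. (x, y) \<in> tri \<Longrightarrow> ((\<lambda>y. w (x, y)) has_real_derivative w2 (x, y)) (at y)"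
  shows "mode_green w w1 w2"
  unfolding mode_green_def
proof (intro conjI allI)
  show b: "bmeas w" "bmeas w1" "bmeas w2" using c by (auto intro: bmeas_continuous)
  fix p
  have cx: "continuous_on {y..pi} (\<lambda>x. w (x, y))" if "0 \<le> y" for y
    by (rule continuous_on_compose2[OF c(1)]) (use that in \<open>auto intro!: continuous_intros\<close>)
  have cy: "continuous_on {0..x} (\<lambda>y. w (x, y))" if "x \<le> pi" for x
    by (rule continuous_on_compose2[OF c(1)]) (use that in \<open>auto intro!: continuous_intros\<close>)
  have m: "continuous_on A (\<lambda>x. md1 p (x, y))" "continuous_on A (\<lambda>y. md2 p (x, y))" for A x y
    by (auto intro!: continuous_on_compose2[OF continuous_md(2)[of UNIV]] continuous_on_compose2[OF continuous_md(3)[of UNIV]] continuous_intros)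
  have "tint (\<lambda>z. w1 z * md1 p z + w2 z * md2 p z) = - tint (\<lambda>z. w z * (md11 p z + md22 p z))"
    by (rule triangle_green[where S = "\<lambda>_. {}" and S' = "\<lambda>_. {}"])
       (auto intro!: continuous_on_mult cx cy m d DERIV_md b bmeas_md simp: md_boundary)
  also have "\<dots> = ev p * tint (\<lambda>z. w z * md p z)"
    unfolding md_laplace tint_minus[symmetric] tint_cmult[symmetric] by (intro arg_cong[where f = tint]) (auto simp: mult_ac)
  finally show "tint (\<lambda>z. w1 z * md1 p z + w2 z * md2 p z) = ev p * tint (\<lambda>z. w z * md p z)" .
qed

lemma mode_green_md_sum: "mode_green (\<lambda>z. \<Sum>p\<in>A. b p * md p z) (\<lambda>z. \<Sum>p\<in>A. b p * md1 p z) (\<lambda>z. \<Sum>p\<in>A. b p * md2 p z)"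
  by (rule mode_green_line_derivatives) (auto intro!: continuous_intros DERIV_sum DERIV_cmult DERIV_md)

lemma mode_green_add:
  assumes "mode_green v v1 v2" "mode_green w w1 w2"
  shows "mode_green (\<lambda>z. v z + c * w z) (\<lambda>z. v1 z + c * w1 z) (\<lambda>z. v2 z + c * w2 z)"
proof -
  have b: "bmeas v" "bmeas v1" "bmeas v2" "bmeas w" "bmeas w1" "bmeas w2" using assms by (auto simp: mode_green_def)
  have "tint (\<lambda>z. (v1 z + c * w1 z) * md1 p z + (v2 z + c * w2 z) * md2 p z) = ev p * tint (\<lambda>z. (v z + c * w z) * md p z)" for p
  proof -
    have "tint (\<lambda>z. (v1 z + c * w1 z) * md1 p z + (v2 z + c * w2 z) * md2 p z) =
      tint (\<lambda>z. (v1 z * md1 p z + v2 z * md2 p z) + c * (w1 z * md1 p z + w2 z * md2 p z))"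
      by (simp add: algebra_simps)
    also have "\<dots> = ev p * tint (\<lambda>z. v z * md p z) + c * (ev p * tint (\<lambda>z. w z * md p z))"
      by (subst tint_add) ((intro bmeas_intros b)+, simp add: tint_cmult assms[THEN mode_greenD(1)])
    also have "\<dots> = ev p * tint (\<lambda>z. v z * md p z + c * (w z * md p z))"
      by (subst tint_add) ((intro bmeas_intros b)+, simp add: tint_cmult algebra_simps)
    finally show ?thesis by (simp add: algebra_simps)
  qed
  then show ?thesis unfolding mode_green_def using b by (auto intro!: bmeas_intros)
qed

text \<open>Gradients of modes are orthogonal with squared norms \<open>ev p * nrm p\<close>. The
  bound is Bessel's inequality for them: the squared distance between \<open>(v1, v2)\<close> and
  the gradient of the truncated Fourier sum \<open>g\<close> is nonnegative.\<close>

lemma bessel_gradient: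
  assumes v: "mode_green v v1 v2" and A: "finite A" "A \<subseteq> modes"
  shows "(\<Sum>p\<in>A. ev p * (tint (\<lambda>z. v z * md p z))\<^sup>2 / nrm p) \<le> tint (\<lambda>z. (v1 z)\<^sup>2 + (v2 z)\<^sup>2)"
proof -
  have b: "bmeas v1" "bmeas v2" using v by (auto simp: mode_green_def)
  define u where "u p = tint (\<lambda>z. v z * md p z)" for p
  define c where "c p = u p / nrm p" for p
  define g where "g z = (\<Sum>p\<in>A. c p * md p z)" for z
  define g1 where "g1 z = (\<Sum>p\<in>A. c p * md1 p z)" for z
  define g2 where "g2 z = (\<Sum>p\<in>A. c p * md2 p z)" for z
  have bg: "bmeas g1" "bmeas g2" unfolding g1_def g2_def by (intro bmeas_intros)+
  have 1: "tint (\<lambda>z. v1 z * g1 z + v2 z * g2 z) = (\<Sum>p\<in>A. ev p * (u p)\<^sup>2 / nrm p)"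
    unfolding g1_def g2_def mode_green_sum[OF v] u_def[symmetric] by (simp add: c_def power2_eq_square mult_ac)
  have 2: "tint (\<lambda>z. g1 z * g1 z + g2 z * g2 z) = (\<Sum>p\<in>A. ev p * (u p)\<^sup>2 / nrm p)"
  proof -
    have "mode_green g g1 g2" unfolding g_def[abs_def] g1_def[abs_def] g2_def[abs_def] by (rule mode_green_md_sum)
    then have "tint (\<lambda>z. g1 z * g1 z + g2 z * g2 z) = (\<Sum>p\<in>A. c p * ev p * tint (\<lambda>z. g z * md p z))"
      using mode_green_sum[of g g1 g2 c A] by (simp add: g1_def g2_def)
    also have "\<dots> = (\<Sum>p\<in>A. ev p * (u p)\<^sup>2 / nrm p)"
    proof (rule sum.cong[OF refl])
      fix p assume p: "p \<in> A"
      then have "nrm p \<noteq> 0" using nrm_pos[of p] A by auto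
      then show "c p * ev p * tint (\<lambda>z. g z * md p z) = ev p * (u p)\<^sup>2 / nrm p"
        unfolding g_def using A p by (subst tint_md_sum) (auto simp: c_def power2_eq_square)
    qed
    finally show ?thesis .
  qed
  have "0 \<le> tint (\<lambda>z. (v1 z - g1 z)\<^sup>2 + (v2 z - g2 z)\<^sup>2)" by (rule tint_nonneg) simp
  also have "\<dots> = tint (\<lambda>z. (((v1 z)\<^sup>2 + (v2 z)\<^sup>2) - 2 * (v1 z * g1 z + v2 z * g2 z)) + (g1 z * g1 z + g2 z * g2 z))"
    by (rule tint_cong) (simp add: power2_eq_square algebra_simps)
  also have "\<dots> = tint (\<lambda>z. (v1 z)\<^sup>2 + (v2 z)\<^sup>2) - 2 * tint (\<lambda>z. v1 z * g1 z + v2 z * g2 z) + tint (\<lambda>z. g1 z * g1 z + g2 z * g2 z)"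
    by (subst tint_add; (subst tint_diff)?) ((intro bmeas_intros b bg)+, simp only: tint_cmult)
  finally show ?thesis unfolding 1 2 u_def by simp
qed

text \<open>Because the coefficients below \<open>\<mu>\<close> are 0, all terms
  \<open>(ev q - \<mu>) * (u q)^2 / nrm q\<close> are nonnegative. Hypothesis \<open>R\<close> and
  Parseval bound their sum over a large finite set by \<open>\<mu> * d\<close> with \<open>d\<close>
  arbitrarily small, so no mode above \<open>\<mu>\<close> contributes either.\<close>

lemma rayleigh_expansion:
  assumes c: "continuous_on ctri v" and \<mu>: "0 \<le> \<mu>"
    and R: "\<And>A. finite A \<Longrightarrow> A \<subseteq> modes \<Longrightarrow> (\<Sum>p\<in>A. ev p * (tint (\<lambda>z. v z * md p z))\<^sup>2 / nrm p) \<le> \<mu> * tint (\<lambda>z. v z * v z)"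
    and low: "\<And>p. p \<in> low \<mu> \<Longrightarrow> tint (\<lambda>z. v z * md p z) = 0"
    and z: "z \<in> ctri"
  shows "v z = (\<Sum>p\<in>level \<mu>. tint (\<lambda>z. v z * md p z) / nrm p * md p z)"
proof (rule tint_md_complete_support[OF c finite_level _ _ z])
  show "level \<mu> \<subseteq> modes" by (auto simp: level_def)
  fix p assume p: "p \<in> modes" "p \<notin> level \<mu>"
  define u where "u p = tint (\<lambda>z. v z * md p z)" for p
  show "tint (\<lambda>z. v z * md p z) = 0"
  proof (cases "ev p < \<mu>")
    case True
    then show ?thesis using p low by (auto simp: low_def)
  next
    case False
    then have gt: "ev p > \<mu>" using p by (auto simp: level_def)
    have "(ev p - \<mu>) * (u p)\<^sup>2 / nrm p \<le> 0 + e" if "e > 0" for e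
    proof -
      define d where "d = e / (\<mu> + 1)"
      have d: "d > 0" "\<mu> * d \<le> e" using that \<mu> by (auto simp: d_def field_simps)
      obtain A where A: "finite A" "A \<subseteq> modes"
        "\<And>B. finite B \<Longrightarrow> A \<subseteq> B \<Longrightarrow> B \<subseteq> modes \<Longrightarrow> tint (\<lambda>z. v z * v z) \<le> (\<Sum>p\<in>B. (u p)\<^sup>2 / nrm p) + d"
        unfolding u_def using md_parseval[OF c d(1)] by blast
      let ?B = "insert p A"
      have B: "finite ?B" "?B \<subseteq> modes" using A p by auto
      have pos: "0 \<le> (ev q - \<mu>) * (u q)\<^sup>2 / nrm q" if "q \<in> ?B" for q
      proof -
        have q: "q \<in> modes" using that B by auto
        show ?thesis
        proof (cases "ev q < \<mu>")
          case True
          then have "u q = 0" using low q by (auto simp: u_def low_def)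
          then show ?thesis by simp
        next
          case False
          then show ?thesis using nrm_pos[OF q] by simp
        qed
      qed
      have "(ev p - \<mu>) * (u p)\<^sup>2 / nrm p \<le> (\<Sum>q\<in>?B. (ev q - \<mu>) * (u q)\<^sup>2 / nrm q)"
        by (rule member_le_sum) (use pos B in auto)
      also have "\<dots> = (\<Sum>q\<in>?B. ev q * (u q)\<^sup>2 / nrm q) - \<mu> * (\<Sum>q\<in>?B. (u q)\<^sup>2 / nrm q)"
        by (simp add: left_diff_distrib diff_divide_distrib sum_subtractf sum_distrib_left)
      also have "\<dots> \<le> \<mu> * tint (\<lambda>z. v z * v z) - \<mu> * (tint (\<lambda>z. v z * v z) - d)"
        using R[OF B] A(3)[OF B(1) subset_insertI B(2)] \<mu> unfolding u_def[symmetric]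
        by (intro diff_mono mult_left_mono) auto
      also have "\<dots> = \<mu> * d" by (simp add: algebra_simps)
      finally show ?thesis using d by simp
    qed
    then have "(ev p - \<mu>) * (u p)\<^sup>2 / nrm p \<le> 0" by (rule field_le_epsilon)
    moreover have "(ev p - \<mu>) / nrm p > 0" using gt nrm_pos[OF p(1)] by simp
    ultimately have "(u p)\<^sup>2 \<le> 0" by (metis mult.commute mult_le_0_iff not_less times_divide_eq_left)
    then show ?thesis by (simp add: u_def)
  qed
qed

text \<open>The cut-off \<open>F\<close> makes \<open>F \<circ> \<phi>\<close> vanish to second order on the nodal set of \<open>\<phi>\<close>; \<open>G\<close> is the
  primitive of \<open>F'\<^sup>2\<close>, so that \<open>G \<circ> \<phi>\<close> tests the energy of \<open>F \<circ> \<phi>\<close>.\<close>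

definition cutF :: "real \<Rightarrow> real \<Rightarrow> real" where
  "cutF d t = t - d * arctan (t / d)"

definition cutF' :: "real \<Rightarrow> real \<Rightarrow> real" where
  "cutF' d t = t\<^sup>2 / (t\<^sup>2 + d\<^sup>2)"

definition cutG :: "real \<Rightarrow> real \<Rightarrow> real" where
  "cutG d t = t - 3 / 2 * (d * arctan (t / d)) + d\<^sup>2 / 2 * (t / (t\<^sup>2 + d\<^sup>2))"

lemma arctan_derivative_scaled:
  fixes d t :: real
  assumes "0 < d"
  shows "d * (inverse (1 + (t / d)\<^sup>2) * (1 / d)) = d\<^sup>2 / (t\<^sup>2 + d\<^sup>2)"
proof -
  have "1 + (t / d)\<^sup>2 = (t\<^sup>2 + d\<^sup>2) / d\<^sup>2"
    using assms by (simp add: power_divide add_divide_distrib)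
  then show ?thesis using assms by simp
qed

lemma DERIV_cutF: assumes "0 < d" shows "(cutF d has_real_derivative cutF' d t) (at t)"
proof -
  have s: "t\<^sup>2 + d\<^sup>2 > 0" using assms by (simp add: pos_add_strict add_nonneg_pos)
  have "(cutF d has_real_derivative 1 - d * (inverse (1 + (t / d)\<^sup>2) * (1 / d))) (at t)"
    unfolding cutF_def using assms by (auto intro!: derivative_eq_intros)
  also have "1 - d * (inverse (1 + (t / d)\<^sup>2) * (1 / d)) = cutF' d t"
  proof -
    have "1 = (t\<^sup>2 + d\<^sup>2) / (t\<^sup>2 + d\<^sup>2)" using s by (intro divide_self[symmetric]) linarith
    then have "1 - d\<^sup>2 / (t\<^sup>2 + d\<^sup>2) = (t\<^sup>2 + d\<^sup>2) / (t\<^sup>2 + d\<^sup>2) - d\<^sup>2 / (t\<^sup>2 + d\<^sup>2)" by simp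
    also have "\<dots> = t\<^sup>2 / (t\<^sup>2 + d\<^sup>2)" by (simp only: diff_divide_distrib[symmetric]) simp
    finally show ?thesis unfolding arctan_derivative_scaled[OF assms] cutF'_def .
  qed
  finally show ?thesis .
qed

lemma DERIV_cutG: assumes "0 < d" shows "(cutG d has_real_derivative (cutF' d t)\<^sup>2) (at t)"
proof -
  define s where "s = t\<^sup>2 + d\<^sup>2"
  have s: "s > 0" using assms by (simp add: s_def add_nonneg_pos)
  have 1: "((\<lambda>t. d * arctan (t / d)) has_real_derivative d\<^sup>2 / s) (at t)"
  proof -
    have "((\<lambda>t. d * arctan (t / d)) has_real_derivative d * (inverse (1 + (t / d)\<^sup>2) * (1 / d))) (at t)"
      using assms by (auto intro!: derivative_eq_intros)
    also have "d * (inverse (1 + (t / d)\<^sup>2) * (1 / d)) = d\<^sup>2 / s"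
      unfolding arctan_derivative_scaled[OF assms] s_def ..
    finally show ?thesis .
  qed
  have 2: "((\<lambda>t. t / (t\<^sup>2 + d\<^sup>2)) has_real_derivative (d\<^sup>2 - t\<^sup>2) / s\<^sup>2) (at t)"
    using s by (auto intro!: derivative_eq_intros simp: s_def power2_eq_square algebra_simps)
  have "(cutG d has_real_derivative (1 - 3 / 2 * (d\<^sup>2 / s) + d\<^sup>2 / 2 * ((d\<^sup>2 - t\<^sup>2) / s\<^sup>2))) (at t)"
    unfolding cutG_def by (intro DERIV_add DERIV_diff DERIV_ident DERIV_cmult 1 2)
  also have "1 - 3 / 2 * (d\<^sup>2 / s) + d\<^sup>2 / 2 * ((d\<^sup>2 - t\<^sup>2) / s\<^sup>2) = (s\<^sup>2 - 3 / 2 * d\<^sup>2 * s + d\<^sup>2 / 2 * (d\<^sup>2 - t\<^sup>2)) / s\<^sup>2"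
    using s by (simp add: field_simps power2_eq_square)
  also have "s\<^sup>2 - 3 / 2 * d\<^sup>2 * s + d\<^sup>2 / 2 * (d\<^sup>2 - t\<^sup>2) = (t\<^sup>2)\<^sup>2"
    by (simp add: s_def power2_eq_square algebra_simps)
  also have "(t\<^sup>2)\<^sup>2 / s\<^sup>2 = (cutF' d t)\<^sup>2" by (simp add: cutF'_def s_def power_divide)
  finally show ?thesis .
qed

lemma cut_0 [simp]: "cutF d 0 = 0" "cutF' d 0 = 0" "cutG d 0 = 0"
  by (simp_all add: cutF_def cutF'_def cutG_def)

text \<open>Both cut-offs converge uniformly to the identity as \<open>d\<close> tends to 0; the
  constants are generous.\<close>

lemma cut_bounds:
  assumes "0 < d" shows "\<bar>cutF d t - t\<bar> \<le> 2 * d" "\<bar>cutG d t - t\<bar> \<le> 4 * d"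
proof -
  have a: "\<bar>d * arctan (t / d)\<bar> \<le> 2 * d"
  proof -
    have "\<bar>arctan (t / d)\<bar> \<le> 2" using arctan_bounded[of "t / d"] pi_half_less_two by linarith
    then show ?thesis using assms by (simp add: abs_mult mult.commute)
  qed
  then show "\<bar>cutF d t - t\<bar> \<le> 2 * d" by (simp add: cutF_def)
  have s: "t\<^sup>2 + d\<^sup>2 > 0" using assms by (simp add: add_nonneg_pos)
  have "0 \<le> (\<bar>t\<bar> - d)\<^sup>2" by simp
  then have "d * (2 * \<bar>t\<bar>) \<le> t\<^sup>2 + d\<^sup>2" by (simp add: power2_eq_square algebra_simps)
  then have "d * (d * (2 * \<bar>t\<bar>)) \<le> d * (t\<^sup>2 + d\<^sup>2)" using assms by (intro mult_left_mono) auto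
  moreover have "0 \<le> d * (t\<^sup>2 + d\<^sup>2)" using assms s by simp
  ultimately have "d\<^sup>2 * \<bar>t\<bar> \<le> d * (2 * (t\<^sup>2 + d\<^sup>2))" by (simp add: power2_eq_square algebra_simps)
  moreover have "\<bar>d\<^sup>2 / 2 * (t / (t\<^sup>2 + d\<^sup>2))\<bar> = d\<^sup>2 * \<bar>t\<bar> / (2 * (t\<^sup>2 + d\<^sup>2))"
    using s by (simp add: abs_mult)
  ultimately have "\<bar>d\<^sup>2 / 2 * (t / (t\<^sup>2 + d\<^sup>2))\<bar> \<le> d"
    using s by (simp add: pos_divide_le_eq)
  then show "\<bar>cutG d t - t\<bar> \<le> 4 * d" using a unfolding cutG_def by linarith
qed

lemma continuous_cut:
  assumes "0 < d" "continuous_on A f"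
  shows "continuous_on A (\<lambda>z. cutF d (f z))" "continuous_on A (\<lambda>z. cutG d (f z))" "continuous_on A (\<lambda>z. cutF' d (f z))"
proof -
  have s: "t\<^sup>2 + d\<^sup>2 \<noteq> 0" for t using assms by (simp add: add_nonneg_pos less_imp_neq[symmetric])
  have "isCont (cutF' d) t" for t unfolding cutF'_def using s by (intro continuous_intros)
  then have "continuous_on UNIV (cutF' d)" by (simp add: continuous_at_imp_continuous_on)
  moreover have "continuous_on UNIV (cutF d)" "continuous_on UNIV (cutG d)"
    using DERIV_cutF[OF assms(1)] DERIV_cutG[OF assms(1)] by (auto intro!: continuous_at_imp_continuous_on DERIV_isCont)
  ultimately show "continuous_on A (\<lambda>z. cutF d (f z))" "continuous_on A (\<lambda>z. cutG d (f z))" "continuous_on A (\<lambda>z. cutF' d (f z))"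
    using assms(2) by (auto intro: continuous_on_compose2[of UNIV _ A f])
qed

section \<open>Combinations of restrictions to nodal domains\<close>

text \<open>Models the coefficient function of a linear combination of restrictions of
  \<open>\<phi>\<close> to nodal domains. It may jump across the nodal set, so it is used only in
  products with functions that vanish there.\<close>

definition locally_const_off :: "(real \<times> real \<Rightarrow> real) \<Rightarrow> (real \<times> real \<Rightarrow> real) \<Rightarrow> bool" where
  "locally_const_off \<phi> s \<longleftrightarrow> (\<exists>B. \<forall>z\<in>ctri. \<bar>s z\<bar> \<le> B) \<and>
     (\<forall>z\<in>ctri. \<phi> z \<noteq> 0 \<longrightarrow> (\<exists>r>0. \<forall>w\<in>ctri. dist w z < r \<longrightarrow> s w = s z))"

lemma locally_const_off_sum:
  assumes "\<And>i. i \<in> A \<Longrightarrow> locally_const_off \<phi> (s i)"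
  shows "locally_const_off \<phi> (\<lambda>z. \<Sum>i\<in>A. c i * s i z)"
  using assms
proof (induction A rule: infinite_finite_induct)
  case (insert i A)
  let ?S = "\<lambda>z. \<Sum>i\<in>A. c i * s i z"
  have IH: "locally_const_off \<phi> ?S" "locally_const_off \<phi> (s i)" using insert by auto
  obtain B C where BC: "\<forall>z\<in>ctri. \<bar>?S z\<bar> \<le> B" "\<forall>z\<in>ctri. \<bar>s i z\<bar> \<le> C"
    using IH unfolding locally_const_off_def by blast
  have "\<forall>z\<in>ctri. \<bar>c i * s i z + ?S z\<bar> \<le> \<bar>c i\<bar> * C + B"
  proof
    fix z assume "z \<in> ctri"
    then have "\<bar>c i * s i z\<bar> \<le> \<bar>c i\<bar> * C" "\<bar>?S z\<bar> \<le> B" using BC by (auto simp: abs_mult intro!: mult_left_mono)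
    then show "\<bar>c i * s i z + ?S z\<bar> \<le> \<bar>c i\<bar> * C + B" by linarith
  qed
  moreover have "\<exists>r>0. \<forall>w\<in>ctri. dist w z < r \<longrightarrow> c i * s i w + ?S w = c i * s i z + ?S z"
    if z: "z \<in> ctri" "\<phi> z \<noteq> 0" for z
  proof -
    obtain r where "r > 0" "\<forall>w\<in>ctri. dist w z < r \<longrightarrow> ?S w = ?S z"
      using IH(1) z unfolding locally_const_off_def by blast
    moreover obtain q where "q > 0" "\<forall>w\<in>ctri. dist w z < q \<longrightarrow> s i w = s i z"
      using IH(2) z unfolding locally_const_off_def by blast
    ultimately show ?thesis by (intro exI[of _ "min r q"]) auto
  qed
  ultimately show ?case unfolding locally_const_off_def using insert.hyps by auto
qed (auto simp: locally_const_off_def intro: zero_less_one)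

lemma locally_const_off_mult:
  assumes "locally_const_off \<phi> s" shows "locally_const_off \<phi> (\<lambda>z. s z * s z)"
proof -
  obtain B where "\<forall>z\<in>ctri. \<bar>s z\<bar> \<le> B" using assms by (auto simp: locally_const_off_def)
  then have "\<forall>z\<in>ctri. \<bar>s z * s z\<bar> \<le> B * B"
    unfolding abs_mult by (meson abs_ge_zero mult_mono order_trans)
  then show ?thesis using assms unfolding locally_const_off_def by (metis (no_types, lifting))
qed

lemma continuous_on_locally_const_off:
  assumes s: "locally_const_off \<phi> s" and h: "continuous_on ctri h"
    and 0: "\<And>z. z \<in> ctri \<Longrightarrow> \<phi> z = 0 \<Longrightarrow> h z = 0"
  shows "continuous_on ctri (\<lambda>z. h z * s z)"
  unfolding continuous_on_def
proof
  fix z assume z: "z \<in> ctri"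
  have hl: "(h \<longlongrightarrow> h z) (at z within ctri)" using h z by (simp add: continuous_on_def)
  show "((\<lambda>z. h z * s z) \<longlongrightarrow> h z * s z) (at z within ctri)"
  proof (cases "\<phi> z = 0")
    case False
    then obtain r where r: "r > 0" "\<forall>w\<in>ctri. dist w z < r \<longrightarrow> s w = s z"
      using s z unfolding locally_const_off_def by blast
    have "\<forall>\<^sub>F w in at z within ctri. h w * s w = h w * s z"
      unfolding eventually_at using r by (intro exI[of _ r]) auto
    moreover have "((\<lambda>w. h w * s z) \<longlongrightarrow> h z * s z) (at z within ctri)" by (intro tendsto_intros hl)
    ultimately show ?thesis by (subst tendsto_cong)
  next
    case True
    then have h0: "h z = 0" using 0 z by simp
    obtain B where B: "\<forall>z\<in>ctri. \<bar>s z\<bar> \<le> B" using s by (auto simp: locally_const_off_def)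
    have "((\<lambda>w. h w * s w) \<longlongrightarrow> 0) (at z within ctri)"
    proof (rule Lim_null_comparison)
      show "\<forall>\<^sub>F w in at z within ctri. norm (h w * s w) \<le> \<bar>h w\<bar> * B"
        unfolding eventually_at using B by (intro exI[of _ 1]) (auto simp: abs_mult intro!: mult_left_mono)
      have "((\<lambda>w. \<bar>h w\<bar> * B) \<longlongrightarrow> \<bar>h z\<bar> * B) (at z within ctri)" by (intro tendsto_intros hl)
      then show "((\<lambda>w. \<bar>h w\<bar> * B) \<longlongrightarrow> 0) (at z within ctri)" using h0 by simp
    qed
    then show ?thesis using h0 by simp
  qed
qed

text \<open>A double zero absorbs any bounded factor: the difference quotient of the product is at
  most \<open>B\<close> times that of \<open>u\<close>.\<close>

lemma DERIV_mult_bounded: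
  fixes u s :: "real \<Rightarrow> real"
  assumes u: "(u has_real_derivative 0) (at x)" "u x = 0" and s: "\<forall>\<^sub>F y in at x. \<bar>s y\<bar> \<le> B"
  shows "((\<lambda>y. u y * s y) has_real_derivative 0) (at x)"
  unfolding has_field_derivative_iff
proof (rule Lim_null_comparison)
  show "\<forall>\<^sub>F y in at x. norm ((u y * s y - u x * s x) / (y - x)) \<le> \<bar>(u y - u x) / (y - x)\<bar> * B"
    using s
  proof eventually_elim
    case (elim y)
    have "norm ((u y * s y - u x * s x) / (y - x)) = \<bar>(u y - u x) / (y - x)\<bar> * \<bar>s y\<bar>"
      using u(2) by (simp add: abs_mult)
    also have "\<dots> \<le> \<bar>(u y - u x) / (y - x)\<bar> * B" using elim by (intro mult_left_mono) auto
    finally show ?case .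
  qed
  have "((\<lambda>y. (u y - u x) / (y - x)) \<longlongrightarrow> 0) (at x)" using u(1) by (simp add: has_field_derivative_iff)
  then have "((\<lambda>y. \<bar>(u y - u x) / (y - x)\<bar> * B) \<longlongrightarrow> \<bar>0\<bar> * B) (at x)" by (intro tendsto_intros)
  then show "((\<lambda>y. \<bar>(u y - u x) / (y - x)\<bar> * B) \<longlongrightarrow> 0) (at x)" by simp
qed

text \<open>Off the nodal set the factor \<open>s\<close> is constant near \<open>l x\<close>; on it
  \<open>u\<close> along the line \<open>l\<close> has a double zero, which the previous lemma
  handles.\<close>

lemma DERIV_locally_const_off:
  fixes l :: "real \<Rightarrow> real \<times> real"
  assumes s: "locally_const_off \<phi> s" and l: "isCont l x" "l x \<in> tri"
    and u: "((\<lambda>y. u (l y)) has_real_derivative d) (at x)"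
    and 0: "\<phi> (l x) = 0 \<Longrightarrow> u (l x) = 0 \<and> d = 0"
  shows "((\<lambda>y. u (l y) * s (l y)) has_real_derivative d * s (l x)) (at x)"
proof -
  have "(l \<longlongrightarrow> l x) (at x)" using l(1) by (simp add: isCont_def)
  then have ev: "\<forall>\<^sub>F y in at x. l y \<in> tri"
    using open_tri l(2) by (rule topological_tendstoD)
  show ?thesis
  proof (cases "\<phi> (l x) = 0")
    case True
    obtain B where B: "\<forall>z\<in>ctri. \<bar>s z\<bar> \<le> B" using s by (auto simp: locally_const_off_def)
    have "\<forall>\<^sub>F y in at x. \<bar>s (l y)\<bar> \<le> B"
      using ev by eventually_elim (use B tri_subset_ctri in auto)
    then show ?thesis
      using DERIV_mult_bounded[of "\<lambda>y. u (l y)" x "\<lambda>y. s (l y)" B] u 0[OF True] by simp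
  next
    case False
    then obtain r where r: "r > 0" "\<forall>w\<in>ctri. dist w (l x) < r \<longrightarrow> s w = s (l x)"
      using s l tri_subset_ctri unfolding locally_const_off_def by blast
    have "\<forall>\<^sub>F y in at x. dist (l y) (l x) < r"
      using \<open>(l \<longlongrightarrow> l x) (at x)\<close> r(1) by (rule tendstoD)
    with ev have e: "\<forall>\<^sub>F y in at x. u (l y) * s (l x) = u (l y) * s (l y)"
      by eventually_elim (use r tri_subset_ctri in auto)
    have "((\<lambda>y. u (l y) * s (l x)) has_real_derivative d * s (l x)) (at x)"
      by (rule DERIV_cmult_right[OF u])
    moreover have "\<forall>\<^sub>F y in nhds x. u (l y) * s (l x) = u (l y) * s (l y)"
      using e by (simp add: eventually_nhds_conv_at)
    note DERIV_cong_ev[OF refl this refl]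
    ultimately show ?thesis by simp
  qed
qed

text \<open>The functions that may be paired with the gradient of \<open>e\<close>: C^1 up to the
  boundary and zero on the nodal set of \<open>\<phi>\<close>, which contains the grid where that
  gradient jumps.\<close>

definition nodal_test :: "(real \<times> real \<Rightarrow> real) \<Rightarrow> (real \<times> real \<Rightarrow> real) \<Rightarrow> (real \<times> real \<Rightarrow> real) \<Rightarrow> (real \<times> real \<Rightarrow> real) \<Rightarrow> bool" where
  "nodal_test \<phi> w w1 w2 \<longleftrightarrow> continuous_on ctri w \<and> continuous_on ctri w1 \<and> continuous_on ctri w2 \<and>
     (\<forall>x y. (x, y) \<in> tri \<longrightarrow> ((\<lambda>x. w (x, y)) has_real_derivative w1 (x, y)) (at x)) \<and>
     (\<forall>x y. (x, y) \<in> tri \<longrightarrow> ((\<lambda>y. w (x, y)) has_real_derivative w2 (x, y)) (at y)) \<and>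
     (\<forall>z\<in>ctri. \<phi> z = 0 \<longrightarrow> w z = 0)"

lemma nodal_test_mode_green: "nodal_test \<phi> w w1 w2 \<Longrightarrow> mode_green w w1 w2"
  unfolding nodal_test_def by (intro mode_green_line_derivatives) blast+

text \<open>As \<open>F\<close> and its derivative vanish at 0, the function
  \<open>F (\<phi> z)\<close> and its gradient vanish on the nodal set, and multiplication by the
  jumping factor \<open>s\<close> keeps it C^1. The identity in place of \<open>F\<close> would fail
  here, its derivative being 1; this is why a cut-off is inserted.\<close>

lemma nodal_test_compose:
  assumes s: "locally_const_off \<phi> s"
    and \<phi>: "continuous_on ctri \<phi>" "continuous_on ctri \<phi>1" "continuous_on ctri \<phi>2"
    and d: "\<And>x y. (x, y) \<in> tri \<Longrightarrow> ((\<lambda>x. \<phi> (x, y)) has_real_derivative \<phi>1 (x, y)) (at x)"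
      "\<And>x y. (x, y) \<in> tri \<Longrightarrow> ((\<lambda>y. \<phi> (x, y)) has_real_derivative \<phi>2 (x, y)) (at y)"
    and F: "\<And>t. (F has_real_derivative F' t) (at t)" "F 0 = 0" "F' 0 = 0"
    and cF: "continuous_on ctri (\<lambda>z. F (\<phi> z))" "continuous_on ctri (\<lambda>z. F' (\<phi> z))"
  shows "nodal_test \<phi> (\<lambda>z. F (\<phi> z) * s z) (\<lambda>z. F' (\<phi> z) * \<phi>1 z * s z) (\<lambda>z. F' (\<phi> z) * \<phi>2 z * s z)"
  unfolding nodal_test_def
proof (intro conjI allI impI ballI)
  fix x y :: real assume xy: "(x, y) \<in> tri"
  show "((\<lambda>x. F (\<phi> (x, y)) * s (x, y)) has_real_derivative F' (\<phi> (x, y)) * \<phi>1 (x, y) * s (x, y)) (at x)"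
    by (rule DERIV_locally_const_off[OF s, where l = "\<lambda>x. (x, y)" and u = "\<lambda>z. F (\<phi> z)"])
       (use xy in \<open>auto intro!: DERIV_chain2[OF F(1) d(1)] continuous_intros simp: F\<close>)
  show "((\<lambda>y. F (\<phi> (x, y)) * s (x, y)) has_real_derivative F' (\<phi> (x, y)) * \<phi>2 (x, y) * s (x, y)) (at y)"
    by (rule DERIV_locally_const_off[OF s, where l = "\<lambda>y. (x, y)" and u = "\<lambda>z. F (\<phi> z)"])
       (use xy in \<open>auto intro!: DERIV_chain2[OF F(1) d(2)] continuous_intros simp: F\<close>)
next
  show "continuous_on ctri (\<lambda>z. F (\<phi> z) * s z)"
    by (rule continuous_on_locally_const_off[OF s cF(1)]) (simp add: F)
  show "continuous_on ctri (\<lambda>z. F' (\<phi> z) * \<phi>1 z * s z)"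
    by (rule continuous_on_locally_const_off[OF s continuous_on_mult[OF cF(2) \<phi>(2)]]) (simp add: F)
  show "continuous_on ctri (\<lambda>z. F' (\<phi> z) * \<phi>2 z * s z)"
    by (rule continuous_on_locally_const_off[OF s continuous_on_mult[OF cF(2) \<phi>(3)]]) (simp add: F)
qed (simp add: F)

text \<open>The closure of \<open>D\<close> is taken so that the indicator is locally constant also
  at points on the sides of the triangle where \<open>\<phi>\<close> is nonzero. Near such a point
  the triangle meets a ball in a convex set on which \<open>\<phi>\<close> has no zero, and this set
  lies in a single component.\<close>

lemma closure_component_locally_const:
  assumes \<phi>: "continuous_on ctri \<phi>" and D: "D \<in> components (tri - \<phi> -` {0})"
  shows "locally_const_off \<phi> (indicator (closure D))"
  unfolding locally_const_off_def
proof (intro conjI ballI impI)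
  show "\<exists>B. \<forall>z\<in>ctri. \<bar>indicator (closure D) z :: real\<bar> \<le> B"
    by (intro exI[of _ 1]) (simp add: indicator_def)
next
  fix z assume z: "z \<in> ctri" "\<phi> z \<noteq> 0"
  obtain r where r: "r > 0" "\<And>w. w \<in> ctri \<Longrightarrow> dist w z < r \<Longrightarrow> \<phi> w \<noteq> 0"
  proof -
    have "\<exists>d>0. \<forall>w\<in>ctri. dist w z < d \<longrightarrow> dist (\<phi> w) (\<phi> z) < \<bar>\<phi> z\<bar>"
      using \<phi> z unfolding continuous_on_iff by (metis zero_less_abs_iff)
    then obtain d where "d > 0" "\<forall>w\<in>ctri. dist w z < d \<longrightarrow> dist (\<phi> w) (\<phi> z) < \<bar>\<phi> z\<bar>" by blast
    then show ?thesis by (intro that[of d]) (auto simp: dist_real_def)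
  qed
  define U where "U = ball z r \<inter> tri"
  have "connected U" unfolding U_def by (intro convex_connected convex_Int convex_ball convex_tri)
  moreover have "U \<subseteq> tri - \<phi> -` {0}"
    using r(2) tri_subset_ctri by (auto simp: U_def dist_commute)
  moreover have "U \<noteq> {}"
    using z r(1) unfolding U_def closure_tri[symmetric] by (metis centre_in_ball closure_iff_nhds_not_empty open_ball inf_commute order_refl)
  ultimately obtain E where E: "E \<in> components (tri - \<phi> -` {0})" "U \<subseteq> E"
    by (metis exists_component_superset empty_subsetI subset_empty)
  have "w \<in> closure D \<longleftrightarrow> D = E" if w: "w \<in> ctri" "dist w z < r" for w
  proof
    assume "w \<in> closure D"
    moreover have "w \<in> ball z r" using w by (simp add: dist_commute)
    ultimately obtain d where "d \<in> D" "d \<in> ball z r"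
      using closure_iff_nhds_not_empty[of w D] open_ball by blast
    moreover from this D have "d \<in> tri" using in_components_subset by blast
    ultimately have "d \<in> E" using E by (auto simp: U_def)
    then show "D = E" using \<open>d \<in> D\<close> components_nonoverlap[OF D E(1)] by blast
  next
    assume "D = E"
    have "w \<in> ball z r \<inter> closure tri" using w by (simp add: dist_commute)
    then have "w \<in> closure U" using open_Int_closure_subset[OF open_ball] unfolding U_def by blast
    then show "w \<in> closure D" using E closure_mono \<open>D = E\<close> by blast
  qed
  then show "\<exists>r>0. \<forall>w\<in>ctri. dist w z < r \<longrightarrow> (indicator (closure D) w :: real) = indicator (closure D) z"
    using r(1) z by (intro exI[of _ r]) (auto simp: indicator_def)
qed

text \<open>Courant's argument with one extra test function \<open>e\<close>, as in Filonov's proof of Friedlander's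
  inequality.\<close>

theorem courant_filonov:
  fixes a :: "int \<times> int \<Rightarrow> real" and \<mu> :: real
  defines "\<phi> \<equiv> \<lambda>z. \<Sum>p\<in>level \<mu>. a p * md p z"
  assumes \<mu>: "0 \<le> \<mu>"
    and e: "continuous_on ctri e" "mode_green e e1 e2"
    and eg: "\<And>w w1 w2. nodal_test \<phi> w w1 w2 \<Longrightarrow> tint (\<lambda>z. w1 z * e1 z + w2 z * e2 z) = \<mu> * tint (\<lambda>z. w z * e z)"
    and energy: "tint (\<lambda>z. (e1 z)\<^sup>2 + (e2 z)\<^sup>2) \<le> \<mu> * tint (\<lambda>z. (e z)\<^sup>2)"
    and z0: "z0 \<in> ctri" "e z0 \<noteq> 0" "\<And>p. p \<in> level \<mu> \<Longrightarrow> md p z0 = 0"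
    and fin: "finite (nodal_domains tri \<phi>)"
  shows "card (nodal_domains tri \<phi>) \<le> card (low \<mu>)"
proof (rule ccontr)
  define \<phi>1 where "\<phi>1 z = (\<Sum>p\<in>level \<mu>. a p * md1 p z)" for z
  define \<phi>2 where "\<phi>2 z = (\<Sum>p\<in>level \<mu>. a p * md2 p z)" for z
  have c\<phi>: "continuous_on A \<phi>" "continuous_on A \<phi>1" "continuous_on A \<phi>2" for A
    unfolding \<phi>_def \<phi>1_def \<phi>2_def by (intro continuous_intros)+
  have d\<phi>: "((\<lambda>x. \<phi> (x, y)) has_real_derivative \<phi>1 (x, y)) (at x)" "((\<lambda>y. \<phi> (x, y)) has_real_derivative \<phi>2 (x, y)) (at y)" for x y
    unfolding \<phi>_def \<phi>1_def \<phi>2_def by (auto intro!: DERIV_sum DERIV_cmult DERIV_md)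
  define \<Delta> where "\<Delta> = nodal_domains tri \<phi>"
  assume "\<not> card (nodal_domains tri \<phi>) \<le> card (low \<mu>)"
  then have gt: "card \<Delta> > card (low \<mu>)" by (simp add: \<Delta>_def)
  then obtain D0 where D0: "D0 \<in> \<Delta>" by fastforce
  have comp: "D \<in> components (tri - \<phi> -` {0})" if "D \<in> \<Delta>" for D using that by (simp add: \<Delta>_def nodal_domains_def)
  have openS: "open (tri - \<phi> -` {0})"
    by (intro open_Diff open_tri closed_vimage c\<phi> closed_singleton)
  have openD: "open D" "D \<noteq> {}" "D \<subseteq> tri" "\<And>z. z \<in> D \<Longrightarrow> \<phi> z \<noteq> 0" if "D \<in> \<Delta>" for D
    using open_components[OF openS comp[OF that]] in_components_nonempty[OF comp[OF that]] in_components_subset[OF comp[OF that]] by auto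
  have disj: "z \<in> closure D \<longleftrightarrow> D = E" if "z \<in> E" "D \<in> \<Delta>" "E \<in> \<Delta>" for z D E
  proof -
    have "D = E" if "z \<in> closure D"
    proof -
      have "D \<inter> E \<noteq> {}"
        using that \<open>z \<in> E\<close> openD(1)[OF \<open>E \<in> \<Delta>\<close>] closure_iff_nhds_not_empty[of z D] by blast
      then show ?thesis using components_nonoverlap[OF comp comp] \<open>D \<in> \<Delta>\<close> \<open>E \<in> \<Delta>\<close> by blast
    qed
    then show ?thesis using closure_subset \<open>z \<in> E\<close> by blast
  qed
  define ch where "ch D = (indicator (closure D) :: real \<times> real \<Rightarrow> real)" for D
  have l_ch: "locally_const_off \<phi> (ch D)" if "D \<in> \<Delta>" for D
    unfolding ch_def by (rule closure_component_locally_const[OF c\<phi>(1) comp[OF that]])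
  have b_ch: "bmeas (\<lambda>z. \<phi> z * ch D z)" if "D \<in> \<Delta>" for D
    by (intro bmeas_continuous continuous_on_locally_const_off[OF l_ch[OF that]] c\<phi>)
  have be: "bmeas e" "bmeas e1" "bmeas e2" using mode_greenD[OF e(2)] by auto
  \<comment> \<open>One unknown for \<open>e\<close> and one for each nodal domain except
    \<open>D0\<close>. They are as many as the nodal domains, hence more than the orthogonality
    conditions coming from \<open>low \<mu>\<close>.\<close>
  define I where "I = insert None (Some ` (\<Delta> - {D0}))"
  define M where "M i p = (case i of None \<Rightarrow> tint (\<lambda>z. e z * md p z) | Some D \<Rightarrow> tint (\<lambda>z. \<phi> z * ch D z * md p z))" for i p
  have finD: "finite \<Delta>" using fin by (simp add: \<Delta>_def)
  have "card I = card \<Delta>"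
    unfolding I_def using finD D0 by (subst card_insert_disjoint) (use gt in \<open>auto simp: card_image\<close>)
  then obtain c where c: "\<exists>i\<in>I. c i \<noteq> 0" "\<And>p. p \<in> low \<mu> \<Longrightarrow> (\<Sum>i\<in>I. c i * M i p) = 0"
    using homogeneous_system_nontrivial_solution[of "low \<mu>" I M] gt finD by (auto simp: I_def)
  define \<sigma> where "\<sigma> z = (\<Sum>D\<in>\<Delta> - {D0}. c (Some D) * ch D z)" for z
  define v where "v z = \<phi> z * \<sigma> z + c None * e z" for z
  have l\<sigma>: "locally_const_off \<phi> \<sigma>" unfolding \<sigma>_def by (rule locally_const_off_sum) (use l_ch in auto)
  have l\<sigma>2: "locally_const_off \<phi> (\<lambda>z. \<sigma> z * \<sigma> z)" by (rule locally_const_off_mult[OF l\<sigma>])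
  have c\<phi>\<sigma>: "continuous_on ctri (\<lambda>z. \<phi> z * \<sigma> z)" by (intro continuous_on_locally_const_off[OF l\<sigma>] c\<phi>)
  have c\<phi>\<sigma>2: "continuous_on ctri (\<lambda>z. \<phi> z * (\<sigma> z * \<sigma> z))" by (intro continuous_on_locally_const_off[OF l\<sigma>2] c\<phi>)
  have cv: "continuous_on ctri v" unfolding v_def by (intro continuous_intros c\<phi>\<sigma> e)
  have low: "tint (\<lambda>z. v z * md p z) = 0" if "p \<in> low \<mu>" for p
  proof -
    have "tint (\<lambda>z. v z * md p z) = tint (\<lambda>z. (\<Sum>D\<in>\<Delta> - {D0}. c (Some D) * (\<phi> z * ch D z * md p z)) + c None * (e z * md p z))"
      by (rule tint_cong) (simp add: v_def \<sigma>_def sum_distrib_left sum_distrib_right algebra_simps)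
    also have "\<dots> = (\<Sum>D\<in>\<Delta> - {D0}. c (Some D) * M (Some D) p) + c None * M None p"
      by (subst tint_add; (subst tint_sum)?) ((intro bmeas_intros b_ch be; simp)+, simp add: tint_cmult M_def)
    also have "\<dots> = (\<Sum>i\<in>I. c i * M i p)"
      unfolding I_def using finD by (subst sum.insert) (auto simp: sum.reindex)
    finally show ?thesis using c(2)[OF that] by simp
  qed
  define \<delta> where "\<delta> n = inverse (real (Suc n))" for n
  have \<delta>: "0 < \<delta> n" "\<delta> n \<le> 1" for n by (auto simp: \<delta>_def field_simps)
  have \<delta>0: "\<delta> \<longlonglongrightarrow> 0" unfolding \<delta>_def by (rule LIMSEQ_inverse_real_of_nat)
  define w where "w n z = cutF (\<delta> n) (\<phi> z) * \<sigma> z" for n z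
  define w1 where "w1 n z = cutF' (\<delta> n) (\<phi> z) * \<phi>1 z * \<sigma> z" for n z
  define w2 where "w2 n z = cutF' (\<delta> n) (\<phi> z) * \<phi>2 z * \<sigma> z" for n z
  \<comment> \<open>The eigenvalue equation of \<open>\<phi>\<close> is tested with
    \<open>u n\<close>: the derivative of \<open>cutG\<close> is the square of that of
    \<open>cutF\<close>, so the gradient of \<open>u n\<close> times the gradient of
    \<open>\<phi>\<close> is the squared gradient of \<open>w n\<close>.\<close>
  define u where "u n z = cutG (\<delta> n) (\<phi> z) * (\<sigma> z * \<sigma> z)" for n z
  have tw: "nodal_test \<phi> (w n) (w1 n) (w2 n)" for n
    unfolding w_def w1_def w2_def
    by (rule nodal_test_compose[OF l\<sigma> c\<phi> d\<phi> DERIV_cutF[OF \<delta>(1)]]) (auto intro!: continuous_cut \<delta> c\<phi>)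
  have tu: "nodal_test \<phi> (u n) (\<lambda>z. (cutF' (\<delta> n) (\<phi> z))\<^sup>2 * \<phi>1 z * (\<sigma> z * \<sigma> z)) (\<lambda>z. (cutF' (\<delta> n) (\<phi> z))\<^sup>2 * \<phi>2 z * (\<sigma> z * \<sigma> z))" for n
    unfolding u_def
    by (rule nodal_test_compose[OF l\<sigma>2 c\<phi> d\<phi> DERIV_cutG[OF \<delta>(1)]]) (auto intro!: continuous_cut continuous_on_power \<delta> c\<phi>)
  have energy_w: "tint (\<lambda>z. (w1 n z)\<^sup>2 + (w2 n z)\<^sup>2) = \<mu> * tint (\<lambda>z. u n z * \<phi> z)" for n
  proof -
    note g = nodal_test_mode_green[OF tu[of n]]
    have bu: "bmeas (u n)" using mode_greenD(2)[OF g] .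
    have "tint (\<lambda>z. (w1 n z)\<^sup>2 + (w2 n z)\<^sup>2) = (\<Sum>p\<in>level \<mu>. a p * ev p * tint (\<lambda>z. u n z * md p z))"
      unfolding mode_green_sum[OF g, symmetric]
      by (rule tint_cong) (simp add: w1_def w2_def \<phi>1_def \<phi>2_def power2_eq_square mult_ac)
    also have "\<dots> = (\<Sum>p\<in>level \<mu>. \<mu> * tint (\<lambda>z. a p * (u n z * md p z)))"
      by (intro sum.cong) (auto simp: level_def tint_cmult)
    also have "\<dots> = \<mu> * tint (\<lambda>z. \<Sum>p\<in>level \<mu>. a p * (u n z * md p z))"
      by (subst tint_sum) (intro bmeas_intros bu, simp add: sum_distrib_left)
    also have "\<dots> = \<mu> * tint (\<lambda>z. u n z * \<phi> z)"
      by (simp add: \<phi>_def sum_distrib_left mult_ac)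
    finally show ?thesis .
  qed
  have bw: "bmeas (w n)" "bmeas (w1 n)" "bmeas (w2 n)" for n
    using mode_greenD[OF nodal_test_mode_green[OF tw]] by auto
  have bu: "bmeas (u n)" for n using mode_greenD(2)[OF nodal_test_mode_green[OF tu]] .
  have b\<phi>: "bmeas \<phi>" by (intro bmeas_continuous c\<phi>)
  define vn where "vn n z = w n z + c None * e z" for n z
  \<comment> \<open>Bessel's inequality is applied to the approximations \<open>vn n\<close>. Their
    energy splits into a part given by \<open>energy_w\<close>, a mixed part given by
    \<open>eg\<close> and a part bounded by \<open>energy\<close>; uniform convergence then yields
    the bound for \<open>v\<close> itself.\<close>
  have R: "(\<Sum>p\<in>A. ev p * (tint (\<lambda>z. v z * md p z))\<^sup>2 / nrm p) \<le> \<mu> * tint (\<lambda>z. v z * v z)" if A: "finite A" "A \<subseteq> modes" for A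
  proof -
    let ?c = "c None"
    have le: "(\<Sum>p\<in>A. ev p * (tint (\<lambda>z. vn n z * md p z))\<^sup>2 / nrm p) \<le>
        \<mu> * (tint (\<lambda>z. u n z * \<phi> z) + 2 * ?c * tint (\<lambda>z. w n z * e z) + ?c\<^sup>2 * tint (\<lambda>z. (e z)\<^sup>2))" for n
    proof -
      have "(\<Sum>p\<in>A. ev p * (tint (\<lambda>z. vn n z * md p z))\<^sup>2 / nrm p) \<le> tint (\<lambda>z. (w1 n z + ?c * e1 z)\<^sup>2 + (w2 n z + ?c * e2 z)\<^sup>2)"
        unfolding vn_def by (rule bessel_gradient[OF mode_green_add[OF nodal_test_mode_green[OF tw] e(2)] A])
      also have "\<dots> = tint (\<lambda>z. (((w1 n z)\<^sup>2 + (w2 n z)\<^sup>2) + 2 * ?c * (w1 n z * e1 z + w2 n z * e2 z)) + ?c\<^sup>2 * ((e1 z)\<^sup>2 + (e2 z)\<^sup>2))"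
        by (rule tint_cong) (simp add: power2_eq_square algebra_simps)
      also have "\<dots> = tint (\<lambda>z. (w1 n z)\<^sup>2 + (w2 n z)\<^sup>2) + 2 * ?c * tint (\<lambda>z. w1 n z * e1 z + w2 n z * e2 z) + ?c\<^sup>2 * tint (\<lambda>z. (e1 z)\<^sup>2 + (e2 z)\<^sup>2)"
        by (subst tint_add; (subst tint_add)?) ((intro bmeas_intros bw be)+, simp only: tint_cmult)
      also have "\<dots> \<le> \<mu> * tint (\<lambda>z. u n z * \<phi> z) + 2 * ?c * (\<mu> * tint (\<lambda>z. w n z * e z)) + ?c\<^sup>2 * (\<mu> * tint (\<lambda>z. (e z)\<^sup>2))"
        unfolding energy_w eg[OF tw] using mult_left_mono[OF energy, of "?c\<^sup>2"] by simp
      finally show ?thesis by (simp add: algebra_simps)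
    qed
    obtain B where B: "\<forall>z\<in>ctri. \<bar>\<sigma> z\<bar> \<le> B" using l\<sigma> by (auto simp: locally_const_off_def)
    have B0: "0 \<le> B" using B z0(1) by (meson abs_ge_zero order_trans)
    have wb: "\<bar>w n z - \<phi> z * \<sigma> z\<bar> \<le> 2 * \<delta> n * B" "\<bar>u n z - \<phi> z * (\<sigma> z * \<sigma> z)\<bar> \<le> 4 * \<delta> n * (B * B)" if "z \<in> ctri" for n z
    proof -
      have "\<bar>w n z - \<phi> z * \<sigma> z\<bar> = \<bar>cutF (\<delta> n) (\<phi> z) - \<phi> z\<bar> * \<bar>\<sigma> z\<bar>"
        by (simp only: w_def left_diff_distrib[symmetric] abs_mult)
      also have "\<dots> \<le> 2 * \<delta> n * B" using that B B0 \<delta>[of n] by (intro mult_mono cut_bounds) auto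
      finally show "\<bar>w n z - \<phi> z * \<sigma> z\<bar> \<le> 2 * \<delta> n * B" .
      have "\<bar>u n z - \<phi> z * (\<sigma> z * \<sigma> z)\<bar> = \<bar>cutG (\<delta> n) (\<phi> z) - \<phi> z\<bar> * (\<bar>\<sigma> z\<bar> * \<bar>\<sigma> z\<bar>)"
        by (simp only: u_def left_diff_distrib[symmetric] abs_mult)
      also have "\<dots> \<le> 4 * \<delta> n * (B * B)" using that B B0 \<delta>[of n] by (intro mult_mono cut_bounds) auto
      finally show "\<bar>u n z - \<phi> z * (\<sigma> z * \<sigma> z)\<bar> \<le> 4 * \<delta> n * (B * B)" .
    qed
    have uniform: "(\<lambda>n. tint (\<lambda>z. h n z * k z)) \<longlonglongrightarrow> tint (\<lambda>z. h' z * k z)"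
      if h: "\<And>n. bmeas (h n)" "bmeas h'" "bmeas k" and C: "0 \<le> C" "\<And>n z. z \<in> ctri \<Longrightarrow> \<bar>h n z - h' z\<bar> \<le> \<delta> n * C" for h h' k C
    proof -
      obtain K where K: "\<forall>z\<in>ctri. \<bar>k z\<bar> \<le> K" using h(3) by (auto simp: bmeas_def)
      obtain H where H: "\<forall>z\<in>ctri. \<bar>h' z\<bar> \<le> H" using h(2) by (auto simp: bmeas_def)
      show ?thesis
      proof (rule tint_tendsto[where B = "(C + H) * K"])
        fix n z assume z: "z \<in> ctri"
        have "\<bar>h n z\<bar> \<le> \<delta> n * C + H" using C(2)[OF z, of n] H z by force
        also have "\<dots> \<le> C + H" using \<delta>[of n] C(1) by (simp add: mult_left_le_one_le)
        finally show "\<bar>h n z * k z\<bar> \<le> (C + H) * K"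
          unfolding abs_mult using K z by (intro mult_mono) (auto intro: order_trans[OF abs_ge_zero])
      next
        fix z assume z: "z \<in> ctri"
        have "(\<lambda>n. h n z - h' z) \<longlonglongrightarrow> 0"
        proof (rule Lim_null_comparison)
          show "\<forall>\<^sub>F n in sequentially. norm (h n z - h' z) \<le> \<delta> n * C" using C(2)[OF z] by simp
          have "(\<lambda>n. \<delta> n * C) \<longlonglongrightarrow> 0 * C" by (intro tendsto_intros \<delta>0)
          then show "(\<lambda>n. \<delta> n * C) \<longlonglongrightarrow> 0" by simp
        qed
        then have "(\<lambda>n. h n z) \<longlonglongrightarrow> h' z" by (simp add: LIM_zero_iff)
        then show "(\<lambda>n. h n z * k z) \<longlonglongrightarrow> h' z * k z" by (intro tendsto_intros)
      qed (auto intro!: h)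
    qed
    have b\<sigma>: "bmeas (\<lambda>z. \<phi> z * \<sigma> z)" "bmeas (\<lambda>z. \<phi> z * (\<sigma> z * \<sigma> z))" by (intro bmeas_continuous c\<phi>\<sigma> c\<phi>\<sigma>2)+
    have bv: "bmeas v" by (intro bmeas_continuous cv)
    have bvn: "bmeas (vn n)" for n unfolding vn_def by (intro bmeas_intros bw be)
    have l1: "(\<lambda>n. tint (\<lambda>z. vn n z * md p z)) \<longlonglongrightarrow> tint (\<lambda>z. v z * md p z)" for p
      by (rule uniform[OF bvn bv bmeas_md(1), where C = "2 * B"]) (use wb B0 in \<open>auto simp: vn_def v_def mult_ac\<close>)
    have l2: "(\<lambda>n. tint (\<lambda>z. u n z * \<phi> z)) \<longlonglongrightarrow> tint (\<lambda>z. \<phi> z * (\<sigma> z * \<sigma> z) * \<phi> z)"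
      by (rule uniform[OF bu b\<sigma>(2) b\<phi>, where C = "4 * (B * B)"]) (use wb B0 in \<open>auto simp: mult_ac\<close>)
    have l3: "(\<lambda>n. tint (\<lambda>z. w n z * e z)) \<longlonglongrightarrow> tint (\<lambda>z. \<phi> z * \<sigma> z * e z)"
      by (rule uniform[OF bw(1) b\<sigma>(1) be(1), where C = "2 * B"]) (use wb B0 in \<open>auto simp: mult_ac\<close>)
    have "(\<Sum>p\<in>A. ev p * (tint (\<lambda>z. v z * md p z))\<^sup>2 / nrm p) \<le>
        \<mu> * (tint (\<lambda>z. \<phi> z * (\<sigma> z * \<sigma> z) * \<phi> z) + 2 * ?c * tint (\<lambda>z. \<phi> z * \<sigma> z * e z) + ?c\<^sup>2 * tint (\<lambda>z. (e z)\<^sup>2))"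
    proof (rule LIMSEQ_le)
      show "(\<lambda>n. \<Sum>p\<in>A. ev p * (tint (\<lambda>z. vn n z * md p z))\<^sup>2 / nrm p) \<longlonglongrightarrow> (\<Sum>p\<in>A. ev p * (tint (\<lambda>z. v z * md p z))\<^sup>2 / nrm p)"
        using A nrm_pos by (intro tendsto_intros l1) (metis less_irrefl subsetD)
      show "(\<lambda>n. \<mu> * (tint (\<lambda>z. u n z * \<phi> z) + 2 * ?c * tint (\<lambda>z. w n z * e z) + ?c\<^sup>2 * tint (\<lambda>z. (e z)\<^sup>2))) \<longlonglongrightarrow>
        \<mu> * (tint (\<lambda>z. \<phi> z * (\<sigma> z * \<sigma> z) * \<phi> z) + 2 * ?c * tint (\<lambda>z. \<phi> z * \<sigma> z * e z) + ?c\<^sup>2 * tint (\<lambda>z. (e z)\<^sup>2))"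
        by (intro tendsto_intros l2 l3)
    qed (use le in auto)
    also have "tint (\<lambda>z. \<phi> z * (\<sigma> z * \<sigma> z) * \<phi> z) + 2 * ?c * tint (\<lambda>z. \<phi> z * \<sigma> z * e z) + ?c\<^sup>2 * tint (\<lambda>z. (e z)\<^sup>2) =
      tint (\<lambda>z. (\<phi> z * (\<sigma> z * \<sigma> z) * \<phi> z + 2 * ?c * (\<phi> z * \<sigma> z * e z)) + ?c\<^sup>2 * (e z)\<^sup>2)"
      by (subst tint_add; (subst tint_add)?) ((intro bmeas_add bmeas_mult[OF _ b\<phi>] bmeas_mult[OF bmeas_const] bmeas_mult[OF _ be(1)] bmeas_power2 b\<sigma> be)+, simp only: tint_cmult)
    also have "\<dots> = tint (\<lambda>z. v z * v z)"
      by (rule tint_cong) (simp add: v_def power2_eq_square algebra_simps)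
    finally show ?thesis .
  qed
  define b where "b p = tint (\<lambda>z. v z * md p z) / nrm p" for p
  define t where "t z = (\<Sum>p\<in>level \<mu>. b p * md p z)" for z
  have vt: "v z = t z" if "z \<in> ctri" for z
    unfolding t_def b_def by (rule rayleigh_expansion[OF cv \<mu> R low that])
  have "\<phi> z0 = 0" "t z0 = 0" using z0 by (auto simp: \<phi>_def t_def)
  \<comment> \<open>At \<open>z0\<close> all modes of the level vanish, hence so do
    \<open>\<phi>\<close> and \<open>t\<close>, and only the contribution of \<open>e\<close> is
    left in \<open>v z0\<close>.\<close>
  then have c0: "c None = 0" using vt[OF z0(1)] z0(2) by (simp add: v_def)
  have \<sigma>0: "\<sigma> z = 0" if "z \<in> D0" for z
    unfolding \<sigma>_def using disj[OF that _ D0] by (intro sum.neutral) (auto simp: ch_def)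
  have tp: "tpoly t" unfolding t_def by (intro tpoly_sum tpoly_cmult tpoly_md)
  \<comment> \<open>With \<open>e\<close> gone, \<open>v\<close> vanishes on the omitted domain
    \<open>D0\<close>; unique continuation makes the trigonometric polynomial \<open>t\<close>
    vanish everywhere.\<close>
  have t0: "t z = 0" for z
  proof (rule tpoly_unique[OF tp openD(1,3,2)[OF D0]])
    fix z assume z: "z \<in> D0"
    then have "z \<in> ctri" using openD(3)[OF D0] tri_subset_ctri by blast
    then show "t z = 0" using vt[of z] c0 \<sigma>0[OF z] by (simp add: v_def)
  qed
  have "c (Some D) = 0" if D: "D \<in> \<Delta> - {D0}" for D
  proof -
    obtain z where z: "z \<in> D" using openD(2)[of D] D by auto
    then have zc: "z \<in> ctri" using openD(3)[of D] D tri_subset_ctri by blast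
    have "\<sigma> z = (\<Sum>E\<in>\<Delta> - {D0}. if E = D then c (Some D) else 0)"
      unfolding \<sigma>_def using disj[OF z] D by (intro sum.cong) (auto simp: ch_def)
    also have "\<dots> = c (Some D)" using D finD by (simp add: sum.delta)
    finally show ?thesis using vt[OF zc] t0[of z] c0 openD(4)[of D z] z D by (simp add: v_def)
  qed
  then show False using c(1) c0 by (auto simp: I_def)
qed

section \<open>Construction of the extra test function\<close>

text \<open>\<open>arccos (cos u)\<close> folds the line onto \<open>[0, pi]\<close>, so this is the
  even \<open>2 * pi\<close>-periodic extension of \<open>cos (p * u)\<close> from there:
  continuous, smooth at even multiples of \<open>pi\<close>, in general with kinks at the odd
  ones.\<close>

definition cper :: "real \<Rightarrow> real \<Rightarrow> real" where
  "cper p u = cos (p * arccos (cos u))"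

text \<open>\<open>sper p u\<close> is \<open>0\<close> at the jumps \<open>u \<in> pi + 2 * pi * \<int>\<close>, because \<open>tan (pi / 2) = 0\<close> by division by zero;
  this keeps \<open>sper p\<close> odd and periodic everywhere.\<close>

definition sper :: "real \<Rightarrow> real \<Rightarrow> real" where
  "sper p u = sin (p * (2 * arctan (tan (u / 2))))"

lemma continuous_cper [continuous_intros]:
  fixes f :: "'a::t2_space \<Rightarrow> real"
  assumes "continuous_on A f" shows "continuous_on A (\<lambda>z. cper p (f z))"
  unfolding cper_def by (intro continuous_intros continuous_on_arccos assms) auto

lemma borel_sper [measurable]: "sper p \<in> borel_measurable borel"
proof -
  have "arctan \<in> borel_measurable borel" by (intro borel_measurable_continuous_onI continuous_intros)
  moreover have "(\<lambda>u::real. tan (u / 2)) \<in> borel_measurable borel" unfolding tan_def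
    by (intro borel_measurable_divide borel_measurable_continuous_onI continuous_intros) auto
  ultimately have "(\<lambda>u. arctan (tan (u / 2))) \<in> borel_measurable borel" by (rule measurable_compose_rev)
  moreover have "(\<lambda>t::real. sin (p * (2 * t))) \<in> borel_measurable borel" by (intro borel_measurable_continuous_onI continuous_intros)
  ultimately show ?thesis unfolding sper_def[abs_def] by (rule measurable_compose)
qed

lemma borel_cper [measurable]: "cper p \<in> borel_measurable borel"
  by (intro borel_measurable_continuous_onI continuous_cper continuous_intros)

lemma abs_per_le [simp]: "\<bar>cper p u\<bar> \<le> 1" "\<bar>sper p u\<bar> \<le> 1"
  by (simp_all add: cper_def sper_def)

text \<open>Off the odd multiples of \<open>pi\<close>, the representative of \<open>u\<close> in
  \<open>(-pi, pi)\<close> is \<open>2 * arctan (tan (u / 2))\<close>, and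
  \<open>arccos (cos u)\<close> is its absolute value. The new form can be differentiated at
  \<open>u = 0\<close> too, where \<open>arccos (cos u)\<close> cannot.\<close>

lemma cper_eq: assumes "cos (u / 2) \<noteq> 0" shows "cper p u = cos (p * (2 * arctan (tan (u / 2))))"
proof -
  define r where "r = 2 * arctan (tan (u / 2))"
  have r: "\<bar>r\<bar> \<le> pi" using arctan_bounded[of "tan (u / 2)"] unfolding r_def by linarith
  have "(cos (arctan (tan (u / 2))))\<^sup>2 = (cos (u / 2))\<^sup>2"
  proof -
    have "(cos (arctan (tan (u / 2))))\<^sup>2 = 1 / (1 + (tan (u / 2))\<^sup>2)"
      by (simp only: cos_arctan power_divide power_one real_sqrt_pow2 add_nonneg_nonneg zero_le_one zero_le_power2)
    also have "\<dots> = 1 / (inverse (cos (u / 2)))\<^sup>2" by (simp only: tan_sec[OF assms])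
    also have "\<dots> = (cos (u / 2))\<^sup>2" by (simp add: inverse_eq_divide power_divide)
    finally show ?thesis .
  qed
  then have "cos r = cos u"
    using cos_double_cos[of "arctan (tan (u / 2))"] cos_double_cos[of "u / 2"] by (simp add: r_def)
  then have "arccos (cos u) = \<bar>r\<bar>"
    using r arccos_cos[of r] arccos_cos2[of r] by (cases "0 \<le> r") auto
  then show ?thesis by (simp add: cper_def flip: r_def) (cases "0 \<le> r"; simp)
qed

lemma DERIV_half_angle: assumes "cos (u / 2) \<noteq> 0"
  shows "((\<lambda>u. 2 * arctan (tan (u / 2))) has_real_derivative 1) (at u)"
proof -
  have "((\<lambda>u. 2 * arctan (tan (u / 2))) has_real_derivative 2 * (inverse (1 + (tan (u / 2))\<^sup>2) * (inverse ((cos (u / 2))\<^sup>2) * (1 / 2)))) (at u)"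
    using assms by (auto intro!: derivative_eq_intros)
  also have "2 * (inverse (1 + (tan (u / 2))\<^sup>2) * (inverse ((cos (u / 2))\<^sup>2) * (1 / 2))) = 1"
    using assms by (simp add: tan_sec power_inverse field_simps)
  finally show ?thesis .
qed

lemma DERIV_sper: assumes "cos (u / 2) \<noteq> 0" shows "(sper p has_real_derivative p * cper p u) (at u)"
  unfolding sper_def[abs_def] cper_eq[OF assms]
  by (rule derivative_eq_intros DERIV_half_angle[OF assms] refl | simp add: mult.commute)+

lemma DERIV_cper: assumes "cos (u / 2) \<noteq> 0" shows "(cper p has_real_derivative - p * sper p u) (at u)"
proof -
  have "((\<lambda>u. cos (p * (2 * arctan (tan (u / 2))))) has_real_derivative - p * sper p u) (at u)"
    unfolding sper_def by (rule derivative_eq_intros DERIV_half_angle[OF assms] refl | simp add: mult.commute)+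
  moreover have "\<forall>\<^sub>F w in nhds u. cper p w = cos (p * (2 * arctan (tan (w / 2))))"
  proof -
    have "open {w::real. cos (w / 2) \<noteq> 0}" by (intro open_Collect_neq continuous_intros) auto
    then have "\<forall>\<^sub>F w in nhds u. cos (w / 2) \<noteq> 0" using assms by (simp add: eventually_nhds) blast
    then show ?thesis by eventually_elim (rule cper_eq)
  qed
  note DERIV_cong_ev[OF refl this refl]
  ultimately show ?thesis by simp
qed

lemma DERIV_per_linear:
  assumes "a = 0 \<or> cos ((a * x + b) / 2) \<noteq> 0"
  shows "((\<lambda>x. cper p (a * x + b)) has_real_derivative a * (- p * sper p (a * x + b))) (at x)"
    and "((\<lambda>x. sper p (a * x + b)) has_real_derivative a * (p * cper p (a * x + b))) (at x)"
proof -
  have l: "((\<lambda>x. a * x + b) has_real_derivative a) (at x)" by (auto intro!: derivative_eq_intros)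
  show "((\<lambda>x. cper p (a * x + b)) has_real_derivative a * (- p * sper p (a * x + b))) (at x)"
    using assms DERIV_chain2[OF DERIV_cper l, of p] by (cases "a = 0") (auto simp: mult.commute)
  show "((\<lambda>x. sper p (a * x + b)) has_real_derivative a * (p * cper p (a * x + b))) (at x)"
    using assms DERIV_chain2[OF DERIV_sper l, of p] by (cases "a = 0") (auto simp: mult.commute)
qed

lemma per_uminus [simp]: "cper p (- u) = cper p u" "sper p (- u) = - sper p u"
  by (simp_all add: cper_def sper_def arctan_minus)

lemma per_periodic: "cper p (u + of_int k * (2 * pi)) = cper p u" "sper p (u + of_int k * (2 * pi)) = sper p u"
proof -
  have "cos (u + of_int k * (2 * pi)) = cos u"
    using cos_int_times_real sin_cos_eq_iff[of "u + of_int k * (2 * pi)" u] by (metis mult.commute mult.left_commute)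
  then show "cper p (u + of_int k * (2 * pi)) = cper p u" by (simp add: cper_def)
  have "tan ((u + of_int k * (2 * pi)) / 2) = tan (u / 2)"
    using tan_periodic_int[of "u / 2" k] by (simp add: add_divide_distrib)
  then show "sper p (u + of_int k * (2 * pi)) = sper p u" by (simp add: sper_def)
qed

lemma sper_eq_0: assumes "sin u = 0" shows "sper p u = 0"
proof -
  have "sin (u / 2) = 0 \<or> cos (u / 2) = 0" using assms sin_double[of "u / 2"] by simp
  then show ?thesis by (auto simp: sper_def tan_def)
qed

lemma per_eq: assumes "0 \<le> u" "u < pi" shows "cper p u = cos (p * u)" "sper p u = sin (p * u)"
proof -
  have "2 * arctan (tan (u / 2)) = u" using assms by (subst arctan_tan) auto
  then show "sper p u = sin (p * u)" by (simp only: sper_def)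
qed (use assms in \<open>simp add: cper_def arccos_cos\<close>)

lemma cper_pi: "cper p pi = cos (p * pi)" "cper p 0 = 1"
  by (simp_all add: cper_def)

text \<open>A segment crosses one family of parallel grid lines finitely often; this supplies the
  finite exceptional sets of Green's formula.\<close>

lemma finite_cos_zeros:
  assumes "a \<noteq> 0" shows "finite {x. 0 \<le> x \<and> x \<le> pi \<and> cos (a * x + b) = (0::real)}"
proof -
  define N where "N = \<lceil>2 * (\<bar>a\<bar> * pi + \<bar>b\<bar>) / pi\<rceil>"
  have "{x. 0 \<le> x \<and> x \<le> pi \<and> cos (a * x + b) = 0} \<subseteq> (\<lambda>i. (of_int i * (pi / 2) - b) / a) ` {- N..N}"
  proof
    fix x assume "x \<in> {x. 0 \<le> x \<and> x \<le> pi \<and> cos (a * x + b) = 0}"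
    then have x: "0 \<le> x" "x \<le> pi" "cos (a * x + b) = 0" by auto
    then obtain i where i: "a * x + b = of_int i * (pi / 2)" unfolding cos_zero_iff_int by auto
    have "\<bar>a * x\<bar> \<le> \<bar>a\<bar> * pi" using x by (simp add: abs_mult mult_left_mono)
    then have "\<bar>of_int i * (pi / 2)\<bar> \<le> \<bar>a\<bar> * pi + \<bar>b\<bar>" unfolding i[symmetric] by linarith
    then have "\<bar>real_of_int i\<bar> \<le> 2 * (\<bar>a\<bar> * pi + \<bar>b\<bar>) / pi" by (simp add: abs_mult field_simps)
    then have "i \<in> {- N..N}" unfolding N_def by (simp add: abs_le_iff) linarith
    moreover have "x = (of_int i * (pi / 2) - b) / a" using i assms by (simp add: field_simps)
    ultimately show "x \<in> (\<lambda>i. (of_int i * (pi / 2) - b) / a) ` {- N..N}" by blast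
  qed
  then show ?thesis by (rule finite_subset) simp
qed

lemma continuous_on_mult_bounded:
  fixes w h :: "'a::metric_space \<Rightarrow> real"
  assumes w: "continuous_on S w" and B: "\<And>z. \<bar>h z\<bar> \<le> B" and c: "\<And>z. z \<in> S \<Longrightarrow> w z = 0 \<or> isCont h z"
  shows "continuous_on S (\<lambda>z. w z * h z)"
  unfolding continuous_on_def
proof
  fix z assume z: "z \<in> S"
  have wl: "(w \<longlongrightarrow> w z) (at z within S)" using w z by (simp add: continuous_on_def)
  show "((\<lambda>z. w z * h z) \<longlongrightarrow> w z * h z) (at z within S)"
  proof (cases "w z = 0")
    case False
    then have "isCont h z" using c[OF z] by simp
    then have "(h \<longlongrightarrow> h z) (at z within S)"
      unfolding isCont_def by (rule tendsto_within_subset) simp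
    then show ?thesis by (intro tendsto_mult wl)
  next
    case True
    have "((\<lambda>z. w z * h z) \<longlongrightarrow> 0) (at z within S)"
    proof (rule Lim_null_comparison)
      show "\<forall>\<^sub>F x in at z within S. norm (w x * h x) \<le> \<bar>w x\<bar> * B"
      proof (intro always_eventually allI)
        fix x show "norm (w x * h x) \<le> \<bar>w x\<bar> * B"
          unfolding real_norm_def abs_mult by (rule mult_left_mono[OF B abs_ge_zero])
      qed
      have "((\<lambda>x. \<bar>w x\<bar> * B) \<longlongrightarrow> \<bar>w z\<bar> * B) (at z within S)" by (intro tendsto_intros wl)
      then show "((\<lambda>x. \<bar>w x\<bar> * B) \<longlongrightarrow> 0) (at z within S)" using True by simp
    qed
    then show ?thesis using True by simp
  qed
qed

text \<open>The analogue of a mode with real frequencies on the square of side \<open>pi\<close>,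
  continued by reflection in its sides. Away from the lines where a coordinate is an odd multiple of
  \<open>pi\<close>, the functions below are its partial derivatives.\<close>

definition sqfun :: "real \<Rightarrow> real \<Rightarrow> real \<times> real \<Rightarrow> real" where
  "sqfun p q = (\<lambda>(a, b). cper p a * cper q b + cper q a * cper p b)"

definition sqfun1 :: "real \<Rightarrow> real \<Rightarrow> real \<times> real \<Rightarrow> real" where
  "sqfun1 p q = (\<lambda>(a, b). - p * sper p a * cper q b - q * sper q a * cper p b)"

definition sqfun2 :: "real \<Rightarrow> real \<Rightarrow> real \<times> real \<Rightarrow> real" where
  "sqfun2 p q = (\<lambda>(a, b). - q * cper p a * sper q b - p * cper q a * sper p b)"

definition sqfun12 :: "real \<Rightarrow> real \<Rightarrow> real \<times> real \<Rightarrow> real" where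
  "sqfun12 p q = (\<lambda>(a, b). p * q * (sper p a * sper q b + sper q a * sper p b))"

definition sqfun11 :: "real \<Rightarrow> real \<Rightarrow> real \<times> real \<Rightarrow> real" where
  "sqfun11 p q = (\<lambda>(a, b). - p\<^sup>2 * cper p a * cper q b - q\<^sup>2 * cper q a * cper p b)"

definition sqfun22 :: "real \<Rightarrow> real \<Rightarrow> real \<times> real \<Rightarrow> real" where
  "sqfun22 p q = (\<lambda>(a, b). - q\<^sup>2 * cper p a * cper q b - p\<^sup>2 * cper q a * cper p b)"

lemmas sqfun_defs = sqfun_def sqfun1_def sqfun2_def sqfun11_def sqfun12_def sqfun22_def

lemma borel_sqfun [measurable]:
  "sqfun p q \<in> borel_measurable borel" "sqfun1 p q \<in> borel_measurable borel" "sqfun2 p q \<in> borel_measurable borel"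
  "sqfun11 p q \<in> borel_measurable borel" "sqfun12 p q \<in> borel_measurable borel" "sqfun22 p q \<in> borel_measurable borel"
  unfolding sqfun_defs borel_prod[symmetric] by measurable

lemma abs_mult_le_1: "\<bar>a\<bar> \<le> 1 \<Longrightarrow> \<bar>b\<bar> \<le> 1 \<Longrightarrow> \<bar>c * a * b\<bar> \<le> \<bar>c :: real\<bar>"
  using mult_mono[of "\<bar>a\<bar>" 1 "\<bar>b\<bar>" 1] mult_left_mono[of "\<bar>a\<bar> * \<bar>b\<bar>" 1 "\<bar>c\<bar>"] by (simp add: abs_mult mult.assoc)

lemma sqfun_bounded:
  "\<bar>sqfun p q z\<bar> \<le> 2" "\<bar>sqfun1 p q z\<bar> \<le> \<bar>p\<bar> + \<bar>q\<bar>" "\<bar>sqfun2 p q z\<bar> \<le> \<bar>p\<bar> + \<bar>q\<bar>"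
  "\<bar>sqfun11 p q z\<bar> \<le> p\<^sup>2 + q\<^sup>2" "\<bar>sqfun12 p q z\<bar> \<le> 2 * \<bar>p * q\<bar>" "\<bar>sqfun22 p q z\<bar> \<le> p\<^sup>2 + q\<^sup>2"
proof -
  obtain a b where z: "z = (a, b)" by (cases z)
  have c: "\<bar>k * cper r x * cper s y\<bar> \<le> \<bar>k\<bar>" "\<bar>k * sper r x * cper s y\<bar> \<le> \<bar>k\<bar>"
    "\<bar>k * cper r x * sper s y\<bar> \<le> \<bar>k\<bar>" "\<bar>k * sper r x * sper s y\<bar> \<le> \<bar>k\<bar>" for k r s x y
    by (rule abs_mult_le_1; simp)+
  show "\<bar>sqfun p q z\<bar> \<le> 2" using c(1)[of 1 p a q b] c(1)[of 1 q a p b] unfolding z sqfun_def by simp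
  show "\<bar>sqfun1 p q z\<bar> \<le> \<bar>p\<bar> + \<bar>q\<bar>" using c(2)[of p p a q b] c(2)[of q q a p b] unfolding z sqfun1_def by simp
  show "\<bar>sqfun2 p q z\<bar> \<le> \<bar>p\<bar> + \<bar>q\<bar>" using c(3)[of q p a q b] c(3)[of p q a p b] unfolding z sqfun2_def by simp
  show "\<bar>sqfun11 p q z\<bar> \<le> p\<^sup>2 + q\<^sup>2" using c(1)[of "p\<^sup>2" p a q b] c(1)[of "q\<^sup>2" q a p b] unfolding z sqfun11_def by simp
  show "\<bar>sqfun22 p q z\<bar> \<le> p\<^sup>2 + q\<^sup>2" using c(1)[of "q\<^sup>2" p a q b] c(1)[of "p\<^sup>2" q a p b] unfolding z sqfun22_def by simp
  show "\<bar>sqfun12 p q z\<bar> \<le> 2 * \<bar>p * q\<bar>"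
    using c(4)[of "p * q" p a q b] c(4)[of "p * q" q a p b] unfolding z sqfun12_def by (simp add: distrib_left mult.assoc)
qed

section \<open>The similarity \<open>rot\<close> and integrals of reflection-invariant
  functions\<close>

definition rot :: "real \<times> real \<Rightarrow> real \<times> real" where
  "rot = (\<lambda>(x, y). (x + y, x - y))"

lemma rot_Pair [simp]: "rot (x, y) = (x + y, x - y)"
  by (simp add: rot_def)

lemma borel_rot [measurable]: "rot \<in> borel_measurable borel"
  unfolding rot_def case_prod_unfold by (intro borel_measurable_continuous_onI continuous_intros)

text \<open>Functions invariant under the reflections in the sides of all triangles of the tiling
  generated by \<^term>\<open>tri\<close>.\<close>

definition reflective :: "(real \<times> real \<Rightarrow> real) \<Rightarrow> bool" where
  "reflective h \<longleftrightarrow> h \<in> borel_measurable borel \<and> (\<exists>B. \<forall>z. \<bar>h z\<bar> \<le> B) \<and>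
     (\<forall>a b. h (b, a) = h (a, b) \<and> h (- a, b) = h (a, b) \<and> h (a + 2 * pi, b) = h (a, b))"

lemma reflective_rot: assumes "reflective h" shows "reflective (\<lambda>z. h (rot z))"
proof -
  have s: "h (b, a) = h (a, b)" and m: "h (- a, b) = h (a, b)" and p: "h (a + 2 * pi, b) = h (a, b)" for a b
    using assms unfolding reflective_def by blast+
  have m2: "h (a, - b) = h (a, b)" for a b using s m by metis
  have p2: "h (a, b + 2 * pi) = h (a, b)" for a b using s p by metis
  have "h \<in> borel_measurable borel" using assms by (simp add: reflective_def)
  then have "(\<lambda>z. h (rot z)) \<in> borel_measurable borel" by (rule measurable_compose[OF borel_rot])
  moreover have "h (b + a, b - a) = h (a + b, a - b)" for a b
    using m2[of "a + b" "a - b"] by (simp add: add.commute)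
  moreover have "h (- a + b, - a - b) = h (a + b, a - b)" for a b
  proof -
    have "h (- a + b, - a - b) = h (- (a - b), - (a + b))" by simp
    also have "\<dots> = h (a + b, a - b)" unfolding m m2 by (rule s)
    finally show ?thesis .
  qed
  moreover have "h (a + 2 * pi + b, a + 2 * pi - b) = h (a + b, a - b)" for a b
    using p[of "a + b" "a - b + 2 * pi"] p2[of "a + b" "a - b"] by (simp add: algebra_simps)
  moreover have "\<exists>B. \<forall>z. \<bar>h (rot z)\<bar> \<le> B" using assms unfolding reflective_def by blast
  ultimately show ?thesis unfolding reflective_def by simp
qed

text \<open>The box only has to contain the supports occurring in \<open>tint_rot\<close>, where all
  coordinates lie between 0 and \<open>2 * pi\<close>.\<close>

lemma integrable_bounded_box:
  fixes g :: "real \<times> real \<Rightarrow> real"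
  assumes "g \<in> borel_measurable borel" "\<And>z. \<bar>g z\<bar> \<le> B" "\<And>z. z \<notin> cbox (-10, -10) (10, 10) \<Longrightarrow> g z = 0"
  shows "integrable lborel g"
proof (rule Bochner_Integration.integrable_bound)
  show "integrable lborel (\<lambda>z. indicator (cbox (-10, -10) (10, 10) :: (real \<times> real) set) z * B :: real)"
    using emeasure_compact_finite[OF compact_cbox[of "(-10, -10) :: real \<times> real" "(10, 10)"]]
    by (intro integrable_mult_left integrable_real_indicator) auto
  show "AE z in lborel. norm (g z) \<le> norm (indicator (cbox (-10, -10) (10, 10)) z * B)"
  proof (rule AE_I2)
    fix z show "norm (g z) \<le> norm (indicator (cbox (-10, -10) (10, 10)) z * B)"
      using assms(2)[of z] assms(3)[of z] by (cases "z \<in> cbox (-10, -10) (10, 10)") auto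
  qed
qed (use assms in simp)

text \<open>\<open>rot\<close> doubles areas and maps the triangle onto \<open>R\<close>, which
  consists of the triangle and its mirror image in the line where the first coordinate is
  \<open>pi\<close>. By invariance both halves contribute \<open>tint h\<close>, and the two factors
  2 cancel.\<close>

lemma tint_rot:
  assumes h: "reflective h" shows "tint (\<lambda>z. h (rot z)) = tint h"
proof -
  have s: "h (b, a) = h (a, b)" and m: "h (- a, b) = h (a, b)" and p: "h (a + 2 * pi, b) = h (a, b)" for a b
    using h unfolding reflective_def by blast+
  have hb: "h \<in> borel_measurable borel" using h by (simp add: reflective_def)
  obtain B where B: "\<And>z. \<bar>h z\<bar> \<le> B" using h unfolding reflective_def by blast
  have B0: "0 \<le> B" using B[of "(0, 0)"] by linarith
  define R where "R = {z :: real \<times> real. 0 \<le> snd z} \<inter> {z. snd z \<le> fst z} \<inter> {z. fst z + snd z \<le> 2 * pi}"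
  define f where "f z = indicator R z * h z" for z
  have "closed R" unfolding R_def by (intro closed_Int closed_Collect_le continuous_intros)
  then have fb: "f \<in> borel_measurable borel"
    unfolding f_def using hb by (intro borel_measurable_times borel_measurable_indicator) (auto simp: borel_closed)
  have fB: "\<bar>f z\<bar> \<le> B" for z using B[of z] B0 by (auto simp: f_def indicator_def)
  have pi4: "pi < 4" using pi_less_4 .
  have box: "(a, b) \<in> cbox (-10, -10) (10, 10) \<longleftrightarrow> -10 \<le> a \<and> a \<le> 10 \<and> -10 \<le> b \<and> b \<le> 10" for a b :: real
    by (auto simp: cbox_Pair_eq)
  have intf: "integrable (lborel \<Otimes>\<^sub>M lborel) (\<lambda>(a, b). f (a, b))"
  proof -
    have "integrable lborel f"
    proof (rule integrable_bounded_box[OF fb fB])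
      fix z :: "real \<times> real" assume "z \<notin> cbox (-10, -10) (10, 10)"
      then have "z \<notin> R" using pi4 by (cases z) (auto simp: R_def box)
      then show "f z = 0" by (simp add: f_def)
    qed
    then show ?thesis by (simp add: lborel_prod case_prod_unfold)
  qed
  have intg: "integrable (lborel \<Otimes>\<^sub>M lborel) (\<lambda>(x, a). f (a, 2 * x - a))"
  proof -
    have "(\<lambda>z. f (snd z, 2 * fst z - snd z)) \<in> borel_measurable borel"
      by (rule measurable_compose[OF _ fb]) (intro borel_measurable_continuous_onI continuous_intros)
    then have "integrable lborel (\<lambda>z. f (snd z, 2 * fst z - snd z))"
    proof (rule integrable_bounded_box[OF _ fB])
      fix z :: "real \<times> real" assume "z \<notin> cbox (-10, -10) (10, 10)"
      then have "(snd z, 2 * fst z - snd z) \<notin> R" using pi4 by (cases z) (auto simp: R_def box)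
      then show "f (snd z, 2 * fst z - snd z) = 0" by (simp add: f_def)
    qed
    then show ?thesis by (simp add: lborel_prod case_prod_unfold)
  qed
  have bh: "bmeas h" "bmeas (\<lambda>z. h (rot z))"
    by (rule bmeas_bounded_borel[OF hb B], rule bmeas_bounded_borel[OF measurable_compose[OF borel_rot hb] B])
  have fubini: "tint g = (LINT x|lborel. LINT y|lborel. indicator ctri (x, y) * g (x, y))"
    "integrable lborel (\<lambda>x. LINT y|lborel. indicator ctri (x, y) * g (x, y))" if "bmeas g" for g
  proof -
    have i: "integrable (lborel \<Otimes>\<^sub>M lborel) (\<lambda>(x, y). indicator ctri (x, y) * g (x, y))"
      using integrable_bmeas[OF that] by (simp add: lborel_prod case_prod_unfold)
    show "tint g = (LINT x|lborel. LINT y|lborel. indicator ctri (x, y) * g (x, y))"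
      using lborel_pair.integral_fst[OF i] by (simp add: tint_def lborel_prod case_prod_unfold)
    show "integrable lborel (\<lambda>x. LINT y|lborel. indicator ctri (x, y) * g (x, y))"
      using lborel_pair.integrable_fst[OF i] .
  qed
  define \<Phi> where "\<Phi> a = (LINT b|lborel. f (a, b))" for a
  define \<Psi> where "\<Psi> a = (LINT b|lborel. indicator ctri (a, b) * h (a, b))" for a
  have "tint (\<lambda>z. h (rot z)) = (LINT x|lborel. LINT y|lborel. f (x + y, x - y))"
    unfolding fubini(1)[OF bh(2)]
    by (intro Bochner_Integration.integral_cong refl) (auto simp: f_def R_def indicator_def)
  \<comment> \<open>The substitution is made one coordinate at a time: \<open>a = x + y\<close> for
    fixed \<open>x\<close>, then, after exchanging the integrals, \<open>b = 2 * x - a\<close> for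
    fixed \<open>a\<close>, which produces the factor 1/2.\<close>
  also have "\<dots> = (LINT x|lborel. LINT a|lborel. f (a, 2 * x - a))"
  proof (rule Bochner_Integration.integral_cong[OF refl])
    fix x :: real
    show "(LINT y|lborel. f (x + y, x - y)) = (LINT a|lborel. f (a, 2 * x - a))"
      using lborel_integral_real_affine[of 1 "\<lambda>a. f (a, 2 * x - a)" x] by (simp add: algebra_simps)
  qed
  also have "\<dots> = (LINT a|lborel. LINT x|lborel. f (a, 2 * x - a))"
    using lborel_pair.Fubini_integral[OF intg] by simp
  also have "\<dots> = (LINT a|lborel. \<Phi> a / 2)"
  proof (rule Bochner_Integration.integral_cong[OF refl])
    fix a :: real
    show "(LINT x|lborel. f (a, 2 * x - a)) = \<Phi> a / 2"
      using lborel_integral_real_affine[of 2 "\<lambda>b. f (a, b)" "- a"] by (simp add: \<Phi>_def algebra_simps)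
  qed
  also have "\<dots> = (LINT a|lborel. \<Phi> a) / 2" by simp
  also have "(LINT a|lborel. \<Phi> a) = (LINT a|lborel. \<Psi> a + \<Psi> (2 * pi - a))"
  proof (rule Bochner_Integration.integral_cong_AE)
    have "AE a in lborel. a \<noteq> pi" by (rule AE_lborel_singleton)
    then show "AE a in lborel. \<Phi> a = \<Psi> a + \<Psi> (2 * pi - a)"
    proof eventually_elim
      case (elim a)
      show ?case
      proof (cases "a < pi")
        case True
        have "f (a, b) = indicator ctri (a, b) * h (a, b)" for b
          using True by (auto simp: f_def R_def indicator_def)
        moreover have "indicator ctri (2 * pi - a, b) = (0 :: real)" for b
          using True by (auto simp: indicator_def)
        ultimately show ?thesis by (simp add: \<Phi>_def \<Psi>_def)
      next
        case False
        then have a: "a > pi" using elim by simp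
        have "h (2 * pi - a, b) = h (a, b)" for b using p[of "- a" b] m[of a b] by (simp add: algebra_simps)
        then have "f (a, b) = indicator ctri (2 * pi - a, b) * h (2 * pi - a, b)" for b
          using a by (auto simp: f_def R_def indicator_def)
        moreover have "indicator ctri (a, b) = (0 :: real)" for b
          using a by (auto simp: indicator_def)
        ultimately show ?thesis by (simp add: \<Phi>_def \<Psi>_def)
      qed
    qed
    show "\<Phi> \<in> borel_measurable lborel"
      using lborel_pair.integrable_fst[OF intf] unfolding \<Phi>_def[abs_def] by auto
    have \<Psi>b: "\<Psi> \<in> borel_measurable borel"
      using fubini(2)[OF bh(1)] unfolding \<Psi>_def[abs_def] by auto
    then show "(\<lambda>a. \<Psi> a + \<Psi> (2 * pi - a)) \<in> borel_measurable lborel" by measurable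
  qed
  also have "\<dots> = 2 * tint h"
  proof -
    have i: "integrable lborel \<Psi>" using fubini(2)[OF bh(1)] by (simp add: \<Psi>_def[abs_def])
    have i2: "integrable lborel (\<lambda>a. \<Psi> (2 * pi - a))"
      using lborel_integrable_real_affine[OF i, of "-1" "2 * pi"] by simp
    have "(LINT a|lborel. \<Psi> (2 * pi - a)) = (LINT a|lborel. \<Psi> a)"
      using lborel_integral_real_affine[of "-1" \<Psi> "2 * pi"] by simp
    moreover have "tint h = (LINT a|lborel. \<Psi> a)" using fubini(1)[OF bh(1)] by (simp add: \<Psi>_def)
    ultimately show ?thesis using i i2 by simp
  qed
  finally show ?thesis by simp
qed

lemma tint_rot_funpow:
  assumes "reflective h" shows "tint (\<lambda>z. h ((rot ^^ k) z)) = tint h"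
  using assms
proof (induction k arbitrary: h)
  case (Suc k)
  have "tint (\<lambda>z. h ((rot ^^ Suc k) z)) = tint (\<lambda>z. h (rot ((rot ^^ k) z)))" by simp
  also have "\<dots> = tint (\<lambda>z. h (rot z))" by (rule Suc.IH[OF reflective_rot[OF Suc.prems]])
  also have "\<dots> = tint h" by (rule tint_rot[OF Suc.prems])
  finally show ?case .
qed simp

lemma rot_funpow:
  "(rot ^^ (2 * i)) (x, y) = (2 ^ i * x, 2 ^ i * y)"
  "(rot ^^ (2 * i + 1)) (x, y) = (2 ^ i * (x + y), 2 ^ i * (x - y))"
proof -
  have 1: "(rot ^^ (2 * i)) (x, y) = (2 ^ i * x, 2 ^ i * y)" for x y
    by (induction i arbitrary: x y) (auto simp: algebra_simps)
  then show "(rot ^^ (2 * i)) (x, y) = (2 ^ i * x, 2 ^ i * y)" .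
  show "(rot ^^ (2 * i + 1)) (x, y) = (2 ^ i * (x + y), 2 ^ i * (x - y))"
    by (simp only: Suc_eq_plus1[symmetric] funpow.simps o_apply 1 rot_Pair distrib_left right_diff_distrib)
qed

text \<open>The reflections change signs of the two derivatives or exchange them, but leave the sum
  of their squares fixed.\<close>

lemma reflective_sqfun_energy:
  "reflective (\<lambda>z. (sqfun1 p q z)\<^sup>2 + (sqfun2 p q z)\<^sup>2 - (p\<^sup>2 + q\<^sup>2) * (sqfun p q z)\<^sup>2)"
proof -
  let ?h = "\<lambda>z. (sqfun1 p q z)\<^sup>2 + (sqfun2 p q z)\<^sup>2 - (p\<^sup>2 + q\<^sup>2) * (sqfun p q z)\<^sup>2"
  have "?h \<in> borel_measurable borel" by measurable
  moreover have "\<bar>?h z\<bar> \<le> (\<bar>p\<bar> + \<bar>q\<bar>)\<^sup>2 + (\<bar>p\<bar> + \<bar>q\<bar>)\<^sup>2 + (p\<^sup>2 + q\<^sup>2) * 2\<^sup>2" for z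
  proof -
    have "(sqfun1 p q z)\<^sup>2 \<le> (\<bar>p\<bar> + \<bar>q\<bar>)\<^sup>2" "(sqfun2 p q z)\<^sup>2 \<le> (\<bar>p\<bar> + \<bar>q\<bar>)\<^sup>2" "(sqfun p q z)\<^sup>2 \<le> 2\<^sup>2"
      using sqfun_bounded(1-3)[of p q z, THEN power_mono[OF _ abs_ge_zero], of 2] by simp_all
    moreover from this(3) have "(p\<^sup>2 + q\<^sup>2) * (sqfun p q z)\<^sup>2 \<le> (p\<^sup>2 + q\<^sup>2) * 2\<^sup>2"
      by (rule mult_left_mono) simp
    moreover have "0 \<le> (p\<^sup>2 + q\<^sup>2) * (sqfun p q z)\<^sup>2" "0 \<le> (sqfun1 p q z)\<^sup>2" "0 \<le> (sqfun2 p q z)\<^sup>2" by simp_all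
    ultimately show ?thesis by linarith
  qed
  moreover have "?h (b, a) = ?h (a, b)" "?h (- a, b) = ?h (a, b)" "?h (a + 2 * pi, b) = ?h (a, b)" for a b
    using per_periodic[of _ a 1] by (simp_all add: sqfun_defs power2_eq_square algebra_simps)
  ultimately show ?thesis unfolding reflective_def by blast
qed

section \<open>Energy of the folded product\<close>

lemma lint_cmult: "lint (\<lambda>x. c * u x) = c * lint u"
  unfolding lint_def by (simp add: mult.left_commute)

lemma lint_by_parts:
  fixes p q :: real
  defines "C \<equiv> \<lambda>p x. cos (p * x)" and "S \<equiv> \<lambda>p x. - p * sin (p * x)"
  shows "lint (\<lambda>x. S p x * S q x) = S p pi * C q pi + p\<^sup>2 * lint (\<lambda>x. C p x * C q x)"
proof -
  have i: "integrable lborel (\<lambda>x. indicator {0..pi} x * (S p x * S q x))" "integrable lborel (\<lambda>x. indicator {0..pi} x * (p\<^sup>2 * (C p x * C q x)))"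
    unfolding C_def S_def by (intro lint_integrable continuous_intros)+
  have "lint (\<lambda>x. S p x * S q x - p\<^sup>2 * (C p x * C q x)) = S p pi * C q pi - S p 0 * C q 0"
    unfolding C_def S_def
    by (rule lint_FTC) (auto intro!: derivative_eq_intros continuous_intros simp: power2_eq_square algebra_simps)
  moreover have "lint (\<lambda>x. S p x * S q x - p\<^sup>2 * (C p x * C q x)) = lint (\<lambda>x. S p x * S q x) - p\<^sup>2 * lint (\<lambda>x. C p x * C q x)"
    unfolding lint_cmult[symmetric] unfolding lint_def right_diff_distrib by (rule Bochner_Integration.integral_diff[OF i])
  ultimately show ?thesis by (simp add: S_def)
qed

text \<open>On the square everything reduces to one-dimensional integrals, and integration by parts
  leaves boundary values at \<open>pi\<close>. The Neumann condition \<open>sin (q * pi) = 0\<close>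
  or the Dirichlet condition \<open>cos (q * pi) = 0\<close> removes the pure boundary term of
  \<open>q\<close> and one mixed term. The order of \<open>p\<close> and \<open>q\<close> makes the
  other mixed term minus a square over a positive number, and \<open>sc\<close> gives the sign of
  the pure term of \<open>p\<close>.\<close>

lemma sqfun_energy:
  assumes pq: "sin (q * pi) = 0 \<and> q < p \<or> cos (q * pi) = 0 \<and> p < q" "0 \<le> p" "0 \<le> q"
    and sc: "0 \<le> sin (p * pi) * cos (p * pi)"
  shows "tint (\<lambda>z. (sqfun1 p q z)\<^sup>2 + (sqfun2 p q z)\<^sup>2 - (p\<^sup>2 + q\<^sup>2) * (sqfun p q z)\<^sup>2) \<le> 0"
proof -
  define C where "C p x = cos (p * x)" for p x :: real
  define S where "S p x = - p * sin (p * x)" for p x :: real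
  define I where "I p q = lint (\<lambda>x. C p x * C q x)" for p q
  have parts: "lint (\<lambda>x. S p x * S q x) = S p pi * C q pi + p\<^sup>2 * I p q" for p q
    unfolding C_def S_def I_def by (rule lint_by_parts)
  define h where "h z = (S p (fst z) * C q (snd z) + S q (fst z) * C p (snd z))\<^sup>2 + (S q (snd z) * C p (fst z) + S p (snd z) * C q (fst z))\<^sup>2
     - (p\<^sup>2 + q\<^sup>2) * (C p (fst z) * C q (snd z) + C q (fst z) * C p (snd z))\<^sup>2" for z
  have "tint (\<lambda>z. (sqfun1 p q z)\<^sup>2 + (sqfun2 p q z)\<^sup>2 - (p\<^sup>2 + q\<^sup>2) * (sqfun p q z)\<^sup>2) = tint h"
    unfolding tint_def
  proof (rule Bochner_Integration.integral_cong_AE)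
    have ch: "continuous_on A h" for A unfolding h_def C_def S_def by (intro continuous_intros)
    show "(\<lambda>z. indicator ctri z * h z) \<in> borel_measurable lborel"
      using integrable_bmeas[OF bmeas_continuous[OF ch]] by auto
    show "(\<lambda>z. indicator ctri z * ((sqfun1 p q z)\<^sup>2 + (sqfun2 p q z)\<^sup>2 - (p\<^sup>2 + q\<^sup>2) * (sqfun p q z)\<^sup>2)) \<in> borel_measurable lborel"
      using reflective_sqfun_energy[of p q] by (auto simp: reflective_def intro!: borel_measurable_times)
    \<comment> \<open>At first coordinate \<open>pi\<close> the folded sine has its jump, so the
      folded and the unfolded integrand are compared off this null line.\<close>
    have "negligible {z :: real \<times> real. (1, 0) \<bullet> z = pi}"
      by (rule negligible_hyperplane) (simp add: zero_prod_def)
    moreover have "{z :: real \<times> real. (1, 0) \<bullet> z = pi} = {z. fst z = pi}" by (auto simp: inner_prod_def)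
    moreover have "closed {z :: real \<times> real. fst z = pi}" by (intro closed_Collect_eq continuous_intros)
    ultimately have "AE z in lborel. fst (z :: real \<times> real) \<noteq> pi"
      by (subst AE_iff_measurable[OF _ refl]) (auto simp: negligible_iff_null_sets null_sets_def borel_closed)
    then show "AE z in lborel. indicator ctri z * ((sqfun1 p q z)\<^sup>2 + (sqfun2 p q z)\<^sup>2 - (p\<^sup>2 + q\<^sup>2) * (sqfun p q z)\<^sup>2) = indicator ctri z * h z"
    proof eventually_elim
      case (elim z)
      obtain a b where z: "z = (a, b)" by (cases z)
      show ?case
      proof (cases "z \<in> ctri")
        case True
        then have "0 \<le> a" "a < pi" "0 \<le> b" "b < pi" using elim z by auto
        note per_eq[OF this(1,2)] per_eq[OF this(3,4)]
        then have "(sqfun1 p q z)\<^sup>2 + (sqfun2 p q z)\<^sup>2 - (p\<^sup>2 + q\<^sup>2) * (sqfun p q z)\<^sup>2 = h z"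
          unfolding z h_def sqfun_defs C_def S_def by (simp add: power2_eq_square algebra_simps)
        then show ?thesis by simp
      qed simp
    qed
  qed
  also have "tint h = sqint h / 2"
  proof -
    have "sqint h = 2 * tint h"
      by (rule tint_symmetric) (auto simp: h_def C_def S_def algebra_simps intro!: continuous_intros)
    then show ?thesis by simp
  qed
  also have "sqint h = 2 * ((lint (\<lambda>x. S p x * S p x) * I q q + lint (\<lambda>x. S q x * S q x) * I p p + 2 * (lint (\<lambda>x. S p x * S q x) * I p q))
      - (p\<^sup>2 + q\<^sup>2) * (I p p * I q q + I p q * I p q))"
  proof -
    have pr: "sqint (\<lambda>z. (u (fst z) * v (fst z)) * (w (snd z) * r (snd z))) = lint (\<lambda>x. u x * v x) * lint (\<lambda>x. w x * r x)"
      if "continuous_on {0..pi} u" "continuous_on {0..pi} v" "continuous_on {0..pi} w" "continuous_on {0..pi} r" for u v w r :: "real \<Rightarrow> real"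
      using that by (intro sqint_product[of "\<lambda>x. u x * v x" "\<lambda>x. w x * r x"] continuous_intros)
    have c: "continuous_on A (C k)" "continuous_on A (S k)" for k A
      unfolding C_def S_def by (intro continuous_intros)+
    let ?P = "\<lambda>u v w r z. (u (fst z) * v (fst z)) * (w (snd z) * r (snd z))"
    have cP: "continuous_on A (?P u v w r)" if "continuous_on UNIV u" "continuous_on UNIV v" "continuous_on UNIV w" "continuous_on UNIV r" for u v w r :: "real \<Rightarrow> real" and A
      by (intro continuous_intros continuous_on_compose2[OF that(1)] continuous_on_compose2[OF that(2)]
          continuous_on_compose2[OF that(3)] continuous_on_compose2[OF that(4)]) auto
    have sq3: "sqint (\<lambda>z. u z + (v z + k * w z)) = sqint u + (sqint v + k * sqint w)"
      if "continuous_on UNIV u" "continuous_on UNIV v" "continuous_on UNIV w" for u v w k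
    proof -
      have "continuous_on A u" "continuous_on A v" "continuous_on A w" for A using that by (auto intro: continuous_on_subset)
      then show ?thesis by (subst sqint_add; (subst sqint_add)?) (auto intro!: continuous_intros simp: sqint_cmult)
    qed
    let ?h1 = "\<lambda>z. ?P (S p) (S p) (C q) (C q) z + (?P (S q) (S q) (C p) (C p) z + 2 * ?P (S p) (S q) (C p) (C q) z)"
    let ?h2 = "\<lambda>z. ?P (C p) (C p) (S q) (S q) z + (?P (C q) (C q) (S p) (S p) z + 2 * ?P (C p) (C q) (S p) (S q) z)"
    let ?h3 = "\<lambda>z. ?P (C p) (C p) (C q) (C q) z + (?P (C q) (C q) (C p) (C p) z + 2 * ?P (C p) (C q) (C p) (C q) z)"
    have ch: "continuous_on UNIV ?h1" "continuous_on UNIV ?h2" "continuous_on UNIV ?h3"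
      unfolding C_def S_def by (intro continuous_intros)+
    have "h = (\<lambda>z. ?h1 z + (?h2 z + (- (p\<^sup>2 + q\<^sup>2)) * ?h3 z))"
      unfolding h_def by (rule ext) algebra
    then have "sqint h = sqint (\<lambda>z. ?h1 z + (?h2 z + (- (p\<^sup>2 + q\<^sup>2)) * ?h3 z))" by simp
    also have "\<dots> = sqint ?h1 + (sqint ?h2 + (- (p\<^sup>2 + q\<^sup>2)) * sqint ?h3)"
      by (rule sq3[OF ch])
    also have "sqint ?h1 = lint (\<lambda>x. S p x * S p x) * I q q + (lint (\<lambda>x. S q x * S q x) * I p p + 2 * (lint (\<lambda>x. S p x * S q x) * I p q))"
      unfolding I_def by (subst sq3[OF cP cP cP]) ((rule c)+, simp only: pr[OF c(2) c(2) c(1) c(1)])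
    also have "sqint ?h2 = I p p * lint (\<lambda>x. S q x * S q x) + (I q q * lint (\<lambda>x. S p x * S p x) + 2 * (I p q * lint (\<lambda>x. S p x * S q x)))"
      unfolding I_def by (subst sq3[OF cP cP cP]) ((rule c)+, simp only: pr[OF c(1) c(1) c(2) c(2)])
    also have "sqint ?h3 = I p p * I q q + (I q q * I p p + 2 * (I p q * I p q))"
      unfolding I_def by (subst sq3[OF cP cP cP]) ((rule c)+, simp only: pr[OF c(1) c(1) c(1) c(1)])
    finally show ?thesis by (simp add: algebra_simps)
  qed
  also have "2 * ((lint (\<lambda>x. S p x * S p x) * I q q + lint (\<lambda>x. S q x * S q x) * I p p + 2 * (lint (\<lambda>x. S p x * S q x) * I p q))
      - (p\<^sup>2 + q\<^sup>2) * (I p p * I q q + I p q * I p q)) / 2 =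
      S p pi * C p pi * I q q + S q pi * C q pi * I p p + (S p pi * C q pi + S q pi * C p pi) * I p q" (is "_ = ?E")
  proof -
    have sym: "I q p = I p q" by (simp add: I_def mult.commute)
    have "2 * lint (\<lambda>x. S p x * S q x) = S p pi * C q pi + S q pi * C p pi + (p\<^sup>2 + q\<^sup>2) * I p q"
      using parts[of p q] parts[of q p] sym by (simp add: mult.commute[of "S q _"] algebra_simps)
    then show ?thesis unfolding parts[of p p] parts[of q q] by (simp add: algebra_simps)
  qed
  also have "?E \<le> 0"
  proof -
    have sym: "I q p = I p q" by (simp add: I_def mult.commute)
    \<comment> \<open>Lagrange's identity: the sum of the two integrations by parts gave
      \<open>?E\<close>, and their difference expresses the mixed integral \<open>I p q\<close> by
      boundary values.\<close>
    have J: "(p\<^sup>2 - q\<^sup>2) * I p q = S q pi * C p pi - S p pi * C q pi"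
      using parts[of p q] parts[of q p] sym by (simp add: mult.commute[of "S q _"] algebra_simps)
    have "S p pi * C p pi = - (p * (sin (p * pi) * cos (p * pi)))" by (simp add: S_def C_def)
    then have 1: "S p pi * C p pi \<le> 0" using sc pq(2) by simp
    have "0 \<le> I q q" unfolding I_def lint_def by (intro Bochner_Integration.integral_nonneg) (auto simp: indicator_def)
    then have 2: "S p pi * C p pi * I q q \<le> 0" using 1 by (simp add: mult_nonpos_nonneg)
    from pq(1) show ?thesis
    proof
      assume A: "sin (q * pi) = 0 \<and> q < p"
      then have Sq: "S q pi = 0" by (simp add: S_def)
      have pos: "p\<^sup>2 - q\<^sup>2 > 0" using A pq by (simp add: power_strict_mono)
      have "I p q = - (S p pi * C q pi) / (p\<^sup>2 - q\<^sup>2)" using J Sq pos by (simp add: field_simps)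
      then have "S p pi * C q pi * I p q = - ((S p pi * C q pi)\<^sup>2 / (p\<^sup>2 - q\<^sup>2))" by (simp add: power2_eq_square)
      also have "\<dots> \<le> 0" using pos by simp
      finally show ?thesis using 2 Sq by simp
    next
      assume A: "cos (q * pi) = 0 \<and> p < q"
      then have Cq: "C q pi = 0" by (simp add: C_def)
      have neg: "q\<^sup>2 - p\<^sup>2 > 0" using A pq by (simp add: power_strict_mono)
      have "I p q = - (S q pi * C p pi) / (q\<^sup>2 - p\<^sup>2)" using J Cq neg by (simp add: field_simps)
      then have "S q pi * C p pi * I p q = - ((S q pi * C p pi)\<^sup>2 / (q\<^sup>2 - p\<^sup>2))" by (simp add: power2_eq_square)
      also have "\<dots> \<le> 0" using neg by simp
      finally show ?thesis using 2 Cq by simp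
    qed
  qed
  finally show ?thesis by simp
qed

section \<open>The folded product as extra test function\<close>

lemma DERIV_sqfun_line:
  assumes "a = 0 \<or> cos ((a * x + b) / 2) \<noteq> 0" "c = 0 \<or> cos ((c * x + d) / 2) \<noteq> 0"
  defines "z \<equiv> (a * x + b, c * x + d)"
  shows "((\<lambda>x. sqfun p q (a * x + b, c * x + d)) has_real_derivative a * sqfun1 p q z + c * sqfun2 p q z) (at x)"
    and "((\<lambda>x. sqfun1 p q (a * x + b, c * x + d)) has_real_derivative a * sqfun11 p q z + c * sqfun12 p q z) (at x)"
    and "((\<lambda>x. sqfun2 p q (a * x + b, c * x + d)) has_real_derivative a * sqfun12 p q z + c * sqfun22 p q z) (at x)"
proof -
  note u = DERIV_per_linear[OF assms(1)] and v = DERIV_per_linear[OF assms(2)]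
  show "((\<lambda>x. sqfun p q (a * x + b, c * x + d)) has_real_derivative a * sqfun1 p q z + c * sqfun2 p q z) (at x)"
    using DERIV_add[OF DERIV_mult[OF u(1)[of p] v(1)[of q]] DERIV_mult[OF u(1)[of q] v(1)[of p]]]
    unfolding z_def sqfun_defs prod.case by (rule DERIV_cong) (simp add: algebra_simps)
  show "((\<lambda>x. sqfun1 p q (a * x + b, c * x + d)) has_real_derivative a * sqfun11 p q z + c * sqfun12 p q z) (at x)"
    using DERIV_diff[OF DERIV_mult[OF DERIV_cmult[OF u(2)[of p], of "- p"] v(1)[of q]] DERIV_mult[OF DERIV_cmult[OF u(2)[of q], of q] v(1)[of p]]]
    unfolding z_def sqfun_defs prod.case by (rule DERIV_cong) (simp add: power2_eq_square algebra_simps)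
  show "((\<lambda>x. sqfun2 p q (a * x + b, c * x + d)) has_real_derivative a * sqfun12 p q z + c * sqfun22 p q z) (at x)"
    using DERIV_diff[OF DERIV_mult[OF DERIV_cmult[OF u(1)[of p], of "- q"] v(2)[of q]] DERIV_mult[OF DERIV_cmult[OF u(1)[of q], of p] v(2)[of p]]]
    unfolding z_def sqfun_defs prod.case by (rule DERIV_cong) (simp add: power2_eq_square algebra_simps)
qed

lemma sqfun_laplace: "sqfun11 p q z + sqfun22 p q z = - (p\<^sup>2 + q\<^sup>2) * sqfun p q z"
  by (cases z) (simp add: sqfun_defs algebra_simps)

lemma isCont_sqfun:
  assumes "cos (fst z / 2) \<noteq> 0" "cos (snd z / 2) \<noteq> 0"
  shows "isCont (sqfun1 p q) z" "isCont (sqfun2 p q) z"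
proof -
  have s: "isCont (\<lambda>z. sper r (fst z)) z" "isCont (\<lambda>z. sper r (snd z)) z" for r
    by (rule isCont_o2[OF isCont_fst[OF continuous_ident] DERIV_isCont[OF DERIV_sper[OF assms(1)]]],
        rule isCont_o2[OF isCont_snd[OF continuous_ident] DERIV_isCont[OF DERIV_sper[OF assms(2)]]])
  have c: "isCont (\<lambda>z. cper r (fst z)) z" "isCont (\<lambda>z. cper r (snd z)) z" for r
    by (rule isCont_o2[OF isCont_fst[OF continuous_ident] DERIV_isCont[OF DERIV_cper[OF assms(1)]]],
        rule isCont_o2[OF isCont_snd[OF continuous_ident] DERIV_isCont[OF DERIV_cper[OF assms(2)]]])
  show "isCont (sqfun1 p q) z" "isCont (sqfun2 p q) z"
    unfolding sqfun1_def sqfun2_def case_prod_unfold by (intro continuous_intros s c)+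
qed

lemma continuous_sqfun: "continuous_on A (sqfun p q)"
  unfolding sqfun_def case_prod_unfold by (intro continuous_intros)

lemma continuous_on_mult_sqfun:
  fixes w :: "'a::metric_space \<Rightarrow> real" and L :: "'a \<Rightarrow> real \<times> real"
  assumes w: "continuous_on S w" and L: "continuous_on UNIV L"
    and 0: "\<And>z. z \<in> S \<Longrightarrow> cos (fst (L z) / 2) = 0 \<or> cos (snd (L z) / 2) = 0 \<Longrightarrow> w z = 0"
  shows "continuous_on S (\<lambda>z. w z * (k * sqfun1 p q (L z) + l * sqfun2 p q (L z)))"
proof (rule continuous_on_mult_bounded[OF w])
  fix z
  show "\<bar>k * sqfun1 p q (L z) + l * sqfun2 p q (L z)\<bar> \<le> \<bar>k\<bar> * (\<bar>p\<bar> + \<bar>q\<bar>) + \<bar>l\<bar> * (\<bar>p\<bar> + \<bar>q\<bar>)"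
    using mult_left_mono[OF sqfun_bounded(2)[of p q "L z"], of "\<bar>k\<bar>"] mult_left_mono[OF sqfun_bounded(3)[of p q "L z"], of "\<bar>l\<bar>"]
      abs_triangle_ineq[of "k * sqfun1 p q (L z)" "l * sqfun2 p q (L z)"]
    unfolding abs_mult[symmetric] by linarith
  have "isCont L z" using L unfolding continuous_on_eq_continuous_at[OF open_UNIV] by blast
  then have c: "isCont (\<lambda>z. sqfun1 p q (L z)) z \<and> isCont (\<lambda>z. sqfun2 p q (L z)) z"
    if "\<not> (cos (fst (L z) / 2) = 0 \<or> cos (snd (L z) / 2) = 0)"
    using isCont_o2[OF _ isCont_sqfun(1), where f = L and a = z] isCont_o2[OF _ isCont_sqfun(2), where f = L and a = z] that by blast
  assume z: "z \<in> S"
  show "w z = 0 \<or> isCont (\<lambda>z. k * sqfun1 p q (L z) + l * sqfun2 p q (L z)) z"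
  proof (cases "cos (fst (L z) / 2) = 0 \<or> cos (snd (L z) / 2) = 0")
    case True
    then show ?thesis using 0[OF z] by blast
  next
    case False
    then show ?thesis using c by (intro disjI2 isCont_add isCont_mult continuous_const; blast)
  qed
qed

text \<open>The rows of \<open>L\<close> are orthogonal of equal length, so composing with
  \<open>L\<close> multiplies the Laplacian by \<open>K\<close>; hence the formula for
  \<open>\<mu>\<close>. The test function is \<open>sqfun p q\<close> after \<open>L\<close>:
  \<open>bc\<close> is its Neumann condition, \<open>grid\<close> says that all modes of the level
  vanish on its kinks, and \<open>z0\<close> lies on a kink where the function itself is nonzero.
  Explicit coefficients make derivatives along coordinate lines computable.\<close>

lemma extra_function_bound:
  fixes a :: "int \<times> int \<Rightarrow> real" and \<mu> p q \<alpha> \<beta> \<gamma> \<delta> K :: real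
  defines "L \<equiv> \<lambda>z. (\<alpha> * fst z + \<beta> * snd z, \<gamma> * fst z + \<delta> * snd z)"
  defines "e1 \<equiv> \<lambda>z. \<alpha> * sqfun1 p q (L z) + \<gamma> * sqfun2 p q (L z)"
  defines "e2 \<equiv> \<lambda>z. \<beta> * sqfun1 p q (L z) + \<delta> * sqfun2 p q (L z)"
  assumes rows: "\<alpha>\<^sup>2 + \<beta>\<^sup>2 = K" "\<gamma>\<^sup>2 + \<delta>\<^sup>2 = K" "\<alpha> * \<gamma> + \<beta> * \<delta> = 0" and \<mu>: "\<mu> = K * (p\<^sup>2 + q\<^sup>2)"
    and bc: "\<And>t. e1 (pi, t) = 0" "\<And>t. e2 (t, 0) = 0" "\<And>t. e1 (t, t) = e2 (t, t)"
    and en: "tint (\<lambda>z. (sqfun1 p q (L z))\<^sup>2 + (sqfun2 p q (L z))\<^sup>2 - (p\<^sup>2 + q\<^sup>2) * (sqfun p q (L z))\<^sup>2) \<le> 0"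
    and grid: "\<And>z j. z \<in> ctri \<Longrightarrow> cos (fst (L z) / 2) = 0 \<or> cos (snd (L z) / 2) = 0 \<Longrightarrow> j \<in> level \<mu> \<Longrightarrow> md j z = 0"
    and z0: "z0 \<in> ctri" "sqfun p q (L z0) \<noteq> 0" "cos (fst (L z0) / 2) = 0"
    and fin: "finite (nodal_domains tri (\<lambda>z. \<Sum>j\<in>level \<mu>. a j * md j z))"
  shows "card (nodal_domains tri (\<lambda>z. \<Sum>j\<in>level \<mu>. a j * md j z)) \<le> card (low \<mu>)"
proof -
  define e where "e z = sqfun p q (L z)" for z
  define h11 where "h11 z = \<alpha> * (\<alpha> * sqfun11 p q (L z) + \<gamma> * sqfun12 p q (L z)) + \<gamma> * (\<alpha> * sqfun12 p q (L z) + \<gamma> * sqfun22 p q (L z))" for z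
  define h22 where "h22 z = \<beta> * (\<beta> * sqfun11 p q (L z) + \<delta> * sqfun12 p q (L z)) + \<delta> * (\<beta> * sqfun12 p q (L z) + \<delta> * sqfun22 p q (L z))" for z
  have K0: "0 \<le> K" using rows(1) by (metis add_nonneg_nonneg zero_le_power2)
  have \<mu>0: "0 \<le> \<mu>" using K0 by (simp add: \<mu>)
  have cL: "continuous_on A L" for A unfolding L_def by (intro continuous_intros)
  have Lb: "L \<in> borel_measurable borel" by (intro borel_measurable_continuous_onI cL)
  have bL: "bmeas (\<lambda>z. f (L z))" if "f \<in> borel_measurable borel" "\<And>z. \<bar>f z\<bar> \<le> B" for f :: "real \<times> real \<Rightarrow> real" and B
    by (rule bmeas_bounded_borel[OF measurable_compose[OF Lb that(1)] that(2)])
  note bs = bL[OF borel_sqfun(1) sqfun_bounded(1), of p q] bL[OF borel_sqfun(2) sqfun_bounded(2), of p q] bL[OF borel_sqfun(3) sqfun_bounded(3), of p q]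
    bL[OF borel_sqfun(4) sqfun_bounded(4), of p q] bL[OF borel_sqfun(5) sqfun_bounded(5), of p q] bL[OF borel_sqfun(6) sqfun_bounded(6), of p q]
  have be: "bmeas e" "bmeas e1" "bmeas e2" "bmeas h11" "bmeas h22"
    unfolding e_def e1_def e2_def h11_def h22_def by (intro bmeas_add bmeas_mult bmeas_const bs)+
  have ce: "continuous_on A e" for A
    unfolding e_def by (rule continuous_on_compose2[OF continuous_sqfun cL]) auto
  have laplace: "h11 z + h22 z = - \<mu> * e z" for z
  proof -
    have "h11 z + h22 z = (\<alpha>\<^sup>2 + \<beta>\<^sup>2) * sqfun11 p q (L z) + 2 * (\<alpha> * \<gamma> + \<beta> * \<delta>) * sqfun12 p q (L z) + (\<gamma>\<^sup>2 + \<delta>\<^sup>2) * sqfun22 p q (L z)"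
      by (simp add: h11_def h22_def power2_eq_square algebra_simps)
    also have "\<dots> = K * (sqfun11 p q (L z) + sqfun22 p q (L z))" unfolding rows by (simp add: algebra_simps)
    finally show ?thesis unfolding sqfun_laplace by (simp add: \<mu> e_def algebra_simps)
  qed
  \<comment> \<open>The crossings of a horizontal line with the kinks. The guards leave out kinks
    parallel to the line, which could contain all of it; along them nothing has to be
    excluded.\<close>
  define S where "S y = {x. 0 \<le> x \<and> x \<le> pi \<and> (\<alpha> \<noteq> 0 \<and> cos ((\<alpha> * x + \<beta> * y) / 2) = 0 \<or> \<gamma> \<noteq> 0 \<and> cos ((\<gamma> * x + \<delta> * y) / 2) = 0)}" for y
  define S' where "S' x = {y. 0 \<le> y \<and> y \<le> pi \<and> (\<beta> \<noteq> 0 \<and> cos ((\<beta> * y + \<alpha> * x) / 2) = 0 \<or> \<delta> \<noteq> 0 \<and> cos ((\<delta> * y + \<gamma> * x) / 2) = 0)}" for x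
  have fz: "finite {x. 0 \<le> x \<and> x \<le> pi \<and> k \<noteq> 0 \<and> cos ((k * x + l) / 2) = 0}" for k l :: real
  proof (cases "k = 0")
    case False
    then show ?thesis using finite_cos_zeros[of "k / 2" "l / 2"] by (simp add: add_divide_distrib)
  qed simp
  have fS: "finite (S y)" "finite (S' y)" for y
  proof -
    have "S y = {x. 0 \<le> x \<and> x \<le> pi \<and> \<alpha> \<noteq> 0 \<and> cos ((\<alpha> * x + \<beta> * y) / 2) = 0} \<union> {x. 0 \<le> x \<and> x \<le> pi \<and> \<gamma> \<noteq> 0 \<and> cos ((\<gamma> * x + \<delta> * y) / 2) = 0}"
      "S' y = {x. 0 \<le> x \<and> x \<le> pi \<and> \<beta> \<noteq> 0 \<and> cos ((\<beta> * x + \<alpha> * y) / 2) = 0} \<union> {x. 0 \<le> x \<and> x \<le> pi \<and> \<delta> \<noteq> 0 \<and> cos ((\<delta> * x + \<gamma> * y) / 2) = 0}"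
      unfolding S_def S'_def by blast+
    then show "finite (S y)" "finite (S' y)" by (simp_all only: finite_Un fz simp_thms)
  qed
  have dx: "((\<lambda>x. e (x, y)) has_real_derivative e1 (x, y)) (at x)" "((\<lambda>x. e1 (x, y)) has_real_derivative h11 (x, y)) (at x)"
    if "0 < y" "y < x" "x < pi" "x \<notin> S y" for x y
  proof -
    have c: "\<alpha> = 0 \<or> cos ((\<alpha> * x + \<beta> * y) / 2) \<noteq> 0" "\<gamma> = 0 \<or> cos ((\<gamma> * x + \<delta> * y) / 2) \<noteq> 0"
      using that unfolding S_def by auto
    note d = DERIV_sqfun_line[OF c, of p q]
    show "((\<lambda>x. e (x, y)) has_real_derivative e1 (x, y)) (at x)" using d(1) by (simp add: e_def e1_def L_def)
    show "((\<lambda>x. e1 (x, y)) has_real_derivative h11 (x, y)) (at x)"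
      using DERIV_add[OF DERIV_cmult[OF d(2), of \<alpha>] DERIV_cmult[OF d(3), of \<gamma>]] by (simp add: e1_def h11_def L_def)
  qed
  have dy: "((\<lambda>y. e (x, y)) has_real_derivative e2 (x, y)) (at y)" "((\<lambda>y. e2 (x, y)) has_real_derivative h22 (x, y)) (at y)"
    if "0 < y" "y < x" "x < pi" "y \<notin> S' x" for x y
  proof -
    have c: "\<beta> = 0 \<or> cos ((\<beta> * y + \<alpha> * x) / 2) \<noteq> 0" "\<delta> = 0 \<or> cos ((\<delta> * y + \<gamma> * x) / 2) \<noteq> 0"
      using that unfolding S'_def by auto
    note d = DERIV_sqfun_line[OF c, of p q]
    show "((\<lambda>y. e (x, y)) has_real_derivative e2 (x, y)) (at y)" using d(1) by (simp add: e_def e2_def L_def add.commute)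
    show "((\<lambda>y. e2 (x, y)) has_real_derivative h22 (x, y)) (at y)"
      using DERIV_add[OF DERIV_cmult[OF d(2), of \<beta>] DERIV_cmult[OF d(3), of \<delta>]] by (simp add: e2_def h22_def L_def add.commute)
  qed
  have lines: "continuous_on {y..pi} (\<lambda>x. f (x, y))" if "continuous_on ctri f" "0 \<le> y" for f :: "real \<times> real \<Rightarrow> real" and y
    by (rule continuous_on_compose2[OF that(1)]) (use that(2) in \<open>auto intro!: continuous_intros\<close>)
  have lines': "continuous_on {0..x} (\<lambda>y. f (x, y))" if "continuous_on ctri f" "x \<le> pi" for f :: "real \<times> real \<Rightarrow> real" and x
    by (rule continuous_on_compose2[OF that(1)]) (use that(2) in \<open>auto intro!: continuous_intros\<close>)
  \<comment> \<open>Here the kinked function is the scalar factor and the field is the smooth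
    gradient of a mode. As \<open>e\<close> is continuous, its kinks leave no boundary
    terms.\<close>
  have mg: "mode_green e e1 e2"
    unfolding mode_green_def
  proof (intro conjI allI be(1-3))
    fix j
    have "tint (\<lambda>z. e1 z * md1 j z + e2 z * md2 j z) = - tint (\<lambda>z. e z * (md11 j z + md22 j z))"
    proof (rule triangle_green[where S = S and S' = S'])
      show "continuous_on {y..pi} (\<lambda>x. e (x, y) * md1 j (x, y))" if "0 \<le> y" for y
        using that by (intro lines[of "\<lambda>z. e z * md1 j z"] continuous_on_mult ce continuous_md)
      show "continuous_on {0..x} (\<lambda>y. e (x, y) * md2 j (x, y))" if "x \<le> pi" for x
        using that by (intro lines'[of "\<lambda>z. e z * md2 j z"] continuous_on_mult ce continuous_md)
    qed (auto intro!: fS dx dy DERIV_md be bmeas_md simp: md_boundary)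
    also have "\<dots> = ev j * tint (\<lambda>z. e z * md j z)"
      unfolding md_laplace tint_minus[symmetric] tint_cmult[symmetric] by (intro arg_cong[where f = tint]) (auto simp: mult_ac)
    finally show "tint (\<lambda>z. e1 z * md1 j z + e2 z * md2 j z) = ev j * tint (\<lambda>z. e z * md j z)" .
  qed
  show ?thesis
  proof (rule courant_filonov[OF \<mu>0 ce mg _ _ z0(1) _ _ fin])
    show "e z0 \<noteq> 0" using z0(2) by (simp add: e_def)
    show "md j z0 = 0" if "j \<in> level \<mu>" for j using grid[OF z0(1) _ that] z0(3) by blast
  next
    have "tint (\<lambda>z. (e1 z)\<^sup>2 + (e2 z)\<^sup>2) - \<mu> * tint (\<lambda>z. (e z)\<^sup>2) = tint (\<lambda>z. ((e1 z)\<^sup>2 + (e2 z)\<^sup>2) - \<mu> * (e z)\<^sup>2)"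
      unfolding tint_cmult[symmetric] by (rule tint_diff[symmetric]) (intro bmeas_intros be)+
    also have "\<dots> = tint (\<lambda>z. K * ((sqfun1 p q (L z))\<^sup>2 + (sqfun2 p q (L z))\<^sup>2 - (p\<^sup>2 + q\<^sup>2) * (sqfun p q (L z))\<^sup>2))"
    proof (rule tint_cong)
      fix z
      define A B C where "A = sqfun1 p q (L z)" and "B = sqfun2 p q (L z)" and "C = sqfun p q (L z)"
      have "(\<alpha> * A + \<gamma> * B)\<^sup>2 + (\<beta> * A + \<delta> * B)\<^sup>2 = (\<alpha>\<^sup>2 + \<beta>\<^sup>2) * A\<^sup>2 + (\<gamma>\<^sup>2 + \<delta>\<^sup>2) * B\<^sup>2 + 2 * (\<alpha> * \<gamma> + \<beta> * \<delta>) * (A * B)"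
        by (simp add: power2_eq_square algebra_simps)
      also have "\<dots> = K * (A\<^sup>2 + B\<^sup>2)" unfolding rows by (simp add: algebra_simps)
      finally show "(e1 z)\<^sup>2 + (e2 z)\<^sup>2 - \<mu> * (e z)\<^sup>2 = K * ((sqfun1 p q (L z))\<^sup>2 + (sqfun2 p q (L z))\<^sup>2 - (p\<^sup>2 + q\<^sup>2) * (sqfun p q (L z))\<^sup>2)"
        by (simp add: e1_def e2_def e_def \<mu> A_def B_def right_diff_distrib)
    qed
    also have "\<dots> \<le> 0" unfolding tint_cmult using K0 en by (simp add: mult_nonneg_nonpos)
    finally show "tint (\<lambda>z. (e1 z)\<^sup>2 + (e2 z)\<^sup>2) \<le> \<mu> * tint (\<lambda>z. (e z)\<^sup>2)" by simp
  next
    fix w w1 w2 assume nt: "nodal_test (\<lambda>z. \<Sum>j\<in>level \<mu>. a j * md j z) w w1 w2"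
    then have w: "continuous_on ctri w" "continuous_on ctri w1" "continuous_on ctri w2"
      "\<And>x y. (x, y) \<in> tri \<Longrightarrow> ((\<lambda>x. w (x, y)) has_real_derivative w1 (x, y)) (at x)"
      "\<And>x y. (x, y) \<in> tri \<Longrightarrow> ((\<lambda>y. w (x, y)) has_real_derivative w2 (x, y)) (at y)"
      "\<And>z. z \<in> ctri \<Longrightarrow> (\<Sum>j\<in>level \<mu>. a j * md j z) = 0 \<Longrightarrow> w z = 0"
      unfolding nodal_test_def by blast+
    \<comment> \<open>Now the field is the jumping gradient of \<open>e\<close>, and the products
      are continuous because the nodal test function \<open>w\<close> vanishes on the grid.\<close>
    have "continuous_on ctri (\<lambda>z. w z * (k * sqfun1 p q (L z) + l * sqfun2 p q (L z)))" for k l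
    proof (rule continuous_on_mult_sqfun[OF w(1) cL])
      show "w z = 0" if "z \<in> ctri" "cos (fst (L z) / 2) = 0 \<or> cos (snd (L z) / 2) = 0" for z
        using grid[OF that] by (intro w(6) that(1)) simp
    qed
    then have we: "continuous_on ctri (\<lambda>z. w z * e1 z)" "continuous_on ctri (\<lambda>z. w z * e2 z)"
      unfolding e1_def e2_def by blast+
    have bw: "bmeas w" "bmeas w1" "bmeas w2" using w by (auto intro: bmeas_continuous)
    have "tint (\<lambda>z. w1 z * e1 z + w2 z * e2 z) = - tint (\<lambda>z. w z * (h11 z + h22 z))"
      by (rule triangle_green[where S = S and S' = S'])
         (use w(4,5) lines[OF we(1)] lines'[OF we(2)] bc in \<open>auto intro!: fS dx dy be bw\<close>)
    also have "\<dots> = \<mu> * tint (\<lambda>z. w z * e z)"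
      unfolding laplace tint_minus[symmetric] tint_cmult[symmetric] by (intro arg_cong[where f = tint]) (auto simp: mult_ac)
    finally show "tint (\<lambda>z. w1 z * e1 z + w2 z * e2 z) = \<mu> * tint (\<lambda>z. w z * e z)" .
  qed
qed

section \<open>The common grid of zeros\<close>

lemma md_rot: "md (p + q, p - q) z = md (p, q) (rot z)"
proof -
  obtain x y where z: "z = (x, y)" by (cases z)
  show ?thesis
    unfolding z md_def rot_Pair prod.case of_int_add of_int_diff distrib_right left_diff_distrib distrib_left right_diff_distrib cos_add cos_diff
    by algebra
qed

text \<open>If \<open>m^2 + n^2\<close> is even, so is \<open>m + n\<close>; then
  \<open>md_rot\<close> with \<open>p = (m + n) / 2\<close> and \<open>q = (m - n) / 2\<close>
  halves the eigenvalue at the price of one \<open>rot\<close>.\<close>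

lemma md_fold:
  assumes "m\<^sup>2 + n\<^sup>2 = 2 ^ k * r"
  obtains p q where "p\<^sup>2 + q\<^sup>2 = r" "\<And>z. md (m, n) z = md (p, q) ((rot ^^ k) z)"
proof -
  have "\<exists>p q. p\<^sup>2 + q\<^sup>2 = r \<and> (\<forall>z. md (m, n) z = md (p, q) ((rot ^^ k) z))"
    using assms
  proof (induction k arbitrary: m n)
    case 0
    then show ?case by auto
  next
    case (Suc k)
    have "even (m\<^sup>2 + n\<^sup>2)" using Suc.prems by simp
    then have "even (m + n)" by simp
    then obtain p where p: "m + n = 2 * p" by (elim evenE)
    define q where "q = m - p"
    have mn: "m = p + q" "n = p - q" using p by (auto simp: q_def)
    have "2 * (p\<^sup>2 + q\<^sup>2) = 2 * (2 ^ k * r)"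
      using Suc.prems unfolding mn by (simp add: power2_eq_square algebra_simps)
    then have "p\<^sup>2 + q\<^sup>2 = 2 ^ k * r" by simp
    from Suc.IH[OF this] obtain p' q' where *: "p'\<^sup>2 + q'\<^sup>2 = r" "\<And>z. md (p, q) z = md (p', q') ((rot ^^ k) z)" by blast
    have "md (m, n) z = md (p', q') ((rot ^^ Suc k) z)" for z
      unfolding mn md_rot *(2) by (simp add: funpow_swap1)
    then show ?case using *(1) by blast
  qed
  then show ?thesis using that by blast
qed

text \<open>Where \<open>x + y\<close> or \<open>x - y\<close> is an odd multiple of
  \<open>pi\<close>, \<open>cos (j * x)\<close> equals \<open>cos (j * y)\<close> up to the sign
  \<open>(-1)^j\<close>. Exactly one of \<open>m\<close> and \<open>n\<close> is even, so the two
  summands of the mode cancel.\<close>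

lemma md_grid:
  assumes "odd (m\<^sup>2 + n\<^sup>2)" "cos (fst (rot z) / 2) = 0 \<or> cos (snd (rot z) / 2) = 0"
  shows "md (m, n) z = 0"
proof -
  obtain x y where z: "z = (x, y)" by (cases z)
  have c: "cos (of_int j * x) = (if even j then 1 else -1) * cos (of_int j * y)" for j
    using assms(2)
  proof
    assume "cos (fst (rot z) / 2) = 0"
    then obtain i where i: "odd i" "(x + y) / 2 = of_int i * (pi / 2)" unfolding cos_zero_iff_int z by auto
    then have x: "x = of_int i * pi - y" by simp
    have "of_int j * x = pi * of_int (j * i) - of_int j * y" unfolding x by (simp add: algebra_simps)
    then show ?thesis using i(1) by (simp only: cos_diff cos_npi_int sin_npi_int) simp
  next
    assume "cos (snd (rot z) / 2) = 0"
    then obtain i where i: "odd i" "(x - y) / 2 = of_int i * (pi / 2)" unfolding cos_zero_iff_int z by auto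
    then have x: "x = of_int i * pi + y" by simp
    have "of_int j * x = pi * of_int (j * i) + of_int j * y" unfolding x by (simp add: algebra_simps)
    then show ?thesis using i(1) by (simp only: cos_add cos_npi_int sin_npi_int) simp
  qed
  have "even m \<noteq> even n" using assms(1) by simp
  then show ?thesis unfolding z md_def prod.case c[of m] c[of n] by auto
qed

text \<open>The exponent is \<open>k + 1\<close>, not \<open>k\<close>: after \<open>k\<close> steps
  the eigenvalue is odd and its zero lines are diagonal, and one more \<open>rot\<close> turns them
  into the coordinate lines on which the folded cosines have their kinks.\<close>

lemma level_grid:
  fixes m :: nat
  assumes "odd m" "j \<in> level (2 ^ k * real m)" "cos (fst ((rot ^^ (k + 1)) z) / 2) = 0 \<or> cos (snd ((rot ^^ (k + 1)) z) / 2) = 0"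
  shows "md j z = 0"
proof -
  obtain a b where j: "j = (a, b)" by (cases j)
  have "real_of_int (a\<^sup>2 + b\<^sup>2) = of_int (2 ^ k * int m)" using assms(2) by (simp add: j level_def ev_def)
  then have "a\<^sup>2 + b\<^sup>2 = 2 ^ k * int m" by (simp only: of_int_eq_iff)
  then obtain p q where pq: "p\<^sup>2 + q\<^sup>2 = int m" "\<And>z. md (a, b) z = md (p, q) ((rot ^^ k) z)" by (rule md_fold) blast
  have "md (p, q) ((rot ^^ k) z) = 0"
    using assms(1,3) pq(1) by (intro md_grid) auto
  then show ?thesis using pq(2) j by simp
qed

section \<open>Choice of the two frequencies\<close>

text \<open>Modulo \<open>pi\<close>, the angle \<open>p * pi\<close> lies in
  \<open>[0, pi / 2)\<close>, and the product of sine and cosine has period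
  \<open>pi\<close>.\<close>

lemma frac_lt_half:
  fixes p :: real
  assumes "of_int n \<le> p" "p < of_int n + 1 / 2"
  shows "0 \<le> sin (p * pi) * cos (p * pi)" "cos (p * pi) \<noteq> 0"
proof -
  define f where "f = p - of_int n"
  have f: "0 \<le> f" "f < 1 / 2" using assms by (auto simp: f_def)
  have p: "p * pi = pi * of_int n + f * pi" by (simp add: f_def algebra_simps)
  have c: "0 < cos (f * pi)" using f by (intro cos_gt_zero_pi) (auto intro: less_le_trans[of _ 0])
  have s: "0 \<le> sin (f * pi)" using f by (intro sin_ge_zero) auto
  show "cos (p * pi) \<noteq> 0" unfolding p cos_add using c by simp
  show "0 \<le> sin (p * pi) * cos (p * pi)" unfolding p cos_add sin_add using c s by simp
qed

text \<open>\<open>(p, q)\<close> lies on the circle of radius \<open>sqrt (m / 2)\<close>: the arc above the diagonal is followed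
  until it enters a square \<open>[j, j + 1/2] \<times> [n, n + 1/2]\<close> through its left or upper side.\<close>

lemma extra_frequencies:
  fixes m :: nat
  assumes "odd m" "3 \<le> m"
  obtains p q :: real where "0 \<le> p" "0 \<le> q" "p\<^sup>2 + q\<^sup>2 = m / 2" "cos (p * pi) \<noteq> 0" "0 \<le> sin (p * pi) * cos (p * pi)"
    "sin (q * pi) = 0 \<and> q < p \<or> cos (q * pi) = 0 \<and> p < q"
proof -
  define R where "R = sqrt (m / 2)"
  define n where "n = \<lfloor>R\<rfloor>"
  have R2: "R\<^sup>2 = m / 2" by (simp add: R_def)
  have Rge: "1 \<le> R" using assms by (simp add: R_def)
  have n: "of_int n \<le> R" "R < of_int n + 1" by (auto simp: n_def)
  have n1: "1 \<le> n" unfolding n_def using Rge by (simp add: le_floor_iff)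
  show ?thesis
  proof (cases "R < of_int n + 1 / 2")
    case True
    show ?thesis
      using frac_lt_half[OF n(1) True] Rge R2 by (intro that[of R 0]) auto
  next
    case False
    define y where "y = real_of_int n + 1 / 2"
    have y: "y \<le> R" "0 < y" using False n1 by (auto simp: y_def)
    define x where "x = sqrt (R\<^sup>2 - y\<^sup>2)"
    have yR: "y\<^sup>2 \<le> R\<^sup>2" by (rule power_mono[OF y(1) less_imp_le[OF y(2)]])
    have x0: "0 \<le> x" unfolding x_def by (rule real_sqrt_ge_zero) (simp only: diff_ge_0_iff_ge yR)
    have x2: "x\<^sup>2 = R\<^sup>2 - y\<^sup>2"
      unfolding x_def by (rule real_sqrt_pow2) (simp only: diff_ge_0_iff_ge yR)
    \<comment> \<open>Puts \<open>(x, y)\<close> above the diagonal. The estimate needs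
      \<open>1 \<le> n\<close>, which is where \<open>3 \<le> m\<close> enters.\<close>
    have "R\<^sup>2 < 2 * y\<^sup>2"
    proof -
      have "R\<^sup>2 < (of_int n + 1)\<^sup>2" using n(2) Rge by (intro power_strict_mono) auto
      also have "\<dots> \<le> 2 * y\<^sup>2"
      proof -
        have "1 \<le> real_of_int n * real_of_int n" using n1 by (metis mult_mono' of_int_1_le_iff mult_1 zero_le_one)
        moreover have "2 * y\<^sup>2 = 2 * (real_of_int n * of_int n) + 2 * of_int n + 1 / 2"
          by (simp add: y_def power2_eq_square field_simps)
        moreover have "(real_of_int n + 1)\<^sup>2 = real_of_int n * of_int n + 2 * of_int n + 1"
          by (simp add: power2_eq_square algebra_simps)
        ultimately show ?thesis by linarith
      qed
      finally show ?thesis .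
    qed
    then have xy: "x < y" using x2 y by (intro power_less_imp_less_base[of x 2 y]) auto
    have cy: "cos (y * pi) = 0"
    proof -
      have "y * pi = pi * of_int n + pi / 2" by (simp add: y_def algebra_simps)
      then show ?thesis by (simp add: cos_add)
    qed
    define j where "j = \<lfloor>x\<rfloor>"
    have j: "of_int j \<le> x" "x < of_int j + 1" by (auto simp: j_def)
    show ?thesis
    proof (cases "x < of_int j + 1 / 2")
      case True
      show ?thesis
        using frac_lt_half[OF j(1) True] x0 y x2 R2 cy xy by (intro that[of x y]) auto
    next
      case jF: False
      \<comment> \<open>The arc leaves the strip between two squares through the left side
        \<open>j + 1\<close> of the next one. The coordinates change names, because \<open>q\<close>
        is the frequency that satisfies a boundary condition at \<open>pi\<close>.\<close>
      define q where "q = real_of_int (j + 1)"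
      define p where "p = sqrt (R\<^sup>2 - q\<^sup>2)"
      have "real_of_int j < of_int n" using jF xy by (simp add: y_def)
      then have jn: "j + 1 \<le> n" by simp
      have j0: "0 \<le> j" using x0 by (simp add: j_def)
      have q0: "0 \<le> q" using j0 by (simp add: q_def)
      have qn: "q \<le> of_int n" using jn unfolding q_def by (simp only: of_int_le_iff)
      have qx: "q\<^sup>2 - x\<^sup>2 \<le> of_int j + 3 / 4"
      proof -
        have "(of_int j + 1 / 2)\<^sup>2 \<le> x\<^sup>2" using jF j0 by (intro power_mono) auto
        moreover have "(real_of_int j + 1 / 2)\<^sup>2 = of_int j * of_int j + of_int j + 1 / 4"
          by (simp add: power2_eq_square field_simps)
        moreover have "q\<^sup>2 = of_int j * of_int j + 2 * of_int j + 1"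
          by (simp add: q_def power2_eq_square algebra_simps)
        ultimately show ?thesis by linarith
      qed
      have yn: "y\<^sup>2 = (of_int n)\<^sup>2 + of_int n + 1 / 4" by (simp add: y_def power2_eq_square field_simps)
      have lower: "(of_int n)\<^sup>2 \<le> R\<^sup>2 - q\<^sup>2"
        using x2 qx yn qn by (simp add: q_def)
      then have p2: "p\<^sup>2 = R\<^sup>2 - q\<^sup>2" unfolding p_def by (intro real_sqrt_pow2) (meson order_trans zero_le_power2)
      have p0: "0 \<le> p" unfolding p_def using lower by (meson order_trans real_sqrt_ge_zero zero_le_power2)
      have pn: "of_int n \<le> p" using lower p0 unfolding p2[symmetric] by (rule power2_le_imp_le)
      have "x < q" using j by (simp add: q_def)
      then have "x\<^sup>2 < q\<^sup>2" using x0 by (intro power_strict_mono) auto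
      then have "p\<^sup>2 < y\<^sup>2" using p2 x2 by simp
      then have py: "p < of_int n + 1 / 2" using y p0 unfolding y_def[symmetric] by (intro power_less_imp_less_base[of p 2 y]) auto
      \<comment> \<open>On the diagonal, \<open>m / 2 = 2 * q^2\<close> would force \<open>m\<close>
        to be even.\<close>
      have "q \<noteq> p"
      proof
        assume "q = p"
        then have "real m = of_int (4 * (j + 1)\<^sup>2)" using p2 R2 by (simp add: q_def)
        then have "int m = 4 * (j + 1)\<^sup>2" by (metis of_int_eq_iff of_int_of_nat_eq)
        then have "even (int m)" by simp
        then show False using assms(1) by simp
      qed
      then have qp: "q < p" using qn pn by simp
      have "sin (q * pi) = 0" unfolding q_def by (rule sin_of_int_pi)
      then show ?thesis
        using frac_lt_half[OF pn py] p0 q0 p2 R2 qp by (intro that[of p q]) auto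
    qed
  qed
qed

section \<open>Nodal domains for powers of two\<close>

text \<open>The test function is \<open>sqfun p q\<close> after \<open>k + 1\<close> applications of
  \<open>rot\<close>, which multiply the eigenvalue by \<open>2 ^ (k + 1)\<close>; this is the
  origin of \<open>p^2 + q^2 = m / 2\<close>. For even \<open>k\<close> the composed map is a
  multiple of \<open>rot\<close>, for odd \<open>k\<close> a multiple of the identity.\<close>

lemma nodal_count_odd_part:
  fixes m k :: nat and a :: "int \<times> int \<Rightarrow> real"
  defines "\<mu> \<equiv> 2 ^ k * real m"
  assumes m: "odd m" "3 \<le> m"
    and fin: "finite (nodal_domains tri (\<lambda>z. \<Sum>j\<in>level \<mu>. a j * md j z))"
  shows "card (nodal_domains tri (\<lambda>z. \<Sum>j\<in>level \<mu>. a j * md j z)) \<le> card (low \<mu>)"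
proof -
  obtain p q where pq: "0 \<le> p" "0 \<le> q" "p\<^sup>2 + q\<^sup>2 = m / 2" "cos (p * pi) \<noteq> 0" "0 \<le> sin (p * pi) * cos (p * pi)"
    "sin (q * pi) = 0 \<and> q < p \<or> cos (q * pi) = 0 \<and> p < q" using extra_frequencies[OF m] by blast
  have energy: "tint (\<lambda>z. (sqfun1 p q ((rot ^^ (k + 1)) z))\<^sup>2 + (sqfun2 p q ((rot ^^ (k + 1)) z))\<^sup>2 - (p\<^sup>2 + q\<^sup>2) * (sqfun p q ((rot ^^ (k + 1)) z))\<^sup>2) \<le> 0"
    unfolding tint_rot_funpow[OF reflective_sqfun_energy] by (rule sqfun_energy[OF pq(6,1,2,5)])
  \<comment> \<open>Corners of the square on a kink line. The values of \<open>sqfun\<close> are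
    \<open>2 * cos (p * pi) * cos (q * pi)\<close> at \<open>(pi, pi)\<close> and
    \<open>cos (p * pi) + cos (q * pi)\<close> at \<open>(pi, 0)\<close>; the condition on
    \<open>q\<close> decides which one is certainly nonzero. \<open>z0\<close> will be a preimage of
    \<open>w\<close>.\<close>
  obtain w where w: "w = (pi, pi) \<or> w = (pi, 0)" "sqfun p q w \<noteq> 0"
  proof (cases "sin (q * pi) = 0")
    case True
    then have "cos (q * pi) \<noteq> 0" using sin_cos_squared_add[of "q * pi"] by auto
    then show ?thesis using pq(4) by (intro that[of "(pi, pi)"]) (auto simp: sqfun_def cper_pi)
  next
    case False
    then have "cos (q * pi) = 0" using pq(6) by simp
    then show ?thesis using pq(4) by (intro that[of "(pi, 0)"]) (auto simp: sqfun_def cper_pi)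
  qed
  show ?thesis
  proof (cases "even k")
    case True
    then obtain i where k: "k = 2 * i" by (elim evenE)
    define M :: real where "M = 2 ^ i"
    have M: "1 \<le> M" by (simp add: M_def)
    have L: "(M * fst z + M * snd z, M * fst z + - M * snd z) = (rot ^^ (k + 1)) z" for z
      by (cases z) (simp only: k rot_funpow, simp add: M_def algebra_simps)
    obtain z0 where z0: "z0 \<in> ctri" "(rot ^^ (k + 1)) z0 = w"
      using w(1)
    proof
      assume "w = (pi, pi)"
      then show ?thesis using M L[of "(pi / M, 0)"] by (intro that[of "(pi / M, 0)"]) (auto simp: field_simps)
    next
      assume "w = (pi, 0)"
      then show ?thesis using M L[of "(pi / (2 * M), pi / (2 * M))"]
        by (intro that[of "(pi / (2 * M), pi / (2 * M))"]) (auto simp: field_simps)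
    qed
    \<comment> \<open>The side \<open>x = pi\<close> is mapped to points whose two coordinates are
      negatives of each other modulo \<open>2 * pi\<close>; therefore the two terms of the normal
      derivative cancel there.\<close>
    have refl: "cper r (M * pi + M * t) = cper r (M * pi - M * t)" "sper r (M * pi + M * t) = - sper r (M * pi - M * t)" for r t
    proof -
      have "M * pi + M * t = - (M * pi - M * t) + of_int (2 ^ i) * (2 * pi)" by (simp add: M_def algebra_simps)
      then show "cper r (M * pi + M * t) = cper r (M * pi - M * t)" "sper r (M * pi + M * t) = - sper r (M * pi - M * t)"
        by (simp_all only: per_periodic per_uminus)
    qed
    show ?thesis
    proof (rule extra_function_bound[where \<alpha> = M and \<beta> = M and \<gamma> = M and \<delta> = "- M" and K = "2 * M\<^sup>2" and p = p and q = q and ?z0.0 = z0, unfolded L, OF _ _ _ _ _ _ _ energy _ z0(1) _ _ fin])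
      show "\<mu> = 2 * M\<^sup>2 * (p\<^sup>2 + q\<^sup>2)" unfolding pq(3) by (simp add: \<mu>_def k M_def power_mult power2_eq_square power_mult_distrib[symmetric])
      fix t
      show "M * sqfun1 p q ((rot ^^ (k + 1)) (pi, t)) + M * sqfun2 p q ((rot ^^ (k + 1)) (pi, t)) = 0"
        unfolding L[symmetric] by (simp add: sqfun1_def sqfun2_def refl algebra_simps)
      show "M * sqfun1 p q ((rot ^^ (k + 1)) (t, 0)) + - M * sqfun2 p q ((rot ^^ (k + 1)) (t, 0)) = 0"
        unfolding L[symmetric] by (simp add: sqfun1_def sqfun2_def algebra_simps)
      show "M * sqfun1 p q ((rot ^^ (k + 1)) (t, t)) + M * sqfun2 p q ((rot ^^ (k + 1)) (t, t)) =
          M * sqfun1 p q ((rot ^^ (k + 1)) (t, t)) + - M * sqfun2 p q ((rot ^^ (k + 1)) (t, t))"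
        unfolding L[symmetric] by (simp add: sqfun2_def sper_eq_0)
    qed (use w z0 level_grid[OF m(1)] in \<open>auto simp: \<mu>_def power2_eq_square\<close>)
  next
    case False
    then obtain i where k: "k = 2 * i + 1" by (elim oddE)
    define M :: real where "M = 2 ^ (i + 1)"
    have M: "1 \<le> M" unfolding M_def by (rule one_le_power) simp
    have L: "(M * fst z + 0 * snd z, 0 * fst z + M * snd z) = (rot ^^ (k + 1)) z" for z
    proof -
      have "k + 1 = 2 * (i + 1)" by (simp add: k)
      then show ?thesis by (cases z) (simp only: rot_funpow M_def, simp)
    qed
    obtain z0 where z0: "z0 \<in> ctri" "(rot ^^ (k + 1)) z0 = w"
      using w(1)
    proof
      assume "w = (pi, pi)"
      then show ?thesis using M L[of "(pi / M, pi / M)"] by (intro that[of "(pi / M, pi / M)"]) (auto simp: field_simps)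
    next
      assume "w = (pi, 0)"
      then show ?thesis using M L[of "(pi / M, 0)"] by (intro that[of "(pi / M, 0)"]) (auto simp: field_simps)
    qed
    have s0: "sper r (M * pi) = 0" for r
      using sin_of_int_pi[of "2 ^ (i + 1)"] by (intro sper_eq_0) (simp add: M_def)
    show ?thesis
    proof (rule extra_function_bound[where \<alpha> = M and \<beta> = 0 and \<gamma> = 0 and \<delta> = M and K = "M\<^sup>2" and p = p and q = q and ?z0.0 = z0, unfolded L, OF _ _ _ _ _ _ _ energy _ z0(1) _ _ fin])
      show "\<mu> = M\<^sup>2 * (p\<^sup>2 + q\<^sup>2)" unfolding pq(3) by (simp add: \<mu>_def k M_def power_mult power2_eq_square power_mult_distrib[symmetric])
      fix t
      show "M * sqfun1 p q ((rot ^^ (k + 1)) (pi, t)) + 0 * sqfun2 p q ((rot ^^ (k + 1)) (pi, t)) = 0"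
        unfolding L[symmetric] by (simp add: sqfun1_def s0)
      show "0 * sqfun1 p q ((rot ^^ (k + 1)) (t, 0)) + M * sqfun2 p q ((rot ^^ (k + 1)) (t, 0)) = 0"
        unfolding L[symmetric] by (simp add: sqfun2_def sper_eq_0)
      show "M * sqfun1 p q ((rot ^^ (k + 1)) (t, t)) + 0 * sqfun2 p q ((rot ^^ (k + 1)) (t, t)) =
          0 * sqfun1 p q ((rot ^^ (k + 1)) (t, t)) + M * sqfun2 p q ((rot ^^ (k + 1)) (t, t))"
        unfolding L[symmetric] by (simp add: sqfun1_def sqfun2_def algebra_simps)
    qed (use w z0 level_grid[OF m(1)] in \<open>auto simp: \<mu>_def power2_eq_square\<close>)
  qed
qed

section \<open>Counting the convex cells of the grid\<close>

text \<open>Each \<open>U i\<close> is connected and splits off from the union, since the remaining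
  sets also have an open union.\<close>

lemma components_disjoint_union:
  assumes U: "\<And>i. i \<in> X \<Longrightarrow> open (U i)" "\<And>i. i \<in> X \<Longrightarrow> connected (U i)" "\<And>i. i \<in> X \<Longrightarrow> U i \<noteq> {}"
    and disj: "\<And>i j. i \<in> X \<Longrightarrow> j \<in> X \<Longrightarrow> i \<noteq> j \<Longrightarrow> U i \<inter> U j = {}"
  shows "components (\<Union>i\<in>X. U i) = U ` X" "card (components (\<Union>i\<in>X. U i)) = card X"
proof -
  let ?S = "\<Union>i\<in>X. U i"
  have comp: "U i \<in> components ?S" if i: "i \<in> X" for i
    unfolding in_components_maximal
  proof (intro conjI allI impI)
    show "U i \<noteq> {}" "connected (U i)" "U i \<subseteq> ?S" using U i by auto
    fix d assume d: "d \<noteq> {} \<and> U i \<subseteq> d \<and> d \<subseteq> ?S \<and> connected d"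
    let ?V = "\<Union>j\<in>X - {i}. U j"
    have "open (U i)" "open ?V" using U i by auto
    moreover have "U i \<inter> ?V \<inter> d = {}" using disj i by blast
    moreover have "d \<subseteq> U i \<union> ?V" using d by blast
    moreover have "U i \<inter> d \<noteq> {}" using U(3)[OF i] d by blast
    ultimately have "?V \<inter> d = {}" using d unfolding connected_def by metis
    then show "d = U i" using d by blast
  qed
  show eq: "components ?S = U ` X"
  proof
    show "U ` X \<subseteq> components ?S" using comp by blast
    show "components ?S \<subseteq> U ` X"
    proof
      fix C assume C: "C \<in> components ?S"
      then obtain z where z: "z \<in> C" using in_components_nonempty by blast
      then obtain i where i: "i \<in> X" "z \<in> U i" using in_components_subset[OF C] by blast
      then have "C = U i" using components_nonoverlap[OF C comp[OF i(1)]] z by blast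
      then show "C \<in> U ` X" using i by blast
    qed
  qed
  have "inj_on U X" using disj U(3) by (intro inj_onI) (metis inf.idem)
  then show "card (components ?S) = card X" unfolding eq by (rule card_image)
qed

lemma abs_diff_less_iff_strip: "\<bar>t - c\<bar> < r \<longleftrightarrow> c - r < t \<and> t < c + r" for t c r :: real
  by arith

lemma cos_nonzero_iff_strip: "cos t \<noteq> 0 \<longleftrightarrow> (\<exists>i::int. \<bar>t - of_int i * pi\<bar> < pi / 2)"
proof
  assume c: "cos t \<noteq> 0"
  define i where "i = \<lfloor>t / pi + 1 / 2\<rfloor>"
  have "of_int i \<le> t / pi + 1 / 2" "t / pi + 1 / 2 < of_int i + 1" by (auto simp: i_def)
  then have *: "of_int i * pi - pi / 2 \<le> t" "t < of_int i * pi + pi / 2" by (auto simp: field_simps)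
  have "t \<noteq> of_int i * pi - pi / 2"
  proof
    assume t: "t = of_int i * pi - pi / 2"
    have "cos t = 0" unfolding t cos_diff by (simp add: sin_of_int_pi)
    then show False using c by simp
  qed
  then show "\<exists>i::int. \<bar>t - of_int i * pi\<bar> < pi / 2" using * unfolding abs_diff_less_iff_strip by (intro exI[of _ i]) linarith
next
  assume "\<exists>i::int. \<bar>t - of_int i * pi\<bar> < pi / 2"
  then obtain i :: int where i: "\<bar>t - of_int i * pi\<bar> < pi / 2" by blast
  then have c: "0 < cos (t - of_int i * pi)"
    unfolding abs_diff_less_iff_strip by (intro cos_gt_zero_pi) linarith+
  have "cos t = cos ((t - of_int i * pi) + pi * of_int i)" by (simp add: mult.commute)
  also have "\<dots> \<noteq> 0" unfolding cos_add using c by simp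
  finally show "cos t \<noteq> 0" .
qed

lemma pi_mult_le: "of_int a * pi < of_int b * pi + pi \<Longrightarrow> a \<le> b"
proof -
  assume "of_int a * pi < of_int b * pi + pi"
  then have "of_int a * pi < of_int (b + 1) * pi" by (simp add: distrib_right)
  then have "real_of_int a < of_int (b + 1)" using pi_gt_zero by (simp only: mult_less_cancel_right_pos)
  then show "a \<le> b" by linarith
qed

lemma pi_mult_nonneg: "0 < of_int b * pi + pi \<Longrightarrow> 0 \<le> b"
  using pi_mult_le[of 0 b] by simp

text \<open>A cell is the intersection of the triangle with two strips between consecutive zeros of
  the cosines, hence convex. Its centre is allowed to lie on the boundary of the triangle: the open
  intersection of the strips then still meets the interior, so the cell is nonempty.\<close>

lemma strip_cells:
  fixes A B :: "real \<times> real \<Rightarrow> real" and X :: "(int \<times> int) set"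
  assumes lin: "linear A" "linear B"
    and centre: "\<And>i j. (i, j) \<in> X \<Longrightarrow> \<exists>z\<in>ctri. A z = of_int i * pi \<and> B z = of_int j * pi"
    and cover: "\<And>z i j. z \<in> tri \<Longrightarrow> \<bar>A z - of_int i * pi\<bar> < pi / 2 \<Longrightarrow> \<bar>B z - of_int j * pi\<bar> < pi / 2 \<Longrightarrow> (i, j) \<in> X"
    and f: "\<And>z. z \<in> tri \<Longrightarrow> f z = 0 \<longleftrightarrow> cos (A z) * cos (B z) = 0"
  shows "card (nodal_domains tri f) = card X"
proof -
  define U where "U = (\<lambda>(i, j). tri \<inter> (A -` {of_int i * pi - pi / 2 <..< of_int i * pi + pi / 2} \<inter> B -` {of_int j * pi - pi / 2 <..< of_int j * pi + pi / 2}))"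
  have memU: "z \<in> U (i, j) \<longleftrightarrow> z \<in> tri \<and> \<bar>A z - of_int i * pi\<bar> < pi / 2 \<and> \<bar>B z - of_int j * pi\<bar> < pi / 2" for z i j
    unfolding U_def abs_diff_less_iff_strip by auto
  have cont: "continuous_on UNIV A" "continuous_on UNIV B" using lin by (auto intro: linear_continuous_on simp: linear_conv_bounded_linear)
  have open0: "open (A -` {a<..<b} \<inter> B -` {c<..<d})" for a b c d
    by (intro open_Int open_vimage cont) auto
  have "nodal_domains tri f = components (\<Union>x\<in>X. U x)"
    unfolding nodal_domains_def
  proof (rule arg_cong[where f = components], intro equalityI subsetI)
    fix z assume "z \<in> tri - f -` {0}"
    then have z: "z \<in> tri" "cos (A z) \<noteq> 0" "cos (B z) \<noteq> 0" using f[of z] by simp_all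
    obtain i where i: "\<bar>A z - of_int i * pi\<bar> < pi / 2" using z(2) cos_nonzero_iff_strip by blast
    obtain j where j: "\<bar>B z - of_int j * pi\<bar> < pi / 2" using z(3) cos_nonzero_iff_strip by blast
    have "z \<in> U (i, j)" unfolding memU using z(1) i j by simp
    then show "z \<in> (\<Union>x\<in>X. U x)" using cover[OF z(1) i j] by blast
  next
    fix z assume "z \<in> (\<Union>x\<in>X. U x)"
    then obtain i j where "(i, j) \<in> X" "z \<in> U (i, j)" by auto
    then show "z \<in> tri - f -` {0}" using f[of z] cos_nonzero_iff_strip[of "A z"] cos_nonzero_iff_strip[of "B z"] unfolding memU by auto
  qed
  also have "card \<dots> = card X"
  proof (rule components_disjoint_union(2))
    fix x assume x: "x \<in> X"
    obtain i j where ij: "x = (i, j)" by (cases x)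
    show "open (U x)" unfolding ij U_def prod.case by (intro open_Int open_tri open0)
    have "convex (U x)" unfolding ij U_def prod.case
      by (intro convex_Int convex_tri convex_linear_vimage lin convex_real_interval)
    then show "connected (U x)" by (rule convex_connected)
    obtain z where z: "z \<in> ctri" "A z = of_int i * pi" "B z = of_int j * pi" using centre x ij by blast
    define V where "V = A -` {of_int i * pi - pi / 2 <..< of_int i * pi + pi / 2} \<inter> B -` {of_int j * pi - pi / 2 <..< of_int j * pi + pi / 2}"
    have "open V" unfolding V_def by (rule open0)
    then have "V \<inter> closure tri \<subseteq> closure (V \<inter> tri)" by (rule open_Int_closure_subset)
    moreover have "z \<in> V \<inter> closure tri" using z by (simp add: V_def)
    ultimately have "z \<in> closure (V \<inter> tri)" by (rule subsetD)
    then have "V \<inter> tri \<noteq> {}" by (metis closure_empty empty_iff)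
    moreover have "U x = V \<inter> tri" unfolding ij U_def prod.case V_def by (rule Int_commute)
    ultimately show "U x \<noteq> {}" by simp
  next
    fix x y assume "x \<in> X" "y \<in> X" "x \<noteq> y"
    obtain i j where ij: "x = (i, j)" by (cases x)
    obtain k l where kl: "y = (k, l)" by (cases y)
    show "U x \<inter> U y = {}"
    proof (rule ccontr)
      assume "U x \<inter> U y \<noteq> {}"
      then obtain z where z: "z \<in> U (i, j)" "z \<in> U (k, l)" using ij kl by blast
      have "i \<le> k" "k \<le> i" "j \<le> l" "l \<le> j" by (rule pi_mult_le; use z[unfolded memU] in linarith)+
      then show False using \<open>x \<noteq> y\<close> ij kl by simp
    qed
  qed
  finally show ?thesis .
qed

text \<open>\<open>(i, j)\<close> labels the nodal cell centred at \<open>((i + j) * pi / L, (i - j) * pi / L)\<close> for the mode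
  \<open>(L, 0)\<close>, and at \<open>(i * pi / L, j * pi / L)\<close> for the mode \<open>(L, L)\<close>.\<close>

definition cells_even :: "int \<Rightarrow> (int \<times> int) set" where
  "cells_even L = Set.filter (\<lambda>(i, j). j \<le> i \<and> i + j \<le> L) ({0..L} \<times> {0..L})"

definition cells_odd :: "int \<Rightarrow> (int \<times> int) set" where
  "cells_odd L = Set.filter (\<lambda>(i, j). j \<le> i) ({0..L} \<times> {0..L})"

text \<open>After \<open>k\<close> folds the eigenvalue is 1, which leaves only
  \<open>cos x + cos y\<close>, a product of two cosines in the coordinates \<open>x + y\<close> and
  \<open>x - y\<close>.\<close>

lemma level_power_two:
  assumes "j \<in> level (2 ^ k)"
  shows "md j z = 2 * cos (fst ((rot ^^ (k + 1)) z) / 2) * cos (snd ((rot ^^ (k + 1)) z) / 2)"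
proof -
  obtain a b where j: "j = (a, b)" by (cases j)
  have "real_of_int (a\<^sup>2 + b\<^sup>2) = of_int (2 ^ k * 1)" using assms by (simp add: j level_def ev_def)
  then have "a\<^sup>2 + b\<^sup>2 = 2 ^ k * 1" by (simp only: of_int_eq_iff)
  then obtain p q where pq: "p\<^sup>2 + q\<^sup>2 = 1" "\<And>z. md (a, b) z = md (p, q) ((rot ^^ k) z)" by (rule md_fold) blast
  have "p = 0 \<or> q = 0"
  proof (rule ccontr)
    assume "\<not> (p = 0 \<or> q = 0)"
    then have "0 < p\<^sup>2" "0 < q\<^sup>2" by simp_all
    then show False using pq(1) by linarith
  qed
  then have "(\<bar>p\<bar> = 1 \<and> \<bar>q\<bar> = 0) \<or> (\<bar>p\<bar> = 0 \<and> \<bar>q\<bar> = 1)"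
    using pq(1) by (auto simp: power2_eq_1_iff)
  then have "md (p, q) = md (1, 0)"
    using md_abs[of p q] md_swap[of 0 1] by auto
  moreover have "md (1, 0) w = 2 * cos (fst (rot w) / 2) * cos (snd (rot w) / 2)" for w
  proof -
    obtain x y where w: "w = (x, y)" by (cases w)
    have "cos x + cos y = 2 * cos ((x + y) / 2) * cos ((x - y) / 2)" by (rule cos_plus_cos)
    then show ?thesis by (simp add: w md_def)
  qed
  ultimately show ?thesis using pq(2) by (simp add: j)
qed

text \<open>All modes of the level equal the same product, so a nonzero combination is a nonzero
  multiple of it and has the same nodal set.\<close>

lemma nodal_count_power_two:
  fixes a :: "int \<times> int \<Rightarrow> real"
  assumes f: "\<And>z. f z = (\<Sum>j\<in>level (2 ^ k). a j * md j z)" and nz: "f w \<noteq> 0"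
  shows "k = 2 * i \<Longrightarrow> card (nodal_domains tri f) = card (cells_even (2 ^ i))"
    and "k = 2 * i + 1 \<Longrightarrow> card (nodal_domains tri f) = card (cells_odd (2 ^ i))"
proof -
  define c where "c = (\<Sum>j\<in>level (2 ^ k). a j)"
  have fc: "f z = c * (2 * cos (fst ((rot ^^ (k + 1)) z) / 2) * cos (snd ((rot ^^ (k + 1)) z) / 2))" for z
    unfolding f c_def sum_distrib_right by (intro sum.cong refl) (simp add: level_power_two)
  have c0: "c \<noteq> 0" using nz fc[of w] by auto
  define M :: real where "M = 2 ^ i"
  have M: "0 < M" "real_of_int (2 ^ i) = M" by (simp_all add: M_def)
  { assume k: "k = 2 * i"
    have r: "(rot ^^ (k + 1)) z = (M * (fst z + snd z), M * (fst z - snd z))" for z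
      by (cases z) (simp only: k rot_funpow M_def fst_conv snd_conv)
    show "card (nodal_domains tri f) = card (cells_even (2 ^ i))"
    proof (rule strip_cells[where A = "\<lambda>z. M * (fst z + snd z) / 2" and B = "\<lambda>z. M * (fst z - snd z) / 2"])
      show "linear (\<lambda>z. M * (fst z + snd z) / 2)" "linear (\<lambda>z. M * (fst z - snd z) / 2)"
        by (auto intro!: linearI simp: algebra_simps add_divide_distrib diff_divide_distrib)
      show "f z = 0 \<longleftrightarrow> cos (M * (fst z + snd z) / 2) * cos (M * (fst z - snd z) / 2) = 0" for z
        unfolding fc r using c0 by simp
    next
      fix i' j' assume ij: "(i', j') \<in> cells_even (2 ^ i)"
      then have le: "0 \<le> j'" "j' \<le> i'" "real_of_int i' + of_int j' \<le> M"
        unfolding M(2)[symmetric] of_int_add[symmetric] of_int_le_iff by (auto simp: cells_even_def)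
      define z where "z = ((of_int i' + of_int j') * pi / M, (of_int i' - of_int j') * pi / M)"
      have "z \<in> ctri" using le M(1) by (auto simp: z_def divide_le_eq divide_right_mono mult.commute[of pi])
      moreover have "M * (fst z + snd z) / 2 = of_int i' * pi" "M * (fst z - snd z) / 2 = of_int j' * pi"
        using M(1) by (simp_all add: z_def field_simps)
      ultimately show "\<exists>z\<in>ctri. M * (fst z + snd z) / 2 = of_int i' * pi \<and> M * (fst z - snd z) / 2 = of_int j' * pi" by blast
    next
      fix z i' j' assume z: "z \<in> tri" and i: "\<bar>M * (fst z + snd z) / 2 - of_int i' * pi\<bar> < pi / 2" and j: "\<bar>M * (fst z - snd z) / 2 - of_int j' * pi\<bar> < pi / 2"
      obtain x y where xy: "z = (x, y)" by (cases z)
      have *: "0 < M * y" "M * y < M * x" "M * x < M * pi" using z M(1) by (auto simp: xy)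
      define A where "A = M * (x + y) / 2"
      define B where "B = M * (x - y) / 2"
      have "A + B = M * x" "A - B = M * y" by (simp_all add: A_def B_def field_simps)
      then have "0 < B" "B < A" "A + B < M * pi" using * by linarith+
      note * = this
      note ij = i[unfolded xy fst_conv snd_conv, folded A_def, unfolded abs_diff_less_iff_strip]
        j[unfolded xy fst_conv snd_conv, folded B_def, unfolded abs_diff_less_iff_strip]
      have "0 \<le> j'" by (rule pi_mult_nonneg) (use ij * pi_gt_zero in linarith)
      moreover have "j' \<le> i'" by (rule pi_mult_le) (use ij * pi_gt_zero in linarith)
      moreover have "i' + j' \<le> 2 ^ i"
      proof (rule pi_mult_le)
        have "of_int i' * pi + of_int j' * pi < M * pi + pi" using ij * pi_gt_zero by linarith
        then show "of_int (i' + j') * pi < of_int (2 ^ i) * pi + pi" unfolding M(2) by (simp add: distrib_right)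
      qed
      ultimately show "(i', j') \<in> cells_even (2 ^ i)" by (auto simp: cells_even_def)
    qed }
  { assume k: "k = 2 * i + 1"
    have r: "(rot ^^ (k + 1)) z = (2 * (M * fst z), 2 * (M * snd z))" for z
    proof -
      have "k + 1 = 2 * (i + 1)" by (simp add: k)
      then show ?thesis by (cases z) (simp only: rot_funpow M_def, simp)
    qed
    show "card (nodal_domains tri f) = card (cells_odd (2 ^ i))"
    proof (rule strip_cells[where A = "\<lambda>z. M * fst z" and B = "\<lambda>z. M * snd z"])
      show "linear (\<lambda>z. M * fst z)" "linear (\<lambda>z. M * snd z)"
        by (auto intro!: linearI simp: algebra_simps)
      show "f z = 0 \<longleftrightarrow> cos (M * fst z) * cos (M * snd z) = 0" for z
        unfolding fc r using c0 by simp
    next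
      fix i' j' assume ij: "(i', j') \<in> cells_odd (2 ^ i)"
      then have le: "0 \<le> j'" "j' \<le> i'" "real_of_int i' \<le> M"
        unfolding M(2)[symmetric] of_int_le_iff by (auto simp: cells_odd_def)
      define z where "z = (of_int i' * pi / M, of_int j' * pi / M)"
      have "z \<in> ctri" using le M(1) by (auto simp: z_def divide_le_eq divide_right_mono mult.commute[of pi])
      moreover have "M * fst z = of_int i' * pi" "M * snd z = of_int j' * pi"
        using M(1) by (simp_all add: z_def)
      ultimately show "\<exists>z\<in>ctri. M * fst z = of_int i' * pi \<and> M * snd z = of_int j' * pi" by blast
    next
      fix z i' j' assume z: "z \<in> tri" and i: "\<bar>M * fst z - of_int i' * pi\<bar> < pi / 2" and j: "\<bar>M * snd z - of_int j' * pi\<bar> < pi / 2"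
      obtain x y where xy: "z = (x, y)" by (cases z)
      have *: "0 < M * y" "M * y < M * x" "M * x < M * pi" using z M(1) by (auto simp: xy)
      note ij = i[unfolded xy fst_conv snd_conv] j[unfolded xy fst_conv snd_conv]
      have "0 \<le> j'" by (rule pi_mult_nonneg) (use ij * pi_gt_zero in linarith)
      moreover have "j' \<le> i'" by (rule pi_mult_le) (use ij * pi_gt_zero in linarith)
      moreover have "i' \<le> 2 ^ i"
        by (rule pi_mult_le) (unfold M(2), use ij * pi_gt_zero in linarith)
      ultimately show "(i', j') \<in> cells_odd (2 ^ i)" by (auto simp: cells_odd_def)
    qed }
qed

section \<open>Comparison of cells with lower modes, and the classification\<close>

lemma low_int_iff: "(i, j) \<in> low (of_int c) \<longleftrightarrow> 0 \<le> j \<and> j \<le> i \<and> i\<^sup>2 + j\<^sup>2 < c"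
  unfolding low_def modes_def ev_def by (auto simp flip: of_int_power of_int_add)

text \<open>The labels of the cells are themselves lower modes, because
  \<open>i^2 + j^2 \<le> (i + j)^2 \<le> L^2\<close>, with equality throughout only for
  \<open>(L, 0)\<close>. That label is exchanged for \<open>(h + 1, h)\<close>, which is no label as
  its entries add up to \<open>L + 1\<close>, and which lies below \<open>L^2\<close> once
  \<open>4 \<le> L\<close>.\<close>

lemma cells_even_le_low:
  assumes "4 \<le> L" "even L" shows "card (cells_even L) \<le> card (low (of_int (L\<^sup>2)))"
proof -
  obtain h where h: "L = 2 * h" using assms by (elim evenE)
  have h2: "2 \<le> h" using assms h by simp
  have fin: "finite (cells_even L)" by (simp add: cells_even_def)
  have sub: "insert (h + 1, h) (cells_even L - {(L, 0)}) \<subseteq> low (of_int (L\<^sup>2))"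
  proof
    fix x assume x: "x \<in> insert (h + 1, h) (cells_even L - {(L, 0)})"
    obtain i j where ij: "x = (i, j)" by (cases x)
    show "x \<in> low (of_int (L\<^sup>2))"
    proof (cases "x = (h + 1, h)")
      case True
      have "2 * h \<le> h * h" using h2 by (simp add: mult_right_mono)
      moreover have "(h + 1)\<^sup>2 + h\<^sup>2 = 2 * (h * h) + 2 * h + 1" "L\<^sup>2 = 4 * (h * h)"
        by (simp_all add: h power2_eq_square algebra_simps)
      ultimately have "(h + 1)\<^sup>2 + h\<^sup>2 < L\<^sup>2" using h2 by linarith
      then show ?thesis unfolding True low_int_iff using h2 by simp
    next
      case False
      then have c: "0 \<le> j" "j \<le> i" "i + j \<le> L" "(i, j) \<noteq> (L, 0)" using x ij by (auto simp: cells_even_def)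
      have "i\<^sup>2 + j\<^sup>2 < L\<^sup>2"
      proof (cases "j = 0")
        case True
        then have "i < L" using c by auto
        then show ?thesis using c True by (simp add: power_strict_mono)
      next
        case False
        then have "0 < 2 * (i * j)" using c by simp
        then have "i\<^sup>2 + j\<^sup>2 < (i + j)\<^sup>2" by (simp add: power2_eq_square algebra_simps)
        also have "\<dots> \<le> L\<^sup>2" using c by (intro power_mono) auto
        finally show ?thesis .
      qed
      then show ?thesis unfolding ij low_int_iff using c by simp
    qed
  qed
  have "card (cells_even L) \<le> card (insert (h + 1, h) (cells_even L - {(L, 0)}))"
    using fin by (subst card_insert_disjoint) (auto simp: cells_even_def h card_Diff_singleton_if)
  also have "\<dots> \<le> card (low (of_int (L\<^sup>2)))" by (rule card_mono[OF finite_low sub])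
  finally show ?thesis .
qed

text \<open>The same exchange: every label except \<open>(L, L)\<close> is a lower mode, and
  \<open>(L + 1, 0)\<close> takes its place, since \<open>(L + 1)^2 < 2 * L^2\<close> from
  \<open>L = 3\<close> on.\<close>

lemma cells_odd_le_low:
  assumes "3 \<le> L" shows "card (cells_odd L) \<le> card (low (of_int (2 * L\<^sup>2)))"
proof -
  have fin: "finite (cells_odd L)" by (simp add: cells_odd_def)
  have sub: "insert (L + 1, 0) (cells_odd L - {(L, L)}) \<subseteq> low (of_int (2 * L\<^sup>2))"
  proof
    fix x assume x: "x \<in> insert (L + 1, 0) (cells_odd L - {(L, L)})"
    obtain i j where ij: "x = (i, j)" by (cases x)
    show "x \<in> low (of_int (2 * L\<^sup>2))"
    proof (cases "x = (L + 1, 0)")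
      case True
      have "3 * L \<le> L * L" using assms by (simp add: mult_right_mono)
      moreover have "(L + 1)\<^sup>2 = L * L + 2 * L + 1" "2 * L\<^sup>2 = 2 * (L * L)"
        by (simp_all add: power2_eq_square algebra_simps)
      ultimately have "(L + 1)\<^sup>2 < 2 * L\<^sup>2" using assms by linarith
      then show ?thesis unfolding True low_int_iff using assms by simp
    next
      case False
      then have c: "0 \<le> j" "j \<le> i" "i \<le> L" "(i, j) \<noteq> (L, L)" using x ij by (auto simp: cells_odd_def)
      then have "j < L" by auto
      have "i\<^sup>2 \<le> L\<^sup>2" "j\<^sup>2 < L\<^sup>2" using c \<open>j < L\<close> by (auto intro: power_mono power_strict_mono)
      then have "i\<^sup>2 + j\<^sup>2 < 2 * L\<^sup>2" by linarith
      then show ?thesis unfolding ij low_int_iff using c by simp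
    qed
  qed
  have "card (cells_odd L) \<le> card (insert (L + 1, 0) (cells_odd L - {(L, L)}))"
    using fin by (subst card_insert_disjoint) (auto simp: cells_odd_def card_Diff_singleton_if)
  also have "\<dots> \<le> card (low (of_int (2 * L\<^sup>2)))" by (rule card_mono[OF finite_low sub])
  finally show ?thesis .
qed

lemma nodal_domains_zext [simp]: "nodal_domains tri (zext f) = nodal_domains tri f"
proof -
  have "tri - zext f -` {0} = tri - f -` {0}" using tri_subset_ctri by (auto simp: zext_def)
  then show ?thesis by (simp add: nodal_domains_def)
qed

lemma nat_power_two_odd:
  assumes "0 < (n :: nat)" obtains k m where "n = 2 ^ k * m" "odd m"
proof -
  have "\<exists>k m. n = 2 ^ k * m \<and> odd m" using assms
  proof (induction n rule: less_induct)
    case (less n)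
    show ?case
    proof (cases "even n")
      case True
      then obtain h where h: "n = 2 * h" by (elim evenE)
      then obtain k m where "h = 2 ^ k * m" "odd m" using less by (metis mult_2 less_add_same_cancel1 nat_0_less_mult_iff)
      then show ?thesis using h by (intro exI[of _ "Suc k"] exI[of _ m]) simp
    next
      case False
      then show ?thesis by (intro exI[of _ 0] exI[of _ n]) simp
    qed
  qed
  then show ?thesis using that by blast
qed

text \<open>Each count exceeds by one the number of modes below 1, 2, 4 and 8 respectively, as given
  by \<open>card_low_small\<close>; this is Courant-sharpness of these four values.\<close>

lemma card_cells_small:
  "card (cells_even 1) = 2" "card (cells_odd 1) = 3" "card (cells_even 2) = 4" "card (cells_odd 2) = 6"
  unfolding cells_even_def cells_odd_def by code_simp+

lemma card_low_small:
  "card (low (of_int 0)) = 0" "card (low (of_int 1)) = 1" "card (low (of_int 2)) = 2" "card (low (of_int 4)) = 3" "card (low (of_int 8)) = 5"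
  unfolding low_explicit using card_modes_le by simp_all

lemma courant_sharp_mode:
  assumes l: "neumann_eigenvalue_listing tri lam" and "card (nodal_domains tri (md p)) = card (low (ev p)) + 1"
  shows "courant_sharp_eigenvalue tri lam (ev p)"
proof -
  have "zext (md p) (0, 0) \<noteq> 0" by (cases p) (simp add: zext_def md_def)
  then have "zext (md p) \<noteq> 0" by (metis zero_fun_def)
  then show ?thesis
    unfolding courant_sharp_eigenvalue_def courant_sharp_eigenfunction_def neumann_eigenfunction_def
    using assms md_eigenspace[of p] by (intro exI[of _ "zext (md p)"]) (simp add: counting_number_tri)
qed

lemma nodal_count_mode_power_two:
  assumes "p \<in> modes" "ev p = 2 ^ k"
  shows "k = 2 * i \<Longrightarrow> card (nodal_domains tri (md p)) = card (cells_even (2 ^ i))"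
    and "k = 2 * i + 1 \<Longrightarrow> card (nodal_domains tri (md p)) = card (cells_odd (2 ^ i))"
proof -
  have f: "md p z = (\<Sum>j\<in>level (2 ^ k). (if j = p then 1 else 0) * md j z)" for z
  proof -
    have "(\<Sum>j\<in>level (2 ^ k). (if j = p then 1 else 0) * md j z) = (\<Sum>j\<in>level (2 ^ k). if j = p then md p z else 0)"
      by (intro sum.cong) auto
    also have "p \<in> level (2 ^ k)" using assms by (simp add: level_def)
    then have "(\<Sum>j\<in>level (2 ^ k). if j = p then md p z else 0) = md p z" by (simp add: sum.delta)
    finally show ?thesis by simp
  qed
  have nz: "md p (0, 0) \<noteq> 0" by (cases p) (simp add: md_def)
  show "k = 2 * i \<Longrightarrow> card (nodal_domains tri (md p)) = card (cells_even (2 ^ i))"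
    "k = 2 * i + 1 \<Longrightarrow> card (nodal_domains tri (md p)) = card (cells_odd (2 ^ i))"
    by (rule nodal_count_power_two[OF f nz]; assumption)+
qed

theorem courant_sharp_tri:
  assumes l: "neumann_eigenvalue_listing tri lam"
  shows "courant_sharp_eigenvalue tri lam \<mu> \<longleftrightarrow> \<mu> \<in> {0, 1, 2, 4, 8}"
proof
  assume "\<mu> \<in> {0, 1, 2, 4, 8}"
  then consider "\<mu> = 0" | "\<mu> = 1" | "\<mu> = 2" | "\<mu> = 4" | "\<mu> = 8" by blast
  then show "courant_sharp_eigenvalue tri lam \<mu>"
  proof cases
    case 1
    have "tri - md (0, 0) -` {0} = tri" by (auto simp: md_def)
    then have "nodal_domains tri (md (0, 0)) = {tri}"
      unfolding nodal_domains_def using convex_connected[OF convex_tri] tri_nonempty by (simp add: components_eq_sing_iff)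
    then show ?thesis using courant_sharp_mode[OF l, of "(0, 0)"] card_low_small(1) 1 by (simp add: ev_def)
  next
    case 2
    have "card (nodal_domains tri (md (1, 0))) = card (cells_even (2 ^ 0))"
      by (rule nodal_count_mode_power_two(1)[of _ 0]) (simp_all add: modes_def ev_def)
    then have c: "card (nodal_domains tri (md (1, 0))) = card (cells_even 1)" by simp
    have e: "ev (1, 0) = of_int 1" by (simp add: ev_def)
    have "courant_sharp_eigenvalue tri lam (ev (1, 0))"
      by (rule courant_sharp_mode[OF l], unfold c e card_cells_small(1) card_low_small(2)) simp
    then show ?thesis using 2 by (simp add: e)
  next
    case 3
    have "card (nodal_domains tri (md (1, 1))) = card (cells_odd (2 ^ 0))"
      by (rule nodal_count_mode_power_two(2)[of _ 1]) (simp_all add: modes_def ev_def)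
    then have c: "card (nodal_domains tri (md (1, 1))) = card (cells_odd 1)" by simp
    have e: "ev (1, 1) = of_int 2" by (simp add: ev_def)
    have "courant_sharp_eigenvalue tri lam (ev (1, 1))"
      by (rule courant_sharp_mode[OF l], unfold c e card_cells_small(2) card_low_small(3)) simp
    then show ?thesis using 3 by (simp add: e)
  next
    case 4
    have "card (nodal_domains tri (md (2, 0))) = card (cells_even (2 ^ 1))"
      by (rule nodal_count_mode_power_two(1)[of _ 2]) (simp_all add: modes_def ev_def)
    then have c: "card (nodal_domains tri (md (2, 0))) = card (cells_even 2)" by simp
    have e: "ev (2, 0) = of_int 4" by (simp add: ev_def)
    have "courant_sharp_eigenvalue tri lam (ev (2, 0))"
      by (rule courant_sharp_mode[OF l], unfold c e card_cells_small(3) card_low_small(4)) simp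
    then show ?thesis using 4 by (simp add: e)
  next
    case 5
    have "card (nodal_domains tri (md (2, 2))) = card (cells_odd (2 ^ 1))"
      by (rule nodal_count_mode_power_two(2)[of _ 3]) (simp_all add: modes_def ev_def)
    then have c: "card (nodal_domains tri (md (2, 2))) = card (cells_odd 2)" by simp
    have e: "ev (2, 2) = of_int 8" by (simp add: ev_def)
    have "courant_sharp_eigenvalue tri lam (ev (2, 2))"
      by (rule courant_sharp_mode[OF l], unfold c e card_cells_small(4) card_low_small(5)) simp
    then show ?thesis using 5 by (simp add: e)
  qed
next
  assume "courant_sharp_eigenvalue tri lam \<mu>"
  then obtain \<phi> where "courant_sharp_eigenfunction tri lam \<mu> \<phi>"
    unfolding courant_sharp_eigenvalue_def by (elim exE)
  then have \<phi>: "\<phi> \<in> neumann_eigenspace tri \<mu>" "\<phi> \<noteq> 0" "card (nodal_domains tri \<phi>) = card (low \<mu>) + 1"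
    unfolding courant_sharp_eigenfunction_def neumann_eigenfunction_def counting_number_tri[OF l] by blast+
  obtain a where a: "\<phi> = zext (\<lambda>z. \<Sum>j\<in>level \<mu>. a j * md j z)" by (rule eigenspace_expansion[OF \<phi>(1)])
  define f where "f z = (\<Sum>j\<in>level \<mu>. a j * md j z)" for z
  have \<phi>f: "\<phi> = zext f" by (simp add: a f_def[abs_def])
  have card: "card (nodal_domains tri f) = card (low \<mu>) + 1" using \<phi>(3) by (simp add: \<phi>f)
  \<comment> \<open>An infinite set would have \<open>card\<close> 0, whereas the right side of
    \<open>card\<close> is positive.\<close>
  have fin: "finite (nodal_domains tri f)" using card card.infinite by fastforce
  obtain w where w: "f w \<noteq> 0"
  proof -
    have "\<exists>w. f w \<noteq> 0" using \<phi>(2) unfolding \<phi>f by (auto simp: fun_eq_iff zext_def split: if_splits)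
    then show ?thesis using that by blast
  qed
  then have "level \<mu> \<noteq> {}" by (auto simp: f_def)
  then obtain i j where "(i, j) \<in> level \<mu>" by auto
  then have \<mu>: "\<mu> = of_int (i\<^sup>2 + j\<^sup>2)" by (simp add: level_def ev_def)
  define n where "n = nat (i\<^sup>2 + j\<^sup>2)"
  have \<mu>n: "\<mu> = real n" unfolding \<mu> n_def by simp
  show "\<mu> \<in> {0, 1, 2, 4, 8}"
  proof (cases "n = 0")
    case True
    then show ?thesis by (simp add: \<mu>n)
  next
    case False
    then obtain k m where n: "n = 2 ^ k * m" "odd m" using nat_power_two_odd by blast
    have \<mu>k: "\<mu> = 2 ^ k * real m" by (simp add: \<mu>n n)
    show ?thesis
    proof (cases "m = 1")
      case False
      then have "3 \<le> m" using n(2) by (cases "m = 0"; cases "m = 2") auto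
      then have "card (nodal_domains tri f) \<le> card (low \<mu>)"
        using nodal_count_odd_part[OF n(2), where k = k and a = a] fin unfolding f_def[abs_def] \<mu>k by blast
      then show ?thesis using card by simp
    next
      case True
      then have \<mu>2: "\<mu> = 2 ^ k" by (simp add: \<mu>k)
      have fk: "f z = (\<Sum>j\<in>level (2 ^ k). a j * md j z)" for z unfolding f_def \<mu>2 ..
      note count = nodal_count_power_two[OF fk w]
      show ?thesis
      proof (cases "even k")
        case True
        then obtain i where k: "k = 2 * i" by (elim evenE)
        have sq: "\<mu> = of_int ((2 ^ i)\<^sup>2)" by (simp add: \<mu>2 k power_mult[symmetric] mult.commute)
        have c: "card (nodal_domains tri f) = card (cells_even (2 ^ i))" by (rule count(1)[OF k])
        show ?thesis
        proof (cases "2 \<le> i")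
          case True
          have "(2::int) ^ 2 \<le> 2 ^ i" using True by (intro power_increasing) auto
          moreover have "even ((2::int) ^ i)" using True by simp
          ultimately have "card (cells_even (2 ^ i)) \<le> card (low \<mu>)" unfolding sq by (intro cells_even_le_low) auto
          then show ?thesis using c card by simp
        next
          case False
          then have "i = 0 \<or> i = 1" by auto
          then show ?thesis using \<mu>2 k by auto
        qed
      next
        case False
        then obtain i where k: "k = 2 * i + 1" by (elim oddE)
        have sq: "\<mu> = of_int (2 * (2 ^ i)\<^sup>2)" by (simp add: \<mu>2 k power_mult[symmetric] mult.commute)
        have c: "card (nodal_domains tri f) = card (cells_odd (2 ^ i))" by (rule count(2)[OF k])
        show ?thesis
        proof (cases "2 \<le> i")
          case True
          have "(2::int) ^ 2 \<le> 2 ^ i" using True by (intro power_increasing) auto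
          then have "card (cells_odd (2 ^ i)) \<le> card (low \<mu>)" unfolding sq by (intro cells_odd_le_low) auto
          then show ?thesis using c card by simp
        next
          case False
          then have "i = 0 \<or> i = 1" by auto
          then show ?thesis using \<mu>2 k by auto
        qed
      qed
    qed
  qed
qed

section \<open>Invariance under similarities\<close>

lemma neumann_eigenspaceE:
  assumes "\<phi> \<in> neumann_eigenspace \<Omega> \<mu>"
  obtains g H where "\<And>x. x \<notin> closure \<Omega> \<Longrightarrow> \<phi> x = 0"
    "\<And>x. x \<in> closure \<Omega> \<Longrightarrow> (\<phi> has_derivative (\<lambda>h. g x \<bullet> h)) (at x within closure \<Omega>)"
    "continuous_on (closure \<Omega>) g"
    "\<And>x. x \<in> \<Omega> \<Longrightarrow> (g has_derivative H x) (at x)"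
    "\<And>h. continuous_on \<Omega> (\<lambda>x. H x h)"
    "\<And>x. x \<in> \<Omega> \<Longrightarrow> - (\<Sum>b\<in>Basis. H x b \<bullet> b) = \<mu> * \<phi> x"
    "\<And>x n. outward_unit_normal \<Omega> x n \<Longrightarrow> g x \<bullet> n = 0"
  using assms unfolding neumann_eigenspace_def by blast

text \<open>\<open>M\<close> is the adjoint of \<open>L\<close>, and \<open>M_L\<close> says that
  \<open>L\<close> is \<open>sqrt c\<close> times an isometry. Domain and codomain are different
  types because the model triangle lives in \<open>real \<times> real\<close> and
  \<open>\<Omega>\<close> in \<open>real^2\<close>.\<close>

locale similarity =
  fixes L :: "'a::euclidean_space \<Rightarrow> 'b::euclidean_space" and M :: "'b \<Rightarrow> 'a" and b :: 'b and c :: real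
  assumes linear_L: "linear L" and linear_M: "linear M" and c: "0 < c"
    and adjoint: "L x \<bullet> y = x \<bullet> M y"
    and M_L: "M (L x) = c *\<^sub>R x" and L_M: "L (M y) = c *\<^sub>R y"
begin

definition A :: "'a \<Rightarrow> 'b" where "A x = b + L x"
definition A' :: "'b \<Rightarrow> 'a" where "A' y = (1 / c) *\<^sub>R M (y - b)"

lemma A'_A [simp]: "A' (A x) = x" using c by (simp add: A_def A'_def M_L)
lemma A_A' [simp]: "A (A' y) = y" using c by (simp add: A_def A'_def L_M linear_scale[OF linear_L])

lemma continuous_L: "continuous_on S L" and continuous_M: "continuous_on T M"
  using linear_L linear_M by (auto intro: linear_continuous_on simp: linear_conv_bounded_linear)

lemma continuous_A [continuous_intros]: "continuous_on S A" and continuous_A' [continuous_intros]: "continuous_on T A'"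
  unfolding A_def[abs_def] A'_def[abs_def]
  by (intro continuous_intros continuous_L continuous_on_compose2[OF continuous_M[of UNIV]]; simp)+

lemma A_image_iff: "y \<in> A ` S \<longleftrightarrow> A' y \<in> S" by (metis A'_A A_A' imageE imageI)
lemma A_mem_iff: "A x \<in> A ` S \<longleftrightarrow> x \<in> S" by (simp add: A_image_iff)

lemma A'_image: "A' ` A ` S = S" by (simp add: image_image)

lemma closure_image: "closure (A ` S) = A ` closure S"
proof
  have "A' ` closure (A ` S) \<subseteq> closure S"
    by (rule image_closure_subset) (auto intro!: continuous_intros closure_subset[THEN subsetD] simp: A'_image)
  then show "closure (A ` S) \<subseteq> A ` closure S" by (auto simp: A_image_iff)
  show "A ` closure S \<subseteq> closure (A ` S)"
    by (rule image_closure_subset) (auto intro!: continuous_intros closure_subset[THEN subsetD])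
qed

lemma image_Compl: "- A ` S = A ` (- S)" by (rule set_eqI) (simp only: A_image_iff Compl_iff)

lemma interior_image: "interior (A ` S) = A ` interior S"
  unfolding interior_closure image_Compl closure_image ..

lemma A_diff: "A y - A x = L (y - x)" by (simp add: A_def linear_diff[OF linear_L])

lemma norm_L: "norm (L x) = sqrt c * norm x"
proof -
  have "(norm (L x))\<^sup>2 = c * (norm x)\<^sup>2"
    unfolding power2_norm_eq_inner adjoint M_L by simp
  then have "sqrt ((norm (L x))\<^sup>2) = sqrt (c * (norm x)\<^sup>2)" by simp
  then show ?thesis by (simp add: real_sqrt_mult)
qed

text \<open>Dividing \<open>L n\<close> by \<open>sqrt c\<close> restores unit length, and both
  sides of each cone inequality are then multiplied by the same factor \<open>sqrt c\<close>, so the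
  cones correspond with the same opening \<open>e\<close>.\<close>

lemma normal_image:
  assumes "outward_unit_normal \<Omega> x n"
  shows "outward_unit_normal (A ` \<Omega>) (A x) ((1 / sqrt c) *\<^sub>R L n)"
  unfolding outward_unit_normal_def
proof (intro conjI allI impI)
  show "A x \<in> frontier (A ` \<Omega>)"
    using assms unfolding outward_unit_normal_def frontier_def closure_image interior_image by (auto simp: A_mem_iff)
  show "norm ((1 / sqrt c) *\<^sub>R L n) = 1"
    using assms c by (simp add: norm_L outward_unit_normal_def)
  fix e :: real assume e: "0 < e"
  let ?n = "(1 / sqrt c) *\<^sub>R L n"
  have lim: "filterlim A' (at x) (at (A x))"
  proof (rule filterlim_atI)
    have "isCont A' (A x)" using continuous_A'[of UNIV] by (simp add: continuous_on_eq_continuous_at)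
    then show "filterlim A' (nhds x) (at (A x))" by (simp add: isCont_def)
    show "\<forall>\<^sub>F y in at (A x). A' y \<noteq> x"
      unfolding eventually_at by (intro exI[of _ 1]) auto
  qed
  have "\<forall>\<^sub>F y in at x. (n \<bullet> (y - x) < - e * norm (y - x) \<longrightarrow> y \<in> \<Omega>) \<and> (n \<bullet> (y - x) > e * norm (y - x) \<longrightarrow> y \<notin> \<Omega>)"
    using assms e by (simp add: outward_unit_normal_def)
  from eventually_compose_filterlim[OF this lim]
  show "\<forall>\<^sub>F y in at (A x). (?n \<bullet> (y - A x) < - e * norm (y - A x) \<longrightarrow> y \<in> A ` \<Omega>) \<and> (?n \<bullet> (y - A x) > e * norm (y - A x) \<longrightarrow> y \<notin> A ` \<Omega>)"
  proof eventually_elim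
    case (elim y)
    define v where "v = A' y - x"
    have y: "y - A x = L v" using A_diff[of "A' y" x] by (simp add: v_def)
    have i: "?n \<bullet> (y - A x) = sqrt c * (n \<bullet> v)"
    proof -
      have "?n \<bullet> (y - A x) = (1 / sqrt c) * (c * (n \<bullet> v))" unfolding y by (simp add: adjoint M_L)
      also have "\<dots> = sqrt c * (n \<bullet> v)" using real_sqrt_mult_self[of c] c by (simp add: field_simps)
      finally show ?thesis .
    qed
    have nn: "norm (y - A x) = sqrt c * norm v" unfolding y by (rule norm_L)
    have s: "0 < sqrt c" using c by simp
    have "?n \<bullet> (y - A x) < - e * norm (y - A x) \<longleftrightarrow> n \<bullet> v < - e * norm v"
      unfolding i nn mult.left_commute[of _ "sqrt c"] mult_less_cancel_left_pos[OF s] ..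
    moreover have "?n \<bullet> (y - A x) > e * norm (y - A x) \<longleftrightarrow> n \<bullet> v > e * norm v"
      unfolding i nn mult.left_commute[of _ "sqrt c"] mult_less_cancel_left_pos[OF s] ..
    ultimately show ?case using elim unfolding v_def A_image_iff by blast
  qed
qed

text \<open>Cyclicity of the trace: the trace of \<open>M H L\<close> is that of
  \<open>H L M\<close>, and \<open>L M\<close> is multiplication by \<open>c\<close>. Applied to the
  Hessian it shows that pulling back multiplies the Laplacian by \<open>c\<close>.\<close>

lemma trace_similarity:
  assumes "linear H"
  shows "(\<Sum>i\<in>Basis. M (H (L i)) \<bullet> i) = c * (\<Sum>j\<in>Basis. H j \<bullet> j)"
proof -
  have "(\<Sum>i\<in>Basis. M (H (L i)) \<bullet> i) = (\<Sum>i\<in>Basis. \<Sum>j\<in>Basis. (i \<bullet> M j) * (M (H j) \<bullet> i))"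
  proof (rule sum.cong[OF refl])
    fix i :: 'a assume "i \<in> Basis"
    have "H (L i) = H (\<Sum>j\<in>Basis. (L i \<bullet> j) *\<^sub>R j)" by (simp only: euclidean_representation)
    also have "\<dots> = (\<Sum>j\<in>Basis. (i \<bullet> M j) *\<^sub>R H j)"
      by (simp add: linear_sum[OF assms] linear_scale[OF assms] adjoint)
    finally have "M (H (L i)) = (\<Sum>j\<in>Basis. (i \<bullet> M j) *\<^sub>R M (H j))"
      by (simp add: linear_sum[OF linear_M] linear_scale[OF linear_M])
    then show "M (H (L i)) \<bullet> i = (\<Sum>j\<in>Basis. (i \<bullet> M j) * (M (H j) \<bullet> i))" by (simp add: inner_sum_left)
  qed
  also have "\<dots> = (\<Sum>j\<in>Basis. \<Sum>i\<in>Basis. (i \<bullet> M j) * (M (H j) \<bullet> i))" by (rule sum.swap)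
  also have "\<dots> = (\<Sum>j\<in>Basis. M (H j) \<bullet> M j)"
    by (intro sum.cong refl, subst (2) euclidean_inner) (simp add: inner_commute mult.commute)
  also have "\<dots> = (\<Sum>j\<in>Basis. c * (H j \<bullet> j))"
  proof (rule sum.cong[OF refl])
    fix j show "M (H j) \<bullet> M j = c * (H j \<bullet> j)"
      using adjoint[of "M (H j)" j] by (simp add: L_M)
  qed
  finally show ?thesis by (simp add: sum_distrib_left)
qed

lemma eigenspace_pullback:
  assumes "\<phi> \<in> neumann_eigenspace (A ` \<Omega>) \<mu>"
  shows "(\<lambda>x. \<phi> (A x)) \<in> neumann_eigenspace \<Omega> (c * \<mu>)"
proof -
  from assms obtain g H where 0: "\<And>x. x \<notin> closure (A ` \<Omega>) \<Longrightarrow> \<phi> x = 0" and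
    1: "\<And>x. x \<in> closure (A ` \<Omega>) \<Longrightarrow> (\<phi> has_derivative (\<lambda>h. g x \<bullet> h)) (at x within closure (A ` \<Omega>))" and
    2: "continuous_on (closure (A ` \<Omega>)) g" and
    3: "\<And>x. x \<in> A ` \<Omega> \<Longrightarrow> (g has_derivative H x) (at x)" and
    4: "\<And>h. continuous_on (A ` \<Omega>) (\<lambda>x. H x h)" and
    5: "\<And>x. x \<in> A ` \<Omega> \<Longrightarrow> - (\<Sum>b\<in>Basis. H x b \<bullet> b) = \<mu> * \<phi> x" and
    6: "\<And>x n. outward_unit_normal (A ` \<Omega>) x n \<Longrightarrow> g x \<bullet> n = 0"
    by (rule neumann_eigenspaceE) (rule that)
  have dL: "(A has_derivative L) F" for F
    unfolding A_def[abs_def] using linear_L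
    by (auto intro!: derivative_eq_intros bounded_linear.has_derivative[of L "\<lambda>x. x"] simp: linear_conv_bounded_linear)
  have bM: "bounded_linear M" using linear_M by (simp add: linear_conv_bounded_linear)
  show ?thesis
    unfolding neumann_eigenspace_def mem_Collect_eq
  proof (intro conjI exI[of _ "\<lambda>x. M (g (A x))"] exI[of _ "\<lambda>x h. M (H (A x) (L h))"] allI impI ballI)
    fix x assume "x \<notin> closure \<Omega>"
    then show "\<phi> (A x) = 0" by (intro 0) (simp add: closure_image A_mem_iff)
  next
    fix x assume x: "x \<in> closure \<Omega>"
    have "(\<phi> has_derivative (\<lambda>h. g (A x) \<bullet> h)) (at (A x) within A ` closure \<Omega>)"
      using 1[of "A x"] x by (simp add: closure_image A_mem_iff)
    from has_derivative_in_compose[OF dL this]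
    show "((\<lambda>x. \<phi> (A x)) has_derivative (\<lambda>h. M (g (A x)) \<bullet> h)) (at x within closure \<Omega>)"
      by (simp add: inner_commute[of "g _"] adjoint) (simp add: inner_commute)
  next
    show "continuous_on (closure \<Omega>) (\<lambda>x. M (g (A x)))"
      by (intro continuous_on_compose2[OF continuous_M[of UNIV]] continuous_on_compose2[OF 2] continuous_A)
        (auto simp: closure_image)
  next
    fix x assume x: "x \<in> \<Omega>"
    have "(g has_derivative H (A x)) (at (A x))" using 3 x by blast
    from has_derivative_compose[OF dL this]
    have "((\<lambda>x. g (A x)) has_derivative (\<lambda>h. H (A x) (L h))) (at x)" .
    then show "((\<lambda>x. M (g (A x))) has_derivative (\<lambda>h. M (H (A x) (L h)))) (at x)"
      by (rule bounded_linear.has_derivative[OF bM])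
    have "linear (H (A x))" using 3[of "A x"] x has_derivative_linear by blast
    then show "- (\<Sum>b\<in>Basis. M (H (A x) (L b)) \<bullet> b) = c * \<mu> * \<phi> (A x)"
    proof -
      have "(\<Sum>b\<in>Basis. H (A x) b \<bullet> b) = - (\<mu> * \<phi> (A x))" using 5[of "A x"] x by simp
      then show ?thesis unfolding trace_similarity[OF \<open>linear (H (A x))\<close>] by simp
    qed
  next
    fix h show "continuous_on \<Omega> (\<lambda>x. M (H (A x) (L h)))"
      by (intro continuous_on_compose2[OF continuous_M[of UNIV]] continuous_on_compose2[OF 4] continuous_A) auto
  next
    fix x n assume "outward_unit_normal \<Omega> x n"
    from 6[OF normal_image[OF this]] have "L n \<bullet> g (A x) = 0" using c by (simp add: inner_commute)
    then show "M (g (A x)) \<bullet> n = 0" by (simp add: adjoint inner_commute)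
  qed
qed

text \<open>The inverse map is a similarity as well; interpreting the locale with it turns the
  one-way transport \<open>eigenspace_pullback\<close> into an equivalence.\<close>

lemma similarity_inverse: "similarity (\<lambda>y. (1 / c) *\<^sub>R M y) (\<lambda>x. (1 / c) *\<^sub>R L x) (1 / c)"
proof (rule similarity.intro)
  show "linear (\<lambda>y. (1 / c) *\<^sub>R M y)" "linear (\<lambda>x. (1 / c) *\<^sub>R L x)"
    using linear_L linear_M by (auto intro!: linear_compose_scale_right)
  show "0 < 1 / c" using c by simp
  show "(1 / c) *\<^sub>R M y \<bullet> x = y \<bullet> (1 / c) *\<^sub>R L x" for x y
    using adjoint[of x y] by (simp add: inner_commute)
  show "(1 / c) *\<^sub>R L ((1 / c) *\<^sub>R M y) = (1 / c) *\<^sub>R y" for y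
    using c by (simp add: linear_scale[OF linear_L] L_M)
  show "(1 / c) *\<^sub>R M ((1 / c) *\<^sub>R L x) = (1 / c) *\<^sub>R x" for x
    using c by (simp add: linear_scale[OF linear_M] M_L)
qed

lemma eigenspace_iff:
  "(\<lambda>x. \<phi> (A x)) \<in> neumann_eigenspace \<Omega> (c * \<mu>) \<longleftrightarrow> \<phi> \<in> neumann_eigenspace (A ` \<Omega>) \<mu>"
proof
  interpret inv: similarity "\<lambda>y. (1 / c) *\<^sub>R M y" "\<lambda>x. (1 / c) *\<^sub>R L x" "- (1 / c) *\<^sub>R M b" "1 / c"
    by (rule similarity_inverse)
  have A: "inv.A = A'"
    unfolding inv.A_def[abs_def] A'_def[abs_def] by (simp add: linear_diff[OF linear_M] scaleR_right_diff_distrib)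
  assume "(\<lambda>x. \<phi> (A x)) \<in> neumann_eigenspace \<Omega> (c * \<mu>)"
  then have "(\<lambda>x. \<phi> (A x)) \<in> neumann_eigenspace (inv.A ` A ` \<Omega>) (c * \<mu>)" unfolding A A'_image .
  from inv.eigenspace_pullback[OF this] show "\<phi> \<in> neumann_eigenspace (A ` \<Omega>) \<mu>" using c unfolding A by simp
qed (rule eigenspace_pullback)

lemma components_image: "components (A ` S) = (`) A ` components S"
proof -
  \<comment> \<open>Stated for an arbitrary pair \<open>f\<close>, \<open>g\<close>, since it is
    used once for \<open>A\<close> and once for its inverse \<open>A'\<close>.\<close>
  have image_comp: "f ` D \<in> components (f ` T)"
    if fg: "continuous_on UNIV f" "continuous_on UNIV g" "\<And>x. g (f x) = x" and D: "D \<in> components T"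
    for f :: "'x::topological_space \<Rightarrow> 'y::topological_space" and g D T
    unfolding in_components_maximal
  proof (intro conjI allI impI)
    show "f ` D \<noteq> {}" "f ` D \<subseteq> f ` T" using in_components_nonempty[OF D] in_components_subset[OF D] by auto
    show "connected (f ` D)" using connected_continuous_image[OF continuous_on_subset[OF fg(1)] in_components_connected[OF D]] by simp
    fix d assume d: "d \<noteq> {} \<and> f ` D \<subseteq> d \<and> d \<subseteq> f ` T \<and> connected d"
    have "connected (g ` d)" using connected_continuous_image[OF continuous_on_subset[OF fg(2)]] d by blast
    moreover have "g ` d \<subseteq> T" "D \<subseteq> g ` d" using d fg(3) by (force simp: image_iff subset_iff)+
    ultimately have "g ` d = D" using D d unfolding in_components_maximal by (metis image_is_empty)
    moreover have "f (g y) = y" if "y \<in> d" for y using that d fg(3) by force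
    ultimately show "d = f ` D" by force
  qed
  show ?thesis
  proof
    show "(`) A ` components S \<subseteq> components (A ` S)"
      using image_comp[OF continuous_A continuous_A'] by auto
    show "components (A ` S) \<subseteq> (`) A ` components S"
    proof
      fix C assume "C \<in> components (A ` S)"
      then have "A' ` C \<in> components S" using image_comp[OF continuous_A' continuous_A, of C "A ` S"] by (simp add: A'_image)
      moreover have "C = A ` A' ` C" by (simp add: image_image)
      ultimately show "C \<in> (`) A ` components S" by blast
    qed
  qed
qed

lemma card_nodal_domains_image: "card (nodal_domains (A ` \<Omega>) \<phi>) = card (nodal_domains \<Omega> (\<lambda>x. \<phi> (A x)))"
proof -
  have "A ` \<Omega> - \<phi> -` {0} = A ` (\<Omega> - (\<lambda>x. \<phi> (A x)) -` {0})" by auto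
  then have "nodal_domains (A ` \<Omega>) \<phi> = (`) A ` nodal_domains \<Omega> (\<lambda>x. \<phi> (A x))"
    by (simp add: nodal_domains_def components_image)
  moreover have "inj ((`) A)" by (rule inj_on_inverseI[of _ "(`) A'"]) (simp add: A'_image)
  ultimately show ?thesis by (simp add: card_image inj_on_subset)
qed

lemma courant_sharp_image:
  "courant_sharp_eigenvalue (A ` \<Omega>) lam \<mu> \<longleftrightarrow> courant_sharp_eigenvalue \<Omega> (\<lambda>j. c * lam j) (c * \<mu>)"
proof -
  have N: "counting_number (\<lambda>j. c * lam j) (c * \<mu>) = counting_number lam \<mu>"
    using c by (simp add: counting_number_def)
  have nz: "(\<lambda>x. \<phi> (A x)) \<noteq> 0 \<longleftrightarrow> \<phi> \<noteq> 0" for \<phi> :: "'b \<Rightarrow> real"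
  proof
    assume "\<phi> \<noteq> 0"
    then obtain y where "\<phi> y \<noteq> 0" by (auto simp: fun_eq_iff)
    then show "(\<lambda>x. \<phi> (A x)) \<noteq> 0" using A_A'[of y] by (metis zero_fun_def)
  qed (auto simp: fun_eq_iff)
  have *: "courant_sharp_eigenfunction (A ` \<Omega>) lam \<mu> \<phi> \<longleftrightarrow> courant_sharp_eigenfunction \<Omega> (\<lambda>j. c * lam j) (c * \<mu>) (\<lambda>x. \<phi> (A x))" for \<phi>
    using eigenspace_iff[of \<phi> \<Omega> \<mu>] nz[of \<phi>] card_nodal_domains_image[of \<Omega> \<phi>]
    by (simp only: courant_sharp_eigenfunction_def neumann_eigenfunction_def N)
  show ?thesis
  proof
    assume "courant_sharp_eigenvalue (A ` \<Omega>) lam \<mu>"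
    then show "courant_sharp_eigenvalue \<Omega> (\<lambda>j. c * lam j) (c * \<mu>)" unfolding courant_sharp_eigenvalue_def * by blast
  next
    assume "courant_sharp_eigenvalue \<Omega> (\<lambda>j. c * lam j) (c * \<mu>)"
    then obtain \<psi> where "courant_sharp_eigenfunction \<Omega> (\<lambda>j. c * lam j) (c * \<mu>) \<psi>" unfolding courant_sharp_eigenvalue_def by blast
    then have "courant_sharp_eigenfunction (A ` \<Omega>) lam \<mu> (\<lambda>y. \<psi> (A' y))" unfolding * by simp
    then show "courant_sharp_eigenvalue (A ` \<Omega>) lam \<mu>" unfolding courant_sharp_eigenvalue_def by blast
  qed
qed

text \<open>Pulling back along \<open>A\<close> is an injective linear map of function spaces that
  takes the eigenspace for \<open>\<nu> / c\<close> onto the one for \<open>\<nu>\<close>, so it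
  takes bases to bases and preserves multiplicities.\<close>

lemma listing_image:
  assumes "neumann_eigenvalue_listing (A ` \<Omega>) lam"
  shows "neumann_eigenvalue_listing \<Omega> (\<lambda>j. c * lam j)"
  unfolding neumann_eigenvalue_listing_def
proof (intro conjI allI)
  show "mono_on {1..} (\<lambda>j. c * lam j)"
    using assms c unfolding neumann_eigenvalue_listing_def mono_on_def by (auto intro: mult_left_mono)
  fix \<nu> :: real
  obtain B where B: "finite B" "fun_space.independent B" "fun_space.span B = neumann_eigenspace (A ` \<Omega>) (\<nu> / c)"
    "finite {j. 1 \<le> j \<and> lam j = \<nu> / c}" "card {j. 1 \<le> j \<and> lam j = \<nu> / c} = card B"
    using assms unfolding neumann_eigenvalue_listing_def by blast
  interpret pb: Vector_Spaces.linear "\<lambda>(c::real) (f::'b \<Rightarrow> real) x. c * f x" "\<lambda>(c::real) (f::'a \<Rightarrow> real) x. c * f x" "\<lambda>\<phi> x. \<phi> (A x)"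
    by unfold_locales (auto simp: fun_eq_iff plus_fun_def)
  have inj: "inj (\<lambda>(\<phi>::'b \<Rightarrow> real) x. \<phi> (A x))"
    by (rule inj_on_inverseI[of _ "\<lambda>\<psi> y. \<psi> (A' y)"]) simp
  have js: "{j. 1 \<le> j \<and> c * lam j = \<nu>} = {j. 1 \<le> j \<and> lam j = \<nu> / c}" using c by (auto simp: field_simps)
  show "\<exists>B. finite B \<and> fun_space.independent B \<and> fun_space.span B = neumann_eigenspace \<Omega> \<nu> \<and>
        finite {j. 1 \<le> j \<and> c * lam j = \<nu>} \<and> card {j. 1 \<le> j \<and> c * lam j = \<nu>} = card B"
  proof (intro exI[of _ "(\<lambda>\<phi> x. \<phi> (A x)) ` B"] conjI)
    show "fun_space.independent ((\<lambda>\<phi> x. \<phi> (A x)) ` B)" by (rule pb.independent_inj_image[OF B(2) inj])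
    show "fun_space.span ((\<lambda>\<phi> x. \<phi> (A x)) ` B) = neumann_eigenspace \<Omega> \<nu>"
      unfolding pb.span_image B(3)
    proof
      have \<nu>: "c * (\<nu> / c) = \<nu>" using c by simp
      show "(\<lambda>\<phi> x. \<phi> (A x)) ` neumann_eigenspace (A ` \<Omega>) (\<nu> / c) \<subseteq> neumann_eigenspace \<Omega> \<nu>"
        using eigenspace_pullback[of _ \<Omega> "\<nu> / c"] unfolding \<nu> by blast
      show "neumann_eigenspace \<Omega> \<nu> \<subseteq> (\<lambda>\<phi> x. \<phi> (A x)) ` neumann_eigenspace (A ` \<Omega>) (\<nu> / c)"
      proof
        fix \<psi> assume "\<psi> \<in> neumann_eigenspace \<Omega> \<nu>"
        then have "(\<lambda>y. \<psi> (A' y)) \<in> neumann_eigenspace (A ` \<Omega>) (\<nu> / c)"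
          using eigenspace_iff[of "\<lambda>y. \<psi> (A' y)" \<Omega> "\<nu> / c"] unfolding \<nu> by simp
        then show "\<psi> \<in> (\<lambda>\<phi> x. \<phi> (A x)) ` neumann_eigenspace (A ` \<Omega>) (\<nu> / c)"
          by (rule rev_image_eqI) simp
      qed
    qed
  qed (use B js inj in \<open>auto simp: card_image inj_on_subset\<close>)
qed

end

section \<open>Every isosceles right triangle is similar to the model\<close>

lemma ctri_convex_hull: "ctri = convex hull {(0, 0), (pi, 0), (pi, pi)}"
proof
  show "convex hull {(0, 0), (pi, 0), (pi, pi)} \<subseteq> ctri"
    by (rule hull_minimal) (auto simp: closure_tri[symmetric] convex_closure simp del: closure_tri, simp_all)
  show "ctri \<subseteq> convex hull {(0, 0), (pi, 0), (pi, pi)}"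
  proof
    fix z assume "z \<in> ctri"
    then obtain x y where z: "z = (x, y)" "0 \<le> y" "y \<le> x" "x \<le> pi" by (cases z) auto
    have "z = (1 - x / pi) *\<^sub>R (0, 0) + ((x - y) / pi) *\<^sub>R (pi, 0) + (y / pi) *\<^sub>R (pi, pi)"
      using z by (simp add: field_simps)
    moreover have "0 \<le> 1 - x / pi" "0 \<le> (x - y) / pi" "0 \<le> y / pi" "1 - x / pi + (x - y) / pi + y / pi = 1"
      using z by (auto simp: field_simps)
    ultimately show "z \<in> convex hull {(0, 0), (pi, 0), (pi, pi)}" unfolding convex_hull_3 by blast
  qed
qed

lemma isosceles_right_triangle_similar:
  assumes "isosceles_right_triangle \<Omega>"
  obtains L M b c where "similarity L M c" "\<Omega> = similarity.A L b ` tri"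
proof -
  obtain p q r :: "real^2" where t: "p \<noteq> q" "(q - p) \<bullet> (r - p) = 0" "dist p q = dist p r" and \<Omega>: "\<Omega> = interior (convex hull {p, q, r})"
    using assms unfolding isosceles_right_triangle_def by blast
  \<comment> \<open>The right angle of the model is at \<open>(pi, 0)\<close>. Hence
    \<open>q\<close>, \<open>p\<close>, \<open>r\<close> are to be the images of
    \<open>(0, 0)\<close>, \<open>(pi, 0)\<close>, \<open>(pi, pi)\<close>, and the legs
    \<open>p - q\<close> and \<open>r - p\<close> are divided by the model length
    \<open>pi\<close>.\<close>
  define u where "u = (1 / pi) *\<^sub>R (p - q)"
  define w where "w = (1 / pi) *\<^sub>R (r - p)"
  define L where "L z = fst z *\<^sub>R u + snd z *\<^sub>R w" for z
  define M where "M y = (y \<bullet> u, y \<bullet> w)" for y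
  define c where "c = u \<bullet> u"
  have "(p - q) \<bullet> (r - p) = 0" using t(2) by (simp add: inner_diff_left)
  then have uw: "u \<bullet> w = 0" by (simp add: u_def w_def)
  have "norm (p - q) = norm (r - p)" using t(3) by (simp add: dist_norm norm_minus_commute)
  then have "norm u = norm w" by (simp add: u_def w_def)
  then have ww: "w \<bullet> w = c" by (simp add: c_def norm_eq)
  have c0: "0 < c" using t(1) by (simp add: c_def u_def)
  have lL: "linear L" unfolding L_def by (rule linearI) (auto simp: algebra_simps)
  have M_L: "M (L z) = c *\<^sub>R z" for z
    using uw ww by (cases z) (simp add: M_def L_def c_def inner_add_left inner_commute[of w u])
  \<comment> \<open>\<open>L\<close> is injective by \<open>M_L\<close>, so onto by equality of
    dimensions; the identity for \<open>L (M y)\<close> then follows by writing \<open>y\<close> as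
    an image.\<close>
  have sL: "range L = UNIV"
  proof -
    have "inj L" using M_L c0 by (metis injI real_vector.scale_cancel_left less_irrefl)
    then have "dim (L ` UNIV) = dim (UNIV :: (real \<times> real) set)"
      by (intro dim_image_eq[OF lL]) (auto intro: inj_on_subset)
    then have "dim (range L) = DIM(real^2)" by simp
    then have "span (range L) = UNIV" by (simp only: dim_eq_full)
    then show ?thesis using linear_subspace_image[OF lL subspace_UNIV] by (metis span_eq_iff)
  qed
  have L_M: "L (M y) = c *\<^sub>R y" for y
  proof -
    obtain z where "y = L z" using sL by (metis rangeE UNIV_I)
    then show ?thesis by (simp add: M_L linear_scale[OF lL])
  qed
  interpret sim: similarity L M q c
  proof (rule similarity.intro)
    show "linear M" unfolding M_def by (rule linearI) (auto simp: inner_add_left)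
    show "L x \<bullet> y = x \<bullet> M y" for x y
      by (simp add: L_def M_def inner_prod_def inner_add_left inner_commute[of y])
  qed (use lL c0 M_L L_M in auto)
  have v: "sim.A (0, 0) = q" "sim.A (pi, 0) = p" "sim.A (pi, pi) = r"
    by (simp_all add: sim.A_def L_def u_def w_def)
  have "sim.A ` S = (\<lambda>x. q + x) ` L ` S" for S by (auto simp: sim.A_def)
  then have "sim.A ` (convex hull {(0, 0), (pi, 0), (pi, pi)}) = convex hull (sim.A ` {(0, 0), (pi, 0), (pi, pi)})"
    by (simp only: convex_hull_linear_image[OF lL] convex_hull_translation)
  also have "sim.A ` {(0, 0), (pi, 0), (pi, pi)} = {p, q, r}" using v by auto
  finally have "\<Omega> = sim.A ` interior ctri" unfolding \<Omega> ctri_convex_hull sim.interior_image[symmetric] by simp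
  also have "interior ctri = tri"
    using convex_interior_closure[OF convex_tri] by (simp add: interior_open)
  finally show ?thesis using that[OF sim.similarity_axioms] by simp
qed

theorem theorem1p1:
  fixes \<Omega> :: "(real^2) set" and lam :: "nat \<Rightarrow> real"
  assumes "isosceles_right_triangle \<Omega>"
    and "neumann_eigenvalue_listing \<Omega> lam"
  shows "{\<mu>. courant_sharp_eigenvalue \<Omega> lam \<mu>} = {lam 1, lam 2, lam 3, lam 4, lam 6}"
proof -
  obtain L M b c where "similarity L M c" and \<Omega>: "\<Omega> = similarity.A L b ` tri"
    by (rule isosceles_right_triangle_similar[OF assms(1)])
  then interpret similarity L M b c by simp
  have l: "neumann_eigenvalue_listing tri (\<lambda>j. c * lam j)"
    using assms(2) unfolding \<Omega> by (rule listing_image)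
  \<comment> \<open>The fifth eigenvalue of \<open>tri\<close> is 5, which is its own odd part and
    thus excluded; the sixth is 8. This is why index 5 is skipped.\<close>
  have v: "{0, 1, 2, 4, 8} = (*) c ` {lam 1, lam 2, lam 3, lam 4, lam 6}"
    using listing_values[OF l] by (simp only: image_insert image_empty)
  have "courant_sharp_eigenvalue \<Omega> lam \<mu> \<longleftrightarrow> c * \<mu> \<in> (*) c ` {lam 1, lam 2, lam 3, lam 4, lam 6}" for \<mu>
    unfolding \<Omega> courant_sharp_image courant_sharp_tri[OF l] v ..
  then show ?thesis using c by (auto simp: image_iff)
qed

end
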